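(* Let $T$ be a bounded linear operator on an infinite-dimensional, reflexive complex Banach space $X$. Then $T$ admits an almost-invariant half-space with defect one.
   Context: All Banach spaces are complex and all subspaces are norm closed. A subspace $Y\subseteq X$ is called almost-invariant for $T$ if there is a finite-dimensional subspace $M\subseteq X$ such that $TY\subseteq Y+M$; the minimal dimension of such an $M$ is called the defect of $Y$ for $T$. A half-space of $X$ is a subspace that has both infinite dimension and infinite codimension in $X$. An almost-invariant half-space for $T$ is a half-space that is almost-invariant for $T$.
   Formalization: For scalar multiples of the identity every subspace is invariant, so every half-space has defect zero and "defect one" fails; the result proved gives defect at most one for every operator and defect exactly one for every operator that is not a scalar multiple of the identity. *)

theory Defs
  imports "HOL-Analysis.Analysis"
begin

text \<open>The real structure comes from the library classes; the complex scalar multiplication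
  extends it and the norm is homogeneous over the complex numbers.\<close>

class complex_normed_vector = real_normed_vector +
  fixes scaleC :: "complex \<Rightarrow> 'a \<Rightarrow> 'a" (infixr \<open>*\<^sub>C\<close> 75)
  assumes scaleC_add_right: "c *\<^sub>C (x + y) = c *\<^sub>C x + c *\<^sub>C y"
    and scaleC_add_left: "(c + d) *\<^sub>C x = c *\<^sub>C x + d *\<^sub>C x"
    and scaleC_scaleC: "c *\<^sub>C d *\<^sub>C x = (c * d) *\<^sub>C x"
    and scaleC_one: "1 *\<^sub>C x = x"
    and scaleC_of_real: "complex_of_real r *\<^sub>C x = r *\<^sub>R x"
    and norm_scaleC: "norm (c *\<^sub>C x) = cmod c * norm x"

class complex_banach = complex_normed_vector + banach

instantiation complex :: complex_banach
begin

definition scaleC_complex :: "complex \<Rightarrow> complex \<Rightarrow> complex"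
  where "scaleC_complex c z = c * z"

instance
  by standard (simp_all add: scaleC_complex_def algebra_simps norm_mult scaleR_conv_of_real)

end

global_interpretation complex_vector: vector_space
  "scaleC :: complex \<Rightarrow> 'a \<Rightarrow> 'a::complex_normed_vector"
  by standard (simp_all add: scaleC_add_right scaleC_add_left scaleC_scaleC scaleC_one)

definition bounded_clinear ::
    "('a::complex_normed_vector \<Rightarrow> 'b::complex_normed_vector) \<Rightarrow> bool"
  where "bounded_clinear f \<longleftrightarrow>
    Vector_Spaces.linear scaleC scaleC f \<and> (\<exists>K. \<forall>x. norm (f x) \<le> K * norm x)"

definition closed_csubspace :: "'a::complex_normed_vector set \<Rightarrow> bool"
  where "closed_csubspace Y \<longleftrightarrow> complex_vector.subspace Y \<and> closed Y"

definition finite_cdim :: "'a::complex_normed_vector set \<Rightarrow> bool"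
  where "finite_cdim Y \<longleftrightarrow> (\<exists>B. finite B \<and> complex_vector.span B = Y)"

text \<open>The quotient by \<open>Y\<close> is spanned by finitely many cosets \<open>b + Y\<close>.\<close>

definition finite_ccodim :: "'a::complex_normed_vector set \<Rightarrow> bool"
  where "finite_ccodim Y \<longleftrightarrow>
    (\<exists>B. finite B \<and> (\<forall>x. \<exists>b\<in>complex_vector.span B. x - b \<in> Y))"

definition half_space :: "'a::complex_normed_vector set \<Rightarrow> bool"
  where "half_space Y \<longleftrightarrow> closed_csubspace Y \<and> \<not> finite_cdim Y \<and> \<not> finite_ccodim Y"

text \<open>Continuous functionals are represented as functions \<open>'a \<Rightarrow> complex\<close>. An element \<open>\<phi>\<close> of the
  bidual is a function on these that is linear and bounded on the dual, where the dual carries the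
  operator norm \<open>onorm\<close>; its values off the dual are irrelevant. Reflexivity is
  surjectivity of the canonical embedding into the bidual.\<close>

definition cbidual :: "(('a::complex_normed_vector \<Rightarrow> complex) \<Rightarrow> complex) set"
  where "cbidual = {\<phi>.
    (\<forall>f g. bounded_clinear f \<longrightarrow> bounded_clinear g \<longrightarrow> \<phi> (\<lambda>x. f x + g x) = \<phi> f + \<phi> g) \<and>
    (\<forall>c f. bounded_clinear f \<longrightarrow> \<phi> (\<lambda>x. c * f x) = c * \<phi> f) \<and>
    (\<exists>K. \<forall>f. bounded_clinear f \<longrightarrow> cmod (\<phi> f) \<le> K * onorm f)}"

definition reflexive_space :: "'a::complex_normed_vector itself \<Rightarrow> bool"
  where "reflexive_space _ \<longleftrightarrow>
    (\<forall>\<phi>\<in>cbidual. \<exists>x::'a. \<forall>f. bounded_clinear f \<longrightarrow> \<phi> f = f x)"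

text \<open>\<open>M\<close> is not required to be closed: finite-dimensional subspaces always are.\<close>

definition defect_space ::
    "('a::complex_normed_vector \<Rightarrow> 'a) \<Rightarrow> 'a set \<Rightarrow> 'a set \<Rightarrow> bool"
  where "defect_space T Y M \<longleftrightarrow>
    complex_vector.subspace M \<and> finite_cdim M \<and> T ` Y \<subseteq> {y + m | y m. y \<in> Y \<and> m \<in> M}"

definition almost_invariant :: "('a::complex_normed_vector \<Rightarrow> 'a) \<Rightarrow> 'a set \<Rightarrow> bool"
  where "almost_invariant T Y \<longleftrightarrow> closed_csubspace Y \<and> (\<exists>M. defect_space T Y M)"

text \<open>Meaningful only if \<open>Y\<close> is almost-invariant for \<open>T\<close>.\<close>

definition defect :: "('a::complex_normed_vector \<Rightarrow> 'a) \<Rightarrow> 'a set \<Rightarrow> nat"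
  where "defect T Y = (LEAST n. \<exists>M. defect_space T Y M \<and> complex_vector.dim M = n)"

definition almost_invariant_half_space ::
    "('a::complex_normed_vector \<Rightarrow> 'a) \<Rightarrow> 'a set \<Rightarrow> bool"
  where "almost_invariant_half_space T Y \<longleftrightarrow> half_space Y \<and> almost_invariant T Y"

text \<open>A scalar multiple of the identity leaves every subspace invariant, so no subspace has defect
  exactly one for it. This is why scalar operators need separate treatment in results about
  half-spaces with defect one.\<close>

lemma defect_scalar_eq_0:
  fixes Y :: "'a::complex_normed_vector set"
  assumes "closed_csubspace Y"
  shows "defect (scaleC c) Y = 0"
proof -
  have Y: "complex_vector.subspace Y"
    using assms by (simp add: closed_csubspace_def)
  have "finite_cdim ({0} :: 'a set)"
    unfolding finite_cdim_def by (rule exI[of _ "{}"]) simp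
  moreover have "scaleC c ` Y \<subseteq> {y + m | y m. y \<in> Y \<and> m \<in> {0}}"
    using Y by (auto intro: complex_vector.subspace_scale)
  ultimately have "defect_space (scaleC c) Y {0}"
    by (simp add: defect_space_def complex_vector.subspace_single_0)
  moreover have "complex_vector.dim ({0} :: 'a set) = 0"
    using complex_vector.dim_span[of "{} :: 'a set"]
      complex_vector.dim_eq_card_independent[of "{} :: 'a set"]
    by (simp add: complex_vector.independent_empty)
  ultimately show ?thesis
    unfolding defect_def by (intro Least_eq_0) blast
qed

end

theory Submission
  imports Defs "HOL-Complex_Analysis.Complex_Analysis"
begin

text \<open>Suppose that no half-space \<open>Y\<close> satisfies \<open>T Y \<subseteq> Y + \<langle>e\<rangle>\<close>, and let \<open>\<lambda>\<close> be a boundary point of the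
  spectrum, \<open>S = T - \<lambda>\<close>. Then \<open>ker S\<close> is finite-dimensional, since every subspace of it is invariant.

  If the kernels of the powers of \<open>S\<close> stabilize at \<open>N\<close>, then \<open>S\<close> is injective modulo \<open>N\<close>. Were
  \<open>(T - \<mu>)\<^sup>-\<^sup>1 e\<close> unbounded modulo \<open>N\<close> as \<open>\<mu>\<close> tends to \<open>\<lambda>\<close>, normalizing these vectors would give, by
  reflexivity, a sequence with weak cluster point \<open>0\<close> that \<open>T\<close> maps into its own multiples up to
  \<open>\<langle>e\<rangle> + N\<close>; every second vector of a minimal subsequence, together with \<open>N\<close>, would span a forbidden
  half-space. So the resolvent is bounded modulo \<open>N\<close> near \<open>\<lambda>\<close>.

  If the kernels do not stabilize, consider \<open>Y\<^sub>k\<close>, the closure of the range of \<open>S\<^sup>k\<close>. If the \<open>Y\<^sub>k\<close>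
  decrease strictly, their intersection is an invariant half-space. If they stabilize, the adjoint is
  injective modulo the annihilator of \<open>Y\<^sub>k\<close>, and the resolvent of the adjoint blows up because of an
  eigenvector of \<open>T\<close> in \<open>Y\<^sub>k\<close>; the resulting half-space of the dual has a half-space as its
  preannihilator.

  Hence every boundary point is an isolated eigenvalue, so the spectrum is finite. A functional
  vanishing on all the subspaces \<open>N\<close> turns the resolvent into a function with only removable
  singularities that vanishes at infinity, so it is zero by Liouville's theorem. Therefore the sum of
  the finite-dimensional subspaces \<open>N\<close> is the whole space, a contradiction. Finally, an invariant
  half-space of a nonscalar operator is perturbed by one dimension to a half-space that is not
  invariant.\<close>

section \<open>Bounded complex-linear maps\<close>

text \<open>The defect stays at one because all vectors of a blow-up solve
  \<open>T h - \<mu> *\<^sub>C h = e\<close> with the same \<open>e\<close>. After division by the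
  distance of \<open>h\<close> to \<open>N\<close>, the weak cluster point \<open>z\<close> that
  reflexivity supplies satisfies (T - \<lambda>) z \<in> \<open>N\<close>; only injectivity modulo
  \<open>N\<close> then gives z \<in> \<open>N\<close>, so that subtracting \<open>z\<close> leaves
  vectors of norm at least 1. This is the obstacle at an eigenvalue: \<open>N\<close> has to absorb
  the whole generalized eigenspace and still be finite-dimensional. If the kernels never stabilize,
  no such \<open>N\<close> exists in the space itself, and the finite-dimensional annihilator of Y_k
  takes its place in the dual. Half-spaces are recognized by biorthogonality: the functionals
  belonging to the vectors that are kept witness infinite dimension, those belonging to the dropped
  ones infinite codimension. No quotient space is formed; working modulo \<open>N\<close> means
  measuring distances to \<open>N\<close>, or applying a bounded projection with kernel
  \<open>N\<close>. Scalar operators have defect zero on every closed subspace, so the conclusion is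
  defect at most one in general and exactly one for nonscalar operators.\<close>

abbreviation cspan :: "'a::complex_normed_vector set \<Rightarrow> 'a set"
  where "cspan \<equiv> complex_vector.span"

abbreviation csubspace :: "'a::complex_normed_vector set \<Rightarrow> bool"
  where "csubspace \<equiv> complex_vector.subspace"

lemma bounded_clinearI:
  assumes "\<And>x y. f (x + y) = f x + f y" "\<And>c x. f (c *\<^sub>C x) = c *\<^sub>C f x"
    "\<And>x. norm (f x) \<le> K * norm x"
  shows "bounded_clinear f"
  unfolding bounded_clinear_def
proof
  show "Vector_Spaces.linear scaleC scaleC f"
    by unfold_locales (simp_all add: assms scaleC_add_right scaleC_add_left scaleC_scaleC scaleC_one)
qed (use assms(3) in blast)

lemma bounded_clinear_add: "bounded_clinear f \<Longrightarrow> f (x + y) = f x + f y"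
  unfolding bounded_clinear_def Vector_Spaces.linear_iff by blast

lemma bounded_clinear_scale: "bounded_clinear f \<Longrightarrow> f (c *\<^sub>C x) = c *\<^sub>C f x"
  unfolding bounded_clinear_def Vector_Spaces.linear_iff by blast

lemma bounded_clinear_scale':
  fixes f :: "'a::complex_normed_vector \<Rightarrow> complex"
  shows "bounded_clinear f \<Longrightarrow> f (c *\<^sub>C x) = c * f x"
  by (simp add: bounded_clinear_scale scaleC_complex_def)

lemma bounded_clinear_bounded_linear:
  assumes "bounded_clinear f"
  shows "bounded_linear f"
proof -
  obtain K where "\<And>x. norm (f x) \<le> K * norm x"
    using assms unfolding bounded_clinear_def by blast
  moreover have "f (r *\<^sub>R x) = r *\<^sub>R f x" for r x
    using bounded_clinear_scale[OF assms, of "of_real r" x] by (simp add: scaleC_of_real)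
  ultimately show ?thesis
    by (intro bounded_linear_intro[where K = K])
      (simp_all add: bounded_clinear_add[OF assms] mult.commute)
qed

lemma bounded_clinear_pos:
  assumes "bounded_clinear f"
  obtains K where "K > 0" "\<And>x. norm (f x) \<le> K * norm x"
  using bounded_linear.pos_bounded[OF bounded_clinear_bounded_linear[OF assms]]
  by (metis mult.commute)

lemma bounded_clinear_zero: "bounded_clinear f \<Longrightarrow> f 0 = 0"
  by (simp add: bounded_clinear_bounded_linear bounded_linear.linear linear_0)

lemma bounded_clinear_diff: "bounded_clinear f \<Longrightarrow> f (x - y) = f x - f y"
  by (simp add: bounded_clinear_bounded_linear bounded_linear.linear linear_diff)

lemma bounded_clinear_sum: "bounded_clinear f \<Longrightarrow> f (sum g A) = (\<Sum>i\<in>A. f (g i))"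
  by (simp add: bounded_clinear_bounded_linear bounded_linear.linear linear_sum)

lemma bounded_clinear_continuous_on: "bounded_clinear f \<Longrightarrow> continuous_on A f"
  by (simp add: bounded_clinear_bounded_linear linear_continuous_on)

lemma bounded_clinear_tendsto:
  "bounded_clinear f \<Longrightarrow> (g \<longlongrightarrow> l) F \<Longrightarrow> ((\<lambda>x. f (g x)) \<longlongrightarrow> f l) F"
  using bounded_clinear_bounded_linear bounded_linear.tendsto by blast

lemma bounded_clinear_linear_maps:
  "bounded_clinear f \<Longrightarrow> Vector_Spaces.linear scaleC scaleC f"
  by (simp add: bounded_clinear_def)

lemma bounded_clinear_compose:
  assumes "bounded_clinear f" "bounded_clinear g"
  shows "bounded_clinear (\<lambda>x. f (g x))"
proof -
  obtain K where K: "K > 0" "\<And>x. norm (f x) \<le> K * norm x"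
    using bounded_clinear_pos[OF assms(1)] by blast
  obtain L where L: "L > 0" "\<And>x. norm (g x) \<le> L * norm x"
    using bounded_clinear_pos[OF assms(2)] by blast
  have "norm (f (g x)) \<le> (K * L) * norm x" for x
    using order_trans[OF K(2)[of "g x"] mult_left_mono[OF L(2)[of x], of K]] K(1)
    by (simp add: mult.assoc)
  then show ?thesis
    by (intro bounded_clinearI[where K = "K * L"])
      (simp_all add: assms bounded_clinear_add bounded_clinear_scale)
qed

lemma bounded_clinear_plus:
  assumes "bounded_clinear f" "bounded_clinear g"
  shows "bounded_clinear (\<lambda>x. f x + g x)"
proof -
  obtain K where K: "\<And>x. norm (f x) \<le> K * norm x"
    using bounded_clinear_pos[OF assms(1)] by blast
  obtain L where L: "\<And>x. norm (g x) \<le> L * norm x"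
    using bounded_clinear_pos[OF assms(2)] by blast
  have "norm (f x + g x) \<le> (K + L) * norm x" for x
    using norm_triangle_ineq[of "f x" "g x"] K[of x] L[of x] by (simp add: algebra_simps)
  then show ?thesis
    by (intro bounded_clinearI[where K = "K + L"])
      (simp_all add: assms bounded_clinear_add bounded_clinear_scale scaleC_add_right)
qed

lemma bounded_clinear_scaleC_right: "bounded_clinear (\<lambda>x. c *\<^sub>C x)"
  by (rule bounded_clinearI[where K = "cmod c"])
    (simp_all add: scaleC_add_right scaleC_scaleC norm_scaleC mult.commute)

lemma bounded_clinear_scaleC_left: "bounded_clinear (\<lambda>c. c *\<^sub>C x)"
  by (rule bounded_clinearI[where K = "norm x"])
    (simp_all add: scaleC_add_left scaleC_scaleC norm_scaleC scaleC_complex_def mult.commute)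

lemma bounded_clinear_cmult:
  "bounded_clinear f \<Longrightarrow> bounded_clinear (\<lambda>x. c *\<^sub>C f x)"
  by (rule bounded_clinear_compose[OF bounded_clinear_scaleC_right])

lemma bounded_clinear_cmult':
  fixes f :: "'a::complex_normed_vector \<Rightarrow> complex"
  shows "bounded_clinear f \<Longrightarrow> bounded_clinear (\<lambda>x. c * f x)"
  using bounded_clinear_cmult[of f c] by (simp add: scaleC_complex_def)

lemma bounded_clinear_ident: "bounded_clinear (\<lambda>x. x)"
  by (rule bounded_clinearI[where K = 1]) auto

lemma bounded_clinear_const_0: "bounded_clinear (\<lambda>x. 0)"
  by (rule bounded_clinearI[where K = 0]) auto

lemma bounded_clinear_sub:
  assumes "bounded_clinear f" "bounded_clinear g"
  shows "bounded_clinear (\<lambda>x. f x - g x)"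
  using bounded_clinear_plus[OF assms(1) bounded_clinear_cmult[OF assms(2), of "-1"]]
  by simp

lemma bounded_clinear_setsum:
  assumes "\<And>i. i \<in> A \<Longrightarrow> bounded_clinear (f i)"
  shows "bounded_clinear (\<lambda>x. \<Sum>i\<in>A. f i x)"
  using assms
  by (induction A rule: infinite_finite_induct)
    (simp_all add: bounded_clinear_const_0 bounded_clinear_plus)

lemma bounded_clinear_funpow:
  fixes f :: "'a::complex_normed_vector \<Rightarrow> 'a"
  assumes "bounded_clinear f"
  shows "bounded_clinear (f ^^ n)"
proof (induction n)
  case 0
  show ?case using bounded_clinear_ident by (simp add: id_def)
next
  case (Suc n)
  show ?case using bounded_clinear_compose[OF assms Suc] by (simp add: comp_def)
qed

lemma bounded_clinear_shift:
  "bounded_clinear T \<Longrightarrow> bounded_clinear (\<lambda>x. T x - c *\<^sub>C x)"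
  by (intro bounded_clinear_sub bounded_clinear_scaleC_right)

section \<open>Subspaces and closures under bounded linear maps\<close>

lemma csubspace_kernel: "bounded_clinear f \<Longrightarrow> csubspace {x. f x = 0}"
  by (rule complex_vector.subspaceI)
    (simp_all add: bounded_clinear_zero bounded_clinear_add bounded_clinear_scale)

lemma csubspace_vimage:
  "bounded_clinear f \<Longrightarrow> csubspace Y \<Longrightarrow> csubspace {x. f x \<in> Y}"
  by (rule complex_vector.subspaceI)
    (simp_all add: bounded_clinear_zero bounded_clinear_add bounded_clinear_scale
      complex_vector.subspace_0 complex_vector.subspace_add complex_vector.subspace_scale)

lemma csubspace_image:
  assumes "bounded_clinear f" "csubspace Y"
  shows "csubspace (f ` Y)"
proof (rule complex_vector.subspaceI)
  show "0 \<in> f ` Y"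
    using assms by (metis bounded_clinear_zero complex_vector.subspace_0 imageI)
  show "x + y \<in> f ` Y" if "x \<in> f ` Y" "y \<in> f ` Y" for x y
    using that complex_vector.subspace_add[OF assms(2)]
    by (auto simp flip: bounded_clinear_add[OF assms(1)])
  show "c *\<^sub>C x \<in> f ` Y" if "x \<in> f ` Y" for c x
    using that complex_vector.subspace_scale[OF assms(2)]
    by (auto simp flip: bounded_clinear_scale[OF assms(1)])
qed

lemma closed_vimage_bounded_clinear:
  "bounded_clinear f \<Longrightarrow> closed Y \<Longrightarrow> closed {x. f x \<in> Y}"
  using continuous_closed_vimage[of Y f]
  by (simp add: vimage_def bounded_clinear_bounded_linear linear_continuous_at)

lemma closed_kernel: "bounded_clinear f \<Longrightarrow> closed {x. f x = 0}"
  using closed_vimage_bounded_clinear[of f "{0}"] by simp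

lemma csubspace_closure:
  assumes "csubspace Y"
  shows "csubspace (closure Y)"
proof (rule complex_vector.subspaceI)
  show "0 \<in> closure Y"
    using assms complex_vector.subspace_0 closure_subset by blast
next
  fix x y assume "x \<in> closure Y" "y \<in> closure Y"
  then obtain f g where "\<forall>n. f n \<in> Y" "f \<longlonglongrightarrow> x" "\<forall>n. g n \<in> Y" "g \<longlonglongrightarrow> y"
    unfolding closure_sequential by blast
  then have "\<forall>n. f n + g n \<in> Y" "(\<lambda>n. f n + g n) \<longlonglongrightarrow> x + y"
    using assms complex_vector.subspace_add by (blast, intro tendsto_add)
  then show "x + y \<in> closure Y"
    unfolding closure_sequential by (intro exI[of _ "\<lambda>n. f n + g n"]) blast
next
  fix c x assume "x \<in> closure Y"
  then obtain f where "\<forall>n. f n \<in> Y" "f \<longlonglongrightarrow> x"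
    unfolding closure_sequential by blast
  then have "\<forall>n. c *\<^sub>C f n \<in> Y" "(\<lambda>n. c *\<^sub>C f n) \<longlonglongrightarrow> c *\<^sub>C x"
    using assms complex_vector.subspace_scale
    by (blast, intro bounded_clinear_tendsto[OF bounded_clinear_scaleC_right])
  then show "c *\<^sub>C x \<in> closure Y"
    unfolding closure_sequential by (intro exI[of _ "\<lambda>n. c *\<^sub>C f n"]) blast
qed

lemma image_closure_subset_closed:
  assumes "bounded_clinear f" "closed Z" "f ` Y \<subseteq> Z"
  shows "f ` closure Y \<subseteq> Z"
  using assms closure_minimal[of Y "{x. f x \<in> Z}"] closed_vimage_bounded_clinear by blast

section \<open>The Hahn-Banach theorem\<close>

text \<open>Homogeneity is demanded in one direction only, which is what infima inherit readily; the
  converse follows by scaling back with \<open>1/t\<close>, and \<open>t = 0\<close> supplies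
  \<open>p 0 \<le> 0\<close>.\<close>

definition sublinear :: "('a::real_vector \<Rightarrow> real) \<Rightarrow> bool"
  where "sublinear p \<longleftrightarrow>
    (\<forall>x y. p (x + y) \<le> p x + p y) \<and> (\<forall>t\<ge>0. \<forall>x. p (t *\<^sub>R x) \<le> t * p x)"

lemma sublinear_add: "sublinear p \<Longrightarrow> p (x + y) \<le> p x + p y"
  by (simp add: sublinear_def)

lemma sublinear_0: "sublinear p \<Longrightarrow> p 0 = 0"
proof -
  assume p: "sublinear p"
  have "p (0 *\<^sub>R 0) \<le> 0 * p 0" "p (0 + 0) \<le> p 0 + p 0"
    using p unfolding sublinear_def by blast+
  then show ?thesis by simp
qed

lemma sublinear_scale:
  assumes p: "sublinear p" and "t \<ge> 0"
  shows "p (t *\<^sub>R x) = t * p x"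
proof (cases "t = 0")
  case True
  then show ?thesis by (simp add: sublinear_0[OF p])
next
  case False
  have "p ((1/t) *\<^sub>R (t *\<^sub>R x)) \<le> (1/t) * p (t *\<^sub>R x)"
    using p assms(2) unfolding sublinear_def by (metis divide_nonneg_nonneg zero_le_one)
  then have "t * p x \<le> p (t *\<^sub>R x)"
    using False assms(2) by (simp add: field_simps)
  moreover have "p (t *\<^sub>R x) \<le> t * p x"
    using p assms(2) by (simp add: sublinear_def)
  ultimately show ?thesis by simp
qed

lemma sublinear_lower: "sublinear p \<Longrightarrow> - p (- x) \<le> p x"
  using sublinear_add[of p x "- x"] sublinear_0[of p] by simp

text \<open>Applied to a minimal sublinear functional, this gives back the functional itself and so forces
  it to be odd, hence linear.\<close>

lemma sublinear_decrease:
  fixes p :: "'a::real_vector \<Rightarrow> real"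
  assumes p: "sublinear p"
  obtains q where "sublinear q" "\<And>y. q y \<le> p y" "q (- x) \<le> - p x"
proof
  \<comment> \<open>Moving \<open>y\<close> along the ray of \<open>x\<close> at the price
    \<open>t * p x\<close> lowers \<open>p\<close>; the choice \<open>t = 1\<close> at the point
    \<open>- x\<close> gives the bound \<open>- p x\<close>.\<close>
  define q where "q y = (INF t\<in>{0..}. p (y + t *\<^sub>R x) - t * p x)" for y
  have bdd: "bdd_below ((\<lambda>t. p (y + t *\<^sub>R x) - t * p x) ` {0..})" for y
  proof (rule bdd_belowI2)
    fix t :: real assume t: "t \<in> {0..}"
    have "p (t *\<^sub>R x) \<le> p (y + t *\<^sub>R x) + p (- y)"
      using sublinear_add[OF p, of "y + t *\<^sub>R x" "- y"] by simp
    then show "- p (- y) \<le> p (y + t *\<^sub>R x) - t * p x"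
      using sublinear_scale[OF p, of t x] t by simp
  qed
  have qle: "q y \<le> p (y + t *\<^sub>R x) - t * p x" if "t \<ge> 0" for y t
    unfolding q_def by (rule cINF_lower[OF bdd]) (use that in simp)
  have qge: "c \<le> q y" if "\<And>t. t \<ge> 0 \<Longrightarrow> c \<le> p (y + t *\<^sub>R x) - t * p x" for c y
    unfolding q_def by (rule cINF_greatest) (use that in auto)
  show "q y \<le> p y" for y
    using qle[of 0 y] by simp
  show "q (- x) \<le> - p x"
    using qle[of 1 "- x"] by (simp add: sublinear_0[OF p])
  show "sublinear q"
    unfolding sublinear_def
  proof safe
    fix y z
    have "q (y + z) - (p (y + t *\<^sub>R x) - t * p x) \<le> q z" if t: "t \<ge> 0" for t
    proof (rule qge)
      fix s :: real assume "s \<ge> 0"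
      then have "q (y + z) \<le> p ((y + z) + (t + s) *\<^sub>R x) - (t + s) * p x"
        using t by (intro qle) simp
      also have "(y + z) + (t + s) *\<^sub>R x = (y + t *\<^sub>R x) + (z + s *\<^sub>R x)"
        by (simp add: algebra_simps)
      also have "p \<dots> \<le> p (y + t *\<^sub>R x) + p (z + s *\<^sub>R x)"
        by (rule sublinear_add[OF p])
      finally show "q (y + z) - (p (y + t *\<^sub>R x) - t * p x) \<le> p (z + s *\<^sub>R x) - s * p x"
        by (simp add: algebra_simps)
    qed
    then have "q (y + z) - q z \<le> q y"
      by (intro qge) (simp add: algebra_simps)
    then show "q (y + z) \<le> q y + q z" by simp
  next
    fix t :: real and y assume t: "t \<ge> 0"
    show "q (t *\<^sub>R y) \<le> t * q y"
    proof (cases "t = 0")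
      case True
      then show ?thesis
        using qle[of 0 0] by (simp add: sublinear_0[OF p])
    next
      case False
      have "q (t *\<^sub>R y) / t \<le> q y"
      proof (rule qge)
        fix s :: real assume s: "s \<ge> 0"
        have "q (t *\<^sub>R y) \<le> p (t *\<^sub>R y + (t * s) *\<^sub>R x) - (t * s) * p x"
          using s t by (intro qle) simp
        also have "t *\<^sub>R y + (t * s) *\<^sub>R x = t *\<^sub>R (y + s *\<^sub>R x)"
          by (simp add: algebra_simps)
        also have "p \<dots> = t * p (y + s *\<^sub>R x)"
          by (rule sublinear_scale[OF p t])
        finally show "q (t *\<^sub>R y) / t \<le> p (y + s *\<^sub>R x) - s * p x"
          using t False by (simp add: field_simps)
      qed
      then show ?thesis
        using t False by (simp add: field_simps)
    qed
  qed
qed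

text \<open>Zorn's lemma for the reversed pointwise order. The infimum of a chain is real-valued
  because each sublinear functional below \<open>p\<close> is at least \<open>- p (- x)\<close> at
  \<open>x\<close>.\<close>

lemma minimal_sublinear:
  fixes p :: "'a::real_vector \<Rightarrow> real"
  assumes p: "sublinear p"
  obtains g where "sublinear g" "g \<le> p" "\<And>q. sublinear q \<Longrightarrow> q \<le> g \<Longrightarrow> q = g"
proof -
  define A where "A = {q. sublinear q \<and> q \<le> p}"
  have "\<exists>m\<in>A. \<forall>a\<in>A. a \<le> m \<longrightarrow> a = m"
  proof (rule predicate_Zorn)
    show "partial_order_on A (relation_of (\<lambda>a b. b \<le> a) A)"
      by (rule partial_order_on_relation_ofI) auto
    fix C assume C: "C \<in> Chains (relation_of (\<lambda>a b. b \<le> a) A)"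
    then have CA: "q \<in> A" if "q \<in> C" for q
      using that by (auto simp: Chains_def relation_of_def)
    have tot: "q \<le> r \<or> r \<le> q" if "q \<in> C" "r \<in> C" for q r
      using C that by (auto simp: Chains_def relation_of_def)
    show "\<exists>u\<in>A. \<forall>a\<in>C. u \<le> a"
    proof (cases "C = {}")
      case True
      then show ?thesis using p by (auto simp: A_def)
    next
      case False
      define u where "u x = (INF q\<in>C. q x)" for x
      have lb: "- p (- x) \<le> q x" if "q \<in> C" for q x
      proof -
        have "sublinear q" "q (- x) \<le> p (- x)"
          using CA[OF that] by (auto simp: A_def le_fun_def)
        then show ?thesis using sublinear_lower[of q x] by linarith
      qed
      have bdd: "bdd_below ((\<lambda>q. q x) ` C)" for x
        using lb by (auto intro!: bdd_belowI2[where m = "- p (- x)"])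
      have ule: "u x \<le> q x" if "q \<in> C" for q x
        unfolding u_def by (rule cINF_lower[OF bdd that])
      have uge: "c \<le> u x" if "\<And>q. q \<in> C \<Longrightarrow> c \<le> q x" for c x
        unfolding u_def by (rule cINF_greatest[OF False that])
      have "sublinear u"
        unfolding sublinear_def
      proof safe
        fix x y
        \<comment> \<open>Subadditivity survives the infimum because two members of a chain have a
          common lower bound within it.\<close>
        have *: "u (x + y) \<le> q x + r y" if qr: "q \<in> C" "r \<in> C" for q r
        proof -
          obtain s where s: "s \<in> C" "s \<le> q" "s \<le> r"
            using tot[OF qr] qr by blast
          have "u (x + y) \<le> s (x + y)" by (rule ule[OF s(1)])
          also have "\<dots> \<le> s x + s y"
            using CA[OF s(1)] by (simp add: A_def sublinear_add)
          also have "\<dots> \<le> q x + r y"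
            using s by (intro add_mono) (auto simp: le_fun_def)
          finally show ?thesis .
        qed
        have "u (x + y) - q x \<le> u y" if "q \<in> C" for q
          by (rule uge) (use *[OF that] in \<open>simp add: algebra_simps\<close>)
        then have "u (x + y) - u y \<le> u x"
          by (intro uge) (simp add: algebra_simps)
        then show "u (x + y) \<le> u x + u y" by simp
      next
        fix t :: real and x assume t: "t \<ge> 0"
        have scale: "u (t *\<^sub>R x) \<le> t * q x" if "q \<in> C" for q
          using ule[OF that, of "t *\<^sub>R x"] sublinear_scale[of q t x] CA[OF that] t
          by (simp add: A_def)
        show "u (t *\<^sub>R x) \<le> t * u x"
        proof (cases "t = 0")
          case True
          then show ?thesis using False scale by auto
        next
          case False
          then have "u (t *\<^sub>R x) / t \<le> u x"
            using scale t by (intro uge) (simp add: field_simps)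
          then show ?thesis using t False by (simp add: field_simps)
        qed
      qed
      moreover have "u \<le> p"
      proof -
        obtain q where q: "q \<in> C" using False by blast
        then have "q \<le> p" using CA by (simp add: A_def)
        then show ?thesis using ule[OF q] by (meson le_fun_def order_trans)
      qed
      ultimately show ?thesis
        using ule by (auto simp: A_def le_fun_def)
    qed
  qed
  then obtain m where m: "m \<in> A" "\<And>a. a \<in> A \<Longrightarrow> a \<le> m \<Longrightarrow> a = m" by blast
  then have "sublinear m" "m \<le> p" by (auto simp: A_def)
  moreover have "q = m" if "sublinear q" "q \<le> m" for q
    using m(2)[of q] that \<open>m \<le> p\<close> by (auto simp: A_def)
  ultimately show thesis using that by blast
qed

text \<open>Minimality makes \<open>g\<close> odd, hence linear. Lowering \<open>p\<close> to
  \<open>q\<close> beforehand builds in \<open>g (- x) \<le> - p x\<close>, which by oddness forces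
  the equality at \<open>x\<close>.\<close>

lemma sublinear_dominates_linear:
  fixes p :: "'a::real_vector \<Rightarrow> real"
  assumes "sublinear p"
  obtains g where "linear g" "\<And>y. g y \<le> p y" "g x = p x"
proof -
  obtain q where q: "sublinear q" "\<And>y. q y \<le> p y" "q (- x) \<le> - p x"
    using sublinear_decrease[OF assms] by blast
  obtain g where g: "sublinear g" "g \<le> q" and min: "\<And>r. sublinear r \<Longrightarrow> r \<le> g \<Longrightarrow> r = g"
    using minimal_sublinear[OF q(1)] by blast
  have odd: "g (- y) = - g y" for y
  proof -
    obtain r where r: "sublinear r" "\<And>z. r z \<le> g z" "r (- y) \<le> - g y"
      using sublinear_decrease[OF g(1)] by blast
    then have "r = g" by (intro min) (auto simp: le_fun_def)
    then show ?thesis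
      using r(3) sublinear_lower[OF g(1), of "- y"] by simp
  qed
  have add: "g (y + z) = g y + g z" for y z
    using sublinear_add[OF g(1), of y z] sublinear_add[OF g(1), of "y + z" "- z"] odd[of z]
    by simp
  have "g (t *\<^sub>R y) = t *\<^sub>R g y" for t y
  proof (cases "t \<ge> 0")
    case True
    then show ?thesis using sublinear_scale[OF g(1)] by simp
  next
    case False
    then have "g ((- t) *\<^sub>R y) = (- t) * g y"
      using sublinear_scale[OF g(1), of "- t" y] by simp
    then show ?thesis using odd[of "t *\<^sub>R y"] by simp
  qed
  then have "linear g" using add by (intro linearI)
  moreover have gp: "g y \<le> p y" for y
    using g(2) q(2) by (meson le_fun_def order_trans)
  moreover have "g x = p x"
  proof -
    have "g (- x) \<le> - p x" using g(2) q(3) by (meson le_fun_def order_trans)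
    then show ?thesis using odd[of x] gp[of x] by simp
  qed
  ultimately show thesis using that by blast
qed

text \<open>The dominating functional is the distance to \<open>Z\<close>: it vanishes on
  \<open>Z\<close>, lies below the norm and is at least \<open>d\<close> at \<open>x\<close>. A
  real-linear minorant touching it at \<open>x\<close> is complexified and then divided by its value
  at \<open>x\<close>.\<close>

theorem hahn_banach_separation:
  fixes Z :: "'a::complex_normed_vector set"
  assumes Z: "csubspace Z" and d: "d > 0" and dist: "\<And>z. z \<in> Z \<Longrightarrow> d \<le> norm (x - z)"
  obtains f :: "'a \<Rightarrow> complex" where "bounded_clinear f" "\<And>z. z \<in> Z \<Longrightarrow> f z = 0" "f x = 1"
    "\<And>y. cmod (f y) \<le> norm y / d"
proof -
  have Z0: "0 \<in> Z" using Z complex_vector.subspace_0 by blast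
  define p where "p y = (INF z\<in>Z. norm (y - z))" for y
  have bdd: "bdd_below ((\<lambda>z. norm (y - z)) ` Z)" for y
    by (rule bdd_belowI2[of _ 0]) simp
  have ple: "p y \<le> norm (y - z)" if "z \<in> Z" for y z
    unfolding p_def by (rule cINF_lower[OF bdd that])
  have pge: "c \<le> p y" if "\<And>z. z \<in> Z \<Longrightarrow> c \<le> norm (y - z)" for c y
    unfolding p_def by (rule cINF_greatest) (use that Z0 in auto)
  have pscale: "p (c *\<^sub>C y) \<le> cmod c * p y" for c y
  proof (cases "c = 0")
    case True
    then show ?thesis using ple[OF Z0, of 0] by simp
  next
    case False
    have "p (c *\<^sub>C y) / cmod c \<le> p y"
    proof (rule pge)
      fix z assume "z \<in> Z"
      then have "p (c *\<^sub>C y) \<le> norm (c *\<^sub>C y - c *\<^sub>C z)"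
        by (intro ple complex_vector.subspace_scale[OF Z])
      also have "\<dots> = cmod c * norm (y - z)"
        by (metis complex_vector.scale_right_diff_distrib norm_scaleC)
      finally show "p (c *\<^sub>C y) / cmod c \<le> norm (y - z)"
        using False by (simp add: field_simps)
    qed
    then show ?thesis using False by (simp add: field_simps)
  qed
  have "sublinear p"
    unfolding sublinear_def
  proof safe
    fix y y'
    have *: "p (y + y') \<le> norm (y - z) + norm (y' - z')" if "z \<in> Z" "z' \<in> Z" for z z'
    proof -
      have "p (y + y') \<le> norm ((y + y') - (z + z'))"
        by (intro ple complex_vector.subspace_add[OF Z] that)
      also have "(y + y') - (z + z') = (y - z) + (y' - z')" by simp
      also have "norm \<dots> \<le> norm (y - z) + norm (y' - z')" by (rule norm_triangle_ineq)
      finally show ?thesis .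
    qed
    have "p (y + y') - norm (y - z) \<le> p y'" if "z \<in> Z" for z
      by (rule pge) (use *[OF that] in \<open>simp add: algebra_simps\<close>)
    then have "p (y + y') - p y' \<le> p y"
      by (intro pge) (simp add: algebra_simps)
    then show "p (y + y') \<le> p y + p y'" by simp
  next
    fix t :: real and y assume "t \<ge> 0"
    then show "p (t *\<^sub>R y) \<le> t * p y"
      using pscale[of "of_real t" y] by (simp add: scaleC_of_real)
  qed
  then obtain g where g: "linear g" "\<And>y. g y \<le> p y" "g x = p x"
    by (metis sublinear_dominates_linear)
  \<comment> \<open>The complex-linear functional whose real part is \<open>g\<close>.\<close>
  define h where "h y = Complex (g y) (- g (\<i> *\<^sub>C y))" for y
  have h_add: "h (y + z) = h y + h z" for y z
    by (simp add: h_def scaleC_add_right linear_add[OF g(1)] complex_eq_iff)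
  have h_scale: "h (c *\<^sub>C y) = c * h y" for c y
  proof -
    have c: "c *\<^sub>C y = Re c *\<^sub>R y + Im c *\<^sub>R (\<i> *\<^sub>C y)"
    proof -
      have "c *\<^sub>C y = (of_real (Re c) + of_real (Im c) * \<i>) *\<^sub>C y"
        by (metis complex_eq mult.commute)
      then show ?thesis
        by (simp only: scaleC_add_left scaleC_of_real flip: scaleC_scaleC)
    qed
    have ci: "\<i> *\<^sub>C c *\<^sub>C y = Re c *\<^sub>R (\<i> *\<^sub>C y) - Im c *\<^sub>R y"
    proof -
      have "\<i> * c = of_real (Re c) * \<i> + of_real (- Im c)" by (simp add: complex_eq_iff)
      then have "\<i> *\<^sub>C c *\<^sub>C y = (of_real (Re c) * \<i> + of_real (- Im c)) *\<^sub>C y"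
        by (simp only: scaleC_scaleC)
      then show ?thesis
        by (simp only: scaleC_add_left scaleC_of_real flip: scaleC_scaleC) simp
    qed
    show ?thesis
      unfolding h_def ci
      by (simp add: c linear_add[OF g(1)] linear_diff[OF g(1)] linear_scale[OF g(1)]
          complex_eq_iff algebra_simps)
  qed
  have h_bound: "cmod (h y) \<le> p y" for y
  proof (cases "h y = 0")
    case True
    then show ?thesis using pge[of 0 y] by simp
  next
    case False
    \<comment> \<open>Rotation by this unit scalar makes the value of \<open>h\<close> real and
      nonnegative, so the bound on the real part bounds the modulus.\<close>
    define c where "c = cnj (h y) / of_real (cmod (h y))"
    have c: "cmod c = 1" using False by (simp add: c_def norm_divide)
    have "h (c *\<^sub>C y) = of_real (cmod (h y))"
      using False complex_norm_square[of "h y"]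
      by (simp add: h_scale c_def field_simps power2_eq_square)
    then have "cmod (h y) = Re (h (c *\<^sub>C y))" by simp
    also have "\<dots> \<le> p (c *\<^sub>C y)" using g(2) by (simp add: h_def)
    also have "\<dots> \<le> p y" using pscale[of c y] c by simp
    finally show ?thesis .
  qed
  have px: "p x \<ge> d" using dist by (intro pge)
  have hx: "cmod (h x) \<ge> d"
    using px g(3) abs_Re_le_cmod[of "h x"] by (simp add: h_def)
  define f where "f y = h y / h x" for y
  have fb: "cmod (f y) \<le> norm y / d" for y
  proof -
    have "cmod (h y) \<le> norm y" using h_bound[of y] ple[OF Z0, of y] by simp
    then show ?thesis
      unfolding f_def norm_divide using hx d by (intro frac_le) auto
  qed
  show thesis
  proof
    show "bounded_clinear f"
      by (rule bounded_clinearI[where K = "1/d"])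
        (use fb in \<open>simp_all add: f_def h_add h_scale scaleC_complex_def add_divide_distrib\<close>)
    show "f x = 1" using hx d by (auto simp: f_def)
    show "f z = 0" if "z \<in> Z" for z
    proof -
      have "p z \<le> 0" using ple[OF that, of z] by simp
      then have "cmod (h z) \<le> 0" using h_bound[of z] by linarith
      then show ?thesis by (simp add: f_def)
    qed
  qed (rule fb)
qed

corollary closed_csubspace_separation:
  fixes Z :: "'a::complex_normed_vector set"
  assumes Z: "closed_csubspace Z" and x: "x \<notin> Z"
  obtains f :: "'a \<Rightarrow> complex" where "bounded_clinear f" "\<And>z. z \<in> Z \<Longrightarrow> f z = 0" "f x = 1"
proof -
  have "open (- Z)" "x \<in> - Z" using Z x by (auto simp: closed_csubspace_def)
  then obtain d where "d > 0" "ball x d \<subseteq> - Z"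
    unfolding open_contains_ball by blast
  then have "d > 0" "\<And>z. z \<in> Z \<Longrightarrow> d \<le> dist x z"
    by (auto simp: subset_iff not_less[symmetric])
  moreover have "csubspace Z" using Z by (simp add: closed_csubspace_def)
  ultimately show thesis
    using hahn_banach_separation[of Z d x] that by (metis dist_norm)
qed

section \<open>Finite dimension and codimension\<close>

lemma finite_cdim_span: "finite B \<Longrightarrow> finite_cdim (cspan B)"
  by (auto simp: finite_cdim_def)

lemma finite_cdim_subspace:
  assumes "csubspace Y" "Y \<subseteq> Z" "finite_cdim Z"
  shows "finite_cdim Y"
proof -
  obtain B where B: "finite B" "cspan B = Z"
    using assms(3) by (auto simp: finite_cdim_def)
  obtain C where C: "C \<subseteq> Y" "complex_vector.independent C" "Y \<subseteq> cspan C"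
    using complex_vector.maximal_independent_subset by metis
  have "finite C"
    using complex_vector.independent_span_bound[OF B(1) C(2)] C(1) assms(2) B(2) by blast
  moreover have "cspan C = Y"
    using C complex_vector.span_minimal[OF C(1) assms(1)] by blast
  ultimately show ?thesis by (auto simp: finite_cdim_def)
qed

lemma finite_ccodim_mono: "finite_ccodim Y \<Longrightarrow> Y \<subseteq> Z \<Longrightarrow> finite_ccodim Z"
  unfolding finite_ccodim_def by (meson subsetD)

text \<open>Rank-nullity: preimages of a spanning set of the image, together with a spanning set of
  the kernel, span \<open>Y\<close>.\<close>

lemma finite_cdim_kernel_image:
  fixes S :: "'a::complex_normed_vector \<Rightarrow> 'b::complex_normed_vector"
  assumes S: "bounded_clinear S" and Y: "csubspace Y"
    and ker: "finite_cdim {y\<in>Y. S y = 0}" and im: "finite_cdim (S ` Y)"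
  shows "finite_cdim Y"
proof -
  obtain C where C: "finite C" "cspan C = {y\<in>Y. S y = 0}"
    using ker by (auto simp: finite_cdim_def)
  obtain B where B: "finite B" "cspan B = S ` Y"
    using im by (auto simp: finite_cdim_def)
  have "\<forall>b\<in>B. \<exists>y\<in>Y. S y = b"
    using complex_vector.span_superset[of B] unfolding B(2) by fastforce
  then obtain x where x: "\<And>b. b \<in> B \<Longrightarrow> x b \<in> Y" "\<And>b. b \<in> B \<Longrightarrow> S (x b) = b"
    by metis
  have GY: "cspan (x ` B) \<subseteq> Y"
    using x(1) Y by (intro complex_vector.span_minimal) auto
  have "Y \<subseteq> cspan (C \<union> x ` B)"
  proof
    fix y assume y: "y \<in> Y"
    have "S ` x ` B = B" using x(2) by (force simp: image_iff)
    moreover have "S ` cspan (x ` B) = cspan (S ` x ` B)"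
      using module_hom.span_image[OF Vector_Spaces.linear.axioms(3)[OF bounded_clinear_linear_maps[OF S]]] by metis
    ultimately have "S y \<in> S ` cspan (x ` B)" using y B(2) by auto
    then obtain g where g: "g \<in> cspan (x ` B)" "S y = S g" by blast
    have "y - g \<in> cspan C"
      using y g GY Y by (auto simp: C(2) bounded_clinear_diff[OF S] complex_vector.subspace_diff)
    then have "y - g \<in> cspan (C \<union> x ` B)" "g \<in> cspan (C \<union> x ` B)"
      using g(1) complex_vector.span_mono[of C "C \<union> x ` B"]
        complex_vector.span_mono[of "x ` B" "C \<union> x ` B"] by auto
    then show "y \<in> cspan (C \<union> x ` B)"
      using complex_vector.span_add by fastforce
  qed
  then show ?thesis
    using finite_cdim_subspace[OF Y] finite_cdim_span[of "C \<union> x ` B"] C(1) B(1) by simp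
qed

lemma finite_cdim_complex: "csubspace Y \<Longrightarrow> finite_cdim (Y :: complex set)"
proof (rule finite_cdim_subspace)
  have "z \<in> cspan {1}" for z :: complex
    using complex_vector.span_scale[OF complex_vector.span_base, of "1::complex" "{1}" z]
    by (simp add: scaleC_complex_def)
  then show "Y \<subseteq> cspan {1}" by blast
qed (simp_all add: finite_cdim_span)

lemma finite_cdim_hyperplane:
  fixes f :: "'a::complex_normed_vector \<Rightarrow> complex"
  assumes "bounded_clinear f" "csubspace Y" "finite_cdim {y\<in>Y. f y = 0}"
  shows "finite_cdim Y"
  using finite_cdim_kernel_image[OF assms] finite_cdim_complex csubspace_image[OF assms(1,2)]
  by blast

text \<open>Each functional lowers the dimension by at most one. It is used in both directions: to
  find common zeros in infinite-dimensional spaces, and to bound the dimension of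
  annihilators.\<close>

lemma finite_cdim_kernels:
  fixes \<Phi> :: "('a::complex_normed_vector \<Rightarrow> complex) set"
  assumes "finite \<Phi>" "\<And>f. f \<in> \<Phi> \<Longrightarrow> bounded_clinear f" "csubspace Y"
    "finite_cdim {y\<in>Y. \<forall>f\<in>\<Phi>. f y = 0}"
  shows "finite_cdim Y"
  using assms
proof (induction \<Phi> arbitrary: Y)
  case empty
  then show ?case by simp
next
  case (insert f \<Phi>)
  have "csubspace {y\<in>Y. f y = 0}"
    using complex_vector.subspace_inter[OF insert.prems(2) csubspace_kernel[of f]] insert.prems(1)
    by (simp add: Collect_conj_eq)
  moreover have "{y\<in>{y\<in>Y. f y = 0}. \<forall>f\<in>\<Phi>. f y = 0} = {y\<in>Y. \<forall>f\<in>insert f \<Phi>. f y = 0}"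
    by auto
  ultimately have "finite_cdim {y\<in>Y. f y = 0}"
    using insert.prems insert.IH[of "{y\<in>Y. f y = 0}"] by (metis insertCI)
  then show ?case
    using finite_cdim_hyperplane insert.prems by blast
qed

lemma finite_cdim_0: "finite_cdim {0}"
  using finite_cdim_span[of "{}"] by simp

section \<open>Biorthogonal systems as witnesses of infinite dimension and codimension\<close>

lemma biorthogonal_independent:
  fixes \<psi> :: "nat \<Rightarrow> 'a::complex_normed_vector \<Rightarrow> complex"
  assumes "\<And>k. bounded_clinear (\<psi> k)" "\<And>j k. \<psi> k (v j) = (if j = k then 1 else 0)"
  shows "inj v" "complex_vector.independent (range v)"
proof -
  show "inj v"
    by (rule injI) (metis assms(2) zero_neq_one)
  show "complex_vector.independent (range v)"
    unfolding complex_vector.dependent_def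
  proof clarify
    fix k assume k: "v k \<in> cspan (range v - {v k})"
    have "cspan (range v - {v k}) \<subseteq> {x. \<psi> k x = 0}"
      using assms(2) by (intro complex_vector.span_minimal csubspace_kernel assms(1)) auto
    then show False using k assms(2)[of k k] by auto
  qed
qed

lemma biorthogonal_not_finite_cdim:
  fixes \<psi> :: "nat \<Rightarrow> 'a::complex_normed_vector \<Rightarrow> complex"
  assumes "\<And>k. bounded_clinear (\<psi> k)" "\<And>j k. \<psi> k (v j) = (if j = k then 1 else 0)"
    "range v \<subseteq> Y"
  shows "\<not> finite_cdim Y"
proof
  assume "finite_cdim Y"
  then obtain B where "finite B" "cspan B = Y" by (auto simp: finite_cdim_def)
  then have "finite (range v)"
    using complex_vector.independent_span_bound[of B "range v"]
      biorthogonal_independent[OF assms(1,2)] assms(3) by blast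
  then show False
    using biorthogonal_independent(1)[OF assms(1,2)] finite_imageD by blast
qed

text \<open>Were \<open>v j\<close> congruent modulo \<open>Y\<close> to some \<open>b j\<close> in
  a finite-dimensional span, the \<open>b j\<close> would be biorthogonal to the same functionals,
  since these vanish on \<open>Y\<close>.\<close>

lemma biorthogonal_not_finite_ccodim:
  fixes \<psi> :: "nat \<Rightarrow> 'a::complex_normed_vector \<Rightarrow> complex"
  assumes lin: "\<And>k. bounded_clinear (\<psi> k)"
    and bi: "\<And>j k. \<psi> k (v j) = (if j = k then 1 else 0)"
    and Y: "\<And>k y. y \<in> Y \<Longrightarrow> \<psi> k y = 0"
  shows "\<not> finite_ccodim Y"
proof
  assume "finite_ccodim Y"
  then obtain B where B: "finite B" "\<And>x. \<exists>b\<in>cspan B. x - b \<in> Y"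
    by (auto simp: finite_ccodim_def)
  then have "\<forall>j. \<exists>b. b \<in> cspan B \<and> v j - b \<in> Y" by blast
  then obtain b where b: "\<And>j. b j \<in> cspan B" "\<And>j. v j - b j \<in> Y" by metis
  have "\<psi> k (b j) = (if j = k then 1 else 0)" for j k
    using Y[OF b(2)[of j], of k] bi[where j=j and k=k] by (simp add: bounded_clinear_diff[OF lin])
  then show False
    using biorthogonal_not_finite_cdim[of \<psi> b "cspan B"] lin b(1) finite_cdim_span[OF B(1)]
    by blast
qed

text \<open>The sum is a bounded projection onto \<open>cspan B\<close>. Hahn-Banach extends it by
  one vector at a time; this needs the previous span to be closed, which holds because that span is
  the kernel of the previous projection minus the identity.\<close>

lemma finite_cdim_projection:
  fixes B :: "'a::complex_normed_vector set"
  assumes "finite B"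
  obtains C and g :: "'a \<Rightarrow> 'a \<Rightarrow> complex" where "finite C" "C \<subseteq> cspan B"
    "\<And>c. bounded_clinear (g c)" "\<And>x. x \<in> cspan B \<Longrightarrow> (\<Sum>c\<in>C. g c x *\<^sub>C c) = x"
proof -
  have "\<exists>C g. finite C \<and> C \<subseteq> cspan B \<and> (\<forall>c::'a. bounded_clinear (g c :: 'a \<Rightarrow> complex)) \<and>
      (\<forall>x\<in>cspan B. (\<Sum>c\<in>C. g c x *\<^sub>C c) = x)"
    using assms
  proof (induction B)
    case empty
    show ?case
      using bounded_clinear_const_0 by (intro exI[of _ "{}"] exI[of _ "\<lambda>c x. 0"]) auto
  next
    case (insert b B)
    then obtain C and g :: "'a \<Rightarrow> 'a \<Rightarrow> complex" where C: "finite C" "C \<subseteq> cspan B"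
      and g: "\<And>c. bounded_clinear (g c)"
      and proj: "\<And>x. x \<in> cspan B \<Longrightarrow> (\<Sum>c\<in>C. g c x *\<^sub>C c) = x" by blast
    define P where "P x = (\<Sum>c\<in>C. g c x *\<^sub>C c)" for x
    have P: "bounded_clinear P"
      unfolding P_def
      by (intro bounded_clinear_setsum bounded_clinear_compose[OF bounded_clinear_scaleC_left] g)
    have Pin: "P x \<in> cspan B" for x
      unfolding P_def using C(2)
      by (intro complex_vector.span_sum complex_vector.span_scale) auto
    have "x \<in> cspan B \<longleftrightarrow> P x - x = 0" for x
      using proj[of x] Pin[of x] by (auto simp: P_def)
    then have fixed: "cspan B = {x. P x - x = 0}" by blast
    show ?case
    proof (cases "b \<in> cspan B")
      case True
      then have "cspan (insert b B) = cspan B" by (rule complex_vector.span_redundant)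
      then show ?thesis using C g proj by metis
    next
      case False
      have "closed (cspan B)"
        unfolding fixed by (intro closed_kernel bounded_clinear_sub P bounded_clinear_ident)
      then have "closed_csubspace (cspan B)"
        by (simp add: closed_csubspace_def complex_vector.subspace_span)
      then obtain f :: "'a \<Rightarrow> complex" where f: "bounded_clinear f"
        "\<And>x. x \<in> cspan B \<Longrightarrow> f x = 0" "f b = 1"
        using closed_csubspace_separation False by metis
      \<comment> \<open>The part \<open>P b\<close> is already reproduced by the old projection and
        is removed so as not to be counted twice.\<close>
      define b' where "b' = b - P b"
      have b'C: "b' \<notin> C"
        using f(2)[of b'] f(2)[OF Pin, of b] f(3) C(2)
        by (auto simp: b'_def bounded_clinear_diff[OF f(1)])
      have sub: "cspan B \<subseteq> cspan (insert b B)"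
        by (rule complex_vector.span_mono) auto
      have "b' \<in> cspan (insert b B)"
        unfolding b'_def using Pin sub by (intro complex_vector.span_diff) (auto intro: complex_vector.span_base)
      then have "insert b' C \<subseteq> cspan (insert b B)" using C(2) sub by auto
      moreover have "\<forall>c. bounded_clinear ((g(b' := f)) c)" using g f(1) by simp
      moreover have "(\<Sum>c\<in>insert b' C. (g(b' := f)) c x *\<^sub>C c) = x"
        if x: "x \<in> cspan (insert b B)" for x
      proof -
        have "(\<Sum>c\<in>insert b' C. (g(b' := f)) c x *\<^sub>C c) = f x *\<^sub>C b' + P x"
          using C(1) b'C by (auto simp: P_def intro!: sum.cong arg_cong2[where f = "(+)"])
        moreover obtain k where k: "x - k *\<^sub>C b \<in> cspan B"
          using x complex_vector.span_breakdown_eq by metis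
        have "f x = k"
          using f(2)[OF k] f(3)
          by (simp add: bounded_clinear_diff[OF f(1)] bounded_clinear_scale'[OF f(1)])
        moreover have "P x = x - k *\<^sub>C b + k *\<^sub>C P b"
          using k unfolding fixed
          by (simp add: bounded_clinear_diff[OF P] bounded_clinear_scale[OF P] algebra_simps)
        ultimately show ?thesis
          by (simp add: b'_def complex_vector.scale_right_diff_distrib)
      qed
      ultimately show ?thesis using C(1) by (meson finite_insert)
    qed
  qed
  then show thesis using that by blast
qed

lemma closed_cspan_finite:
  assumes "finite B"
  shows "closed (cspan B)"
proof -
  obtain C and g :: "'a \<Rightarrow> 'a \<Rightarrow> complex" where C: "finite C" "C \<subseteq> cspan B"
    and g: "\<And>c. bounded_clinear (g c)"
    and proj: "\<And>x. x \<in> cspan B \<Longrightarrow> (\<Sum>c\<in>C. g c x *\<^sub>C c) = x"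
    using finite_cdim_projection[OF assms] by metis
  have "(\<Sum>c\<in>C. g c x *\<^sub>C c) \<in> cspan B" for x
    using C(2) by (intro complex_vector.span_sum complex_vector.span_scale) auto
  then have "x \<in> cspan B \<longleftrightarrow> (\<Sum>c\<in>C. g c x *\<^sub>C c) - x = 0" for x
    using proj[of x] by (metis eq_iff_diff_eq_0)
  then have "cspan B = {x. (\<Sum>c\<in>C. g c x *\<^sub>C c) - x = 0}" by blast
  also have "closed \<dots>"
    by (intro closed_kernel bounded_clinear_sub bounded_clinear_ident bounded_clinear_setsum
        bounded_clinear_compose[OF bounded_clinear_scaleC_left] g)
  finally show ?thesis .
qed

lemma closed_csubspace_cspan_finite: "finite B \<Longrightarrow> closed_csubspace (cspan B)"
  by (simp add: closed_csubspace_def closed_cspan_finite complex_vector.subspace_span)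

lemma closed_csubspace_finite_cdim: "finite_cdim Y \<Longrightarrow> closed_csubspace Y"
  unfolding finite_cdim_def using closed_csubspace_cspan_finite by blast

section \<open>Half-spaces that are invariant up to one dimension\<close>

definition adjoin :: "'a::complex_normed_vector set \<Rightarrow> 'a \<Rightarrow> 'a set"
  where "adjoin Y u = {x. \<exists>c. x - c *\<^sub>C u \<in> Y}"

lemma adjoin_eq_cspan: "csubspace Y \<Longrightarrow> adjoin Y u = cspan (insert u Y)"
  by (simp add: adjoin_def complex_vector.span_insert complex_vector.span_eq_iff[THEN iffD2])

lemma csubspace_adjoin: "csubspace Y \<Longrightarrow> csubspace (adjoin Y u)"
  by (simp add: adjoin_eq_cspan complex_vector.subspace_span)

lemma subset_adjoin: "Y \<subseteq> adjoin Y u"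
  by (auto simp: adjoin_def intro: exI[of _ 0])

lemma adjoin_self: "csubspace Y \<Longrightarrow> u \<in> adjoin Y u"
  by (auto simp: adjoin_def complex_vector.subspace_0 intro!: exI[of _ 1])

text \<open>For \<open>u\<close> outside \<open>Y\<close>, the coefficient \<open>c\<close> is the
  value of a continuous functional that vanishes on \<open>Y\<close> and is 1 at \<open>u\<close>,
  so membership becomes a closed condition.\<close>

lemma closed_csubspace_adjoin:
  fixes Y :: "'a::complex_normed_vector set"
  assumes "closed_csubspace Y"
  shows "closed_csubspace (adjoin Y u)"
proof (cases "u \<in> Y")
  case True
  then have "adjoin Y u = Y"
    using assms by (simp add: adjoin_eq_cspan closed_csubspace_def insert_absorb
        complex_vector.span_eq_iff)
  then show ?thesis using assms by simp
next
  case False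
  then obtain f :: "'a \<Rightarrow> complex" where f: "bounded_clinear f" "\<And>y. y \<in> Y \<Longrightarrow> f y = 0" "f u = 1"
    using closed_csubspace_separation[OF assms] by metis
  have "adjoin Y u = {x. x - f x *\<^sub>C u \<in> Y}"
  proof -
    have "f x = c" if "x - c *\<^sub>C u \<in> Y" for x c
      using f(2)[OF that] f(3)
      by (simp add: bounded_clinear_diff[OF f(1)] bounded_clinear_scale'[OF f(1)])
    then show ?thesis by (auto simp: adjoin_def)
  qed
  also have "closed \<dots>"
    using assms
    by (intro closed_vimage_bounded_clinear bounded_clinear_sub bounded_clinear_ident
        bounded_clinear_compose[OF bounded_clinear_scaleC_left f(1)])
      (simp add: closed_csubspace_def)
  finally show ?thesis
    using assms csubspace_adjoin by (auto simp: closed_csubspace_def)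
qed

lemma finite_ccodim_adjoin:
  assumes "csubspace Y" "finite_ccodim (adjoin Y u)"
  shows "finite_ccodim Y"
proof -
  obtain B where B: "finite B" "\<And>x. \<exists>b\<in>cspan B. x - b \<in> adjoin Y u"
    using assms(2) by (auto simp: finite_ccodim_def)
  have "\<exists>b\<in>cspan (insert u B). x - b \<in> Y" for x
  proof -
    obtain b c where bc: "b \<in> cspan B" "x - b - c *\<^sub>C u \<in> Y"
      using B(2)[of x] by (auto simp: adjoin_def)
    have "b + c *\<^sub>C u \<in> cspan (insert u B)"
      using bc(1) complex_vector.span_mono[OF subset_insertI, of B u]
      by (intro complex_vector.span_add complex_vector.span_scale)
        (auto intro: complex_vector.span_base)
    then show ?thesis
      using bc(2) by (intro bexI[of _ "b + c *\<^sub>C u"]) (simp_all add: diff_diff_eq)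
  qed
  then show ?thesis
    using B(1) unfolding finite_ccodim_def by (intro exI[of _ "insert u B"]) simp
qed

lemma half_space_hyperplane:
  fixes f :: "'a::complex_normed_vector \<Rightarrow> complex"
  assumes "half_space Y" "bounded_clinear f"
  shows "half_space {y\<in>Y. f y = 0}"
proof -
  have Y: "csubspace Y" "closed Y" "\<not> finite_cdim Y" "\<not> finite_ccodim Y"
    using assms(1) by (auto simp: half_space_def closed_csubspace_def)
  have "closed_csubspace {y\<in>Y. f y = 0}"
    using complex_vector.subspace_inter[OF Y(1) csubspace_kernel[OF assms(2)]]
      closed_Int[OF Y(2) closed_kernel[OF assms(2)]]
    by (simp add: closed_csubspace_def Collect_conj_eq)
  then show ?thesis
    using finite_cdim_hyperplane[OF assms(2) Y(1)] Y(3,4) finite_ccodim_mono[of "{y\<in>Y. f y = 0}" Y]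
    by (auto simp: half_space_def)
qed

lemma half_space_adjoin:
  assumes "half_space Y"
  shows "half_space (adjoin Y u)"
  unfolding half_space_def
proof (intro conjI notI)
  have Y: "closed_csubspace Y" "csubspace Y" "\<not> finite_cdim Y" "\<not> finite_ccodim Y"
    using assms by (auto simp: half_space_def closed_csubspace_def)
  show "closed_csubspace (adjoin Y u)" using Y(1) by (rule closed_csubspace_adjoin)
  show False if "finite_cdim (adjoin Y u)"
    using finite_cdim_subspace[OF Y(2) subset_adjoin that] Y(3) by blast
  show False if "finite_ccodim (adjoin Y u)"
    using finite_ccodim_adjoin[OF Y(2) that] Y(4) by blast
qed

text \<open>If some \<open>y\<close> in \<open>Y\<close> is not an eigenvector, a hyperplane of
  \<open>Y\<close> that contains \<open>y\<close> but not \<open>T y\<close> serves. Otherwise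
  \<open>T\<close> is scalar on \<open>Y\<close>, and a hyperplane of \<open>Y\<close> is enlarged
  by a vector outside \<open>Y\<close> whose image leaves the enlarged space.\<close>

lemma invariant_half_space_perturb:
  fixes T :: "'a::complex_normed_vector \<Rightarrow> 'a"
  assumes T: "bounded_clinear T" and hs: "half_space Y" and inv: "T ` Y \<subseteq> Y"
    and nonscalar: "\<nexists>c. T = scaleC c"
  obtains Y' e where "half_space Y'" "T ` Y' \<subseteq> adjoin Y' e" "\<not> T ` Y' \<subseteq> Y'"
proof (cases "\<exists>y\<in>Y. T y \<notin> cspan {y}")
  case True
  then obtain y where y: "y \<in> Y" "T y \<notin> cspan {y}" by blast
  then obtain f :: "'a \<Rightarrow> complex" where f: "bounded_clinear f"
    "\<And>z. z \<in> cspan {y} \<Longrightarrow> f z = 0" "f (T y) = 1"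
    using closed_csubspace_separation[OF closed_csubspace_cspan_finite[of "{y}"]] by blast
  define Y' where "Y' = {z\<in>Y. f z = 0}"
  have Ys: "csubspace Y" using hs by (simp add: half_space_def closed_csubspace_def)
  have "half_space Y'" unfolding Y'_def by (rule half_space_hyperplane[OF hs f(1)])
  moreover have "T ` Y' \<subseteq> adjoin Y' (T y)"
  proof clarify
    fix z assume "z \<in> Y'"
    then have "T z - f (T z) *\<^sub>C T y \<in> Y'"
      using inv y(1) f(3) unfolding Y'_def
      by (auto simp: bounded_clinear_diff[OF f(1)] bounded_clinear_scale'[OF f(1)]
          intro!: complex_vector.subspace_diff[OF Ys] complex_vector.subspace_scale[OF Ys])
    then show "T z \<in> adjoin Y' (T y)" by (auto simp: adjoin_def)
  qed
  moreover have "y \<in> Y'" "T y \<notin> Y'"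
    using y(1) f(2)[OF complex_vector.span_base, of y] f(3) by (auto simp: Y'_def)
  ultimately show thesis using that by blast
next
  case False
  have Ys: "csubspace Y" and Yinf: "\<not> finite_cdim Y"
    using hs by (simp_all add: half_space_def closed_csubspace_def)
  have eig: "\<exists>c. T y = c *\<^sub>C y" if "y \<in> Y" for y
    using False that by (auto simp: complex_vector.span_singleton)
  obtain v where v: "v \<in> Y" "v \<noteq> 0"
    using Yinf finite_cdim_0 Ys complex_vector.subspace_0 by (metis singleton_iff subset_antisym subsetI)
  obtain d where d: "T v = d *\<^sub>C v" using eig[OF v(1)] by blast
  \<comment> \<open>Since all vectors of \<open>Y\<close> are eigenvectors, comparing
    \<open>y\<close>, \<open>v\<close> and \<open>y + v\<close> shows that they share one
    eigenvalue.\<close>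
  have Td: "T y = d *\<^sub>C y" if y: "y \<in> Y" for y
  proof -
    obtain c where c: "T y = c *\<^sub>C y" using eig[OF y] by blast
    obtain b where b: "T (y + v) = b *\<^sub>C (y + v)"
      using eig[OF complex_vector.subspace_add[OF Ys y v(1)]] by blast
    have *: "(c - b) *\<^sub>C y = (b - d) *\<^sub>C v"
      using b by (simp add: bounded_clinear_add[OF T] c d algebra_simps
          complex_vector.scale_left_diff_distrib scaleC_add_right)
    show ?thesis
    proof (cases "c = b")
      case True
      then have "b = d" using * v(2) by simp
      then show ?thesis using c True by simp
    next
      case False
      then have "(1 / (c - b)) *\<^sub>C (c - b) *\<^sub>C y = (1 / (c - b)) *\<^sub>C (b - d) *\<^sub>C v"
        using * by simp
      then have "y = ((b - d) / (c - b)) *\<^sub>C v"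
        using False by (simp add: scaleC_scaleC scaleC_one)
      then show ?thesis
        by (simp add: bounded_clinear_scale[OF T] d scaleC_scaleC mult.commute)
    qed
  qed
  obtain u0 where u0: "T u0 \<noteq> d *\<^sub>C u0" using nonscalar by blast
  then have u0Y: "u0 \<notin> Y" using Td by blast
  obtain u where u: "T u \<notin> cspan {u}"
  proof (cases "T u0 \<in> cspan {u0}")
    case True
    then obtain c where c: "T u0 = c *\<^sub>C u0" by (auto simp: complex_vector.span_singleton)
    \<comment> \<open>Here \<open>u0\<close> and \<open>v\<close> are independent eigenvectors with
      distinct eigenvalues \<open>c\<close> and \<open>d\<close>, so their sum is not an
      eigenvector.\<close>
    have "T (u0 + v) \<notin> cspan {u0 + v}"
    proof
      assume "T (u0 + v) \<in> cspan {u0 + v}"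
      then obtain a where "T (u0 + v) = a *\<^sub>C (u0 + v)"
        by (auto simp: complex_vector.span_singleton)
      then have *: "(c - a) *\<^sub>C u0 = (a - d) *\<^sub>C v"
        by (simp add: bounded_clinear_add[OF T] c d algebra_simps
          complex_vector.scale_left_diff_distrib scaleC_add_right)
      show False
      proof (cases "c = a")
        case True
        then have "a = d" using * v(2) by simp
        then show False using u0 c True by simp
      next
        case False
        then have "(1 / (c - a)) *\<^sub>C (c - a) *\<^sub>C u0 = (1 / (c - a)) *\<^sub>C (a - d) *\<^sub>C v"
          using * by simp
        then have "u0 = ((a - d) / (c - a)) *\<^sub>C v"
          using False by (simp add: scaleC_scaleC scaleC_one)
        then show False using u0Y v(1) complex_vector.subspace_scale[OF Ys] by metis
      qed
    qed
    then show thesis using that by blast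
  qed (use that in blast)
  obtain f :: "'a \<Rightarrow> complex" where f: "bounded_clinear f"
    "\<And>z. z \<in> cspan {u} \<Longrightarrow> f z = 0" "f (T u) = 1"
    using closed_csubspace_separation[OF closed_csubspace_cspan_finite[of "{u}"]] u by blast
  have fu: "f u = 0" using f(2)[OF complex_vector.span_base, of u] by simp
  \<comment> \<open>Cutting \<open>Y\<close> down to the kernel of \<open>f\<close> puts all of
    \<open>adjoin W u\<close> into that kernel, while \<open>f (T u) = 1\<close>.\<close>
  define W where "W = {z\<in>Y. f z = 0}"
  have W: "half_space W" unfolding W_def by (rule half_space_hyperplane[OF hs f(1)])
  have Ws: "csubspace (adjoin W u)"
    using half_space_adjoin[OF W] by (simp add: half_space_def closed_csubspace_def)
  have uW: "u \<in> adjoin W u"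
    using W by (intro adjoin_self) (simp add: half_space_def closed_csubspace_def)
  have "f x = 0" if "x \<in> adjoin W u" for x
    using that fu unfolding adjoin_def W_def
    by (auto simp: bounded_clinear_diff[OF f(1)] bounded_clinear_scale'[OF f(1)])
  then have "T u \<notin> adjoin W u" using f(3) by (metis zero_neq_one)
  moreover have "T ` adjoin W u \<subseteq> adjoin (adjoin W u) (T u)"
  proof clarify
    fix x assume "x \<in> adjoin W u"
    then obtain c where c: "x - c *\<^sub>C u \<in> W" by (auto simp: adjoin_def)
    have "T x - c *\<^sub>C T u = T (x - c *\<^sub>C u)"
      by (simp add: bounded_clinear_diff[OF T] bounded_clinear_scale[OF T])
    also have "\<dots> = d *\<^sub>C (x - c *\<^sub>C u)" using c Td by (simp add: W_def)
    also have "\<dots> \<in> adjoin W u"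
      using c subset_adjoin by (intro complex_vector.subspace_scale[OF Ws]) blast
    finally show "T x \<in> adjoin (adjoin W u) (T u)" unfolding adjoin_def[of "adjoin W u"] by blast
  qed
  ultimately show thesis using that[OF half_space_adjoin[OF W]] uW by blast
qed

text \<open>The span of \<open>e\<close> is a defect space of dimension at most one, and a defect of
  zero would be attained by the zero subspace, making \<open>Y\<close> invariant.\<close>

lemma half_space_defect_le_1:
  fixes T :: "'a::complex_normed_vector \<Rightarrow> 'a"
  assumes hs: "half_space Y" and e: "T ` Y \<subseteq> adjoin Y e"
  shows "almost_invariant_half_space T Y" "defect T Y \<le> 1" "\<not> T ` Y \<subseteq> Y \<Longrightarrow> defect T Y = 1"
proof -
  have ds: "defect_space T Y (cspan {e})"
    unfolding defect_space_def
  proof (intro conjI subsetI)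
    fix z assume "z \<in> T ` Y"
    then obtain c where "z - c *\<^sub>C e \<in> Y" using e by (auto simp: adjoin_def)
    moreover have "c *\<^sub>C e \<in> cspan {e}" by (auto simp: complex_vector.span_singleton)
    moreover have "z = (z - c *\<^sub>C e) + c *\<^sub>C e" by simp
    ultimately show "z \<in> {y + m |y m. y \<in> Y \<and> m \<in> cspan {e}}" by blast
  qed (simp_all add: complex_vector.subspace_span finite_cdim_span)
  then show "almost_invariant_half_space T Y"
    using hs by (auto simp: almost_invariant_half_space_def almost_invariant_def half_space_def)
  have "defect T Y \<le> complex_vector.dim (cspan {e})"
    unfolding defect_def by (rule Least_le) (use ds in blast)
  also have "\<dots> \<le> 1"
    using complex_vector.dim_le_card[of "cspan {e}" "{e}"] by simp
  finally show le: "defect T Y \<le> 1" .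
  assume not: "\<not> T ` Y \<subseteq> Y"
  have "defect T Y \<noteq> 0"
  proof
    assume "defect T Y = 0"
    moreover have "\<exists>M. defect_space T Y M \<and> complex_vector.dim M = defect T Y"
      unfolding defect_def
      by (rule LeastI_ex) (use ds in blast)
    ultimately obtain M where M: "defect_space T Y M" "complex_vector.dim M = 0" by auto
    then obtain B where B: "finite B" "cspan B = M"
      by (auto simp: defect_space_def finite_cdim_def)
    obtain C where C: "C \<subseteq> M" "complex_vector.independent C" "M \<subseteq> cspan C"
      "card C = complex_vector.dim M"
      using complex_vector.basis_exists by metis
    \<comment> \<open>A cardinality of zero alone would not exclude an infinite basis; finiteness
      makes \<open>C\<close> empty.\<close>
    have "finite C"
      using complex_vector.independent_span_bound[OF B(1) C(2)] C(1) B(2) by blast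
    then have "M \<subseteq> {0}" using C(3,4) M(2) by simp
    then show False using M(1) not unfolding defect_space_def by fastforce
  qed
  then show "defect T Y = 1" using le by simp
qed

text \<open>Only an invariant \<open>Y\<close> of a nonscalar operator has to be replaced: a
  half-space that is not invariant already has defect one, and for scalar operators the last
  conjunct is vacuous.\<close>

theorem defect_one_from_half_space:
  fixes T :: "'a::complex_normed_vector \<Rightarrow> 'a"
  assumes T: "bounded_clinear T" and Y: "half_space Y" "T ` Y \<subseteq> adjoin Y e"
  shows "\<exists>Y. almost_invariant_half_space T Y \<and> defect T Y \<le> 1 \<and>
    ((\<nexists>c. T = scaleC c) \<longrightarrow> defect T Y = 1)"
proof (cases "T ` Y \<subseteq> Y \<and> (\<nexists>c. T = scaleC c)")
  case True
  then obtain Y' e' where "half_space Y'" "T ` Y' \<subseteq> adjoin Y' e'" "\<not> T ` Y' \<subseteq> Y'"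
    using invariant_half_space_perturb[OF T Y(1)] by blast
  then show ?thesis by (intro exI[of _ Y'] conjI impI half_space_defect_le_1)
next
  case False
  then show ?thesis
    by (intro exI[of _ Y] conjI impI half_space_defect_le_1[OF Y]) blast+
qed

section \<open>Biorthogonal sequences and half-spaces\<close>

text \<open>The matrix \<open>\<phi> j (u i)\<close> is triangular with unit diagonal and tiny
  remaining entries. The row where the weighted coefficient \<open>cmod (a i) / C i\<close> attains
  its maximum \<open>M\<close> controls all others: the weights \<open>(1/2) ^ (i + 2)\<close> keep
  the off-diagonal part below \<open>M / 2\<close>, which is absorbed because
  \<open>C j \<ge> 1\<close>.\<close>

lemma triangular_coefficient_bound:
  fixes u :: "nat \<Rightarrow> 'a::complex_normed_vector" and \<phi> :: "nat \<Rightarrow> 'a \<Rightarrow> complex"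
  assumes lin: "\<And>k. bounded_clinear (\<phi> k)" and diag: "\<And>k. \<phi> k (u k) = 1"
    and zero: "\<And>j k. j < k \<Longrightarrow> \<phi> k (u j) = 0" and C1: "\<And>k. C k \<ge> 1"
    and bound: "\<And>k y. cmod (\<phi> k y) \<le> C k * norm y"
    and small: "\<And>j k. j < k \<Longrightarrow> cmod (\<phi> j (u k)) \<le> (1/2) ^ (k + 2) / C k"
    and n: "\<And>k. \<phi> k n = 0" and k: "k < m"
  shows "cmod (a k) \<le> 2 * C k * norm (n + (\<Sum>i<m. a i *\<^sub>C u i))"
proof -
  define y where "y = n + (\<Sum>i<m. a i *\<^sub>C u i)"
  have Cpos: "C i > 0" for i using C1[of i] by linarith
  define M where "M = Max ((\<lambda>i. cmod (a i) / C i) ` {..<m})"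
  have M: "cmod (a i) \<le> M * C i" if "i < m" for i
  proof -
    have "cmod (a i) / C i \<le> M" unfolding M_def using that by (intro Max_ge) auto
    then show ?thesis using Cpos[of i] by (simp add: field_simps)
  qed
  have "M \<in> (\<lambda>i. cmod (a i) / C i) ` {..<m}"
    unfolding M_def using k by (intro Max_in) auto
  then obtain j where j: "j < m" "M = cmod (a j) / C j" by auto
  have M0: "M \<ge> 0" using Cpos[of j] by (simp add: j(2))
  have "\<phi> j y = (\<Sum>i<m. a i * \<phi> j (u i))"
    by (simp add: y_def bounded_clinear_add[OF lin] bounded_clinear_sum[OF lin] n
        bounded_clinear_scale'[OF lin])
  also have "\<dots> = a j + (\<Sum>i\<in>{..<m} - {j}. a i * \<phi> j (u i))"
    using j(1) by (subst sum.remove[of _ j]) (auto simp: diag)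
  finally have aj: "a j = \<phi> j y - (\<Sum>i\<in>{..<m} - {j}. a i * \<phi> j (u i))" by simp
  have "cmod (\<Sum>i\<in>{..<m} - {j}. a i * \<phi> j (u i)) \<le> (\<Sum>i\<in>{..<m} - {j}. M * (1/2) ^ (i + 2))"
  proof (rule sum_norm_le)
    fix i assume i: "i \<in> {..<m} - {j}"
    show "cmod (a i * \<phi> j (u i)) \<le> M * (1/2) ^ (i + 2)"
    proof (cases "i < j")
      case True
      then show ?thesis using zero M0 by simp
    next
      case False
      then have "cmod (a i) * cmod (\<phi> j (u i)) \<le> (M * C i) * ((1/2) ^ (i + 2) / C i)"
        using i M0 Cpos[of i] by (intro mult_mono M small) auto
      then show ?thesis using Cpos[of i] by (simp add: norm_mult)
    qed
  qed
  also have "\<dots> \<le> (\<Sum>i<m. M * (1/2) ^ (i + 2))"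
    using M0 by (intro sum_mono2) auto
  also have "\<dots> = M / 4 * (\<Sum>i<m. (1/2) ^ i)"
    by (simp add: sum_distrib_left power_add field_simps)
  also have "(\<Sum>i<m. (1/2) ^ i) \<le> (2::real)"
    by (simp add: sum_gp_strict)
  then have "M / 4 * (\<Sum>i<m. (1/2) ^ i) \<le> M / 4 * 2"
    using M0 by (intro mult_left_mono) auto
  finally have "cmod (a j) \<le> C j * norm y + M / 2"
    using norm_triangle_ineq4[of "\<phi> j y" "\<Sum>i\<in>{..<m} - {j}. a i * \<phi> j (u i)"] bound[of j y]
    unfolding aj[symmetric] by linarith
  moreover have "cmod (a j) = M * C j" using Cpos[of j] by (simp add: j(2))
  moreover have "M / 2 \<le> C j * (M / 2)" using C1[of j] M0 by (simp add: mult_left_le_one_le mult_le_cancel_right1)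
  ultimately have "C j * M \<le> C j * (2 * norm y)" by (simp add: algebra_simps)
  then have "M \<le> 2 * norm y" using Cpos[of j] by simp
  then have "M * C k \<le> 2 * norm y * C k" using Cpos[of k] by (intro mult_right_mono) auto
  then show ?thesis using M[OF k] by (simp add: y_def mult_ac)
qed

lemma cspan_finite_sum_representation:
  fixes u :: "nat \<Rightarrow> 'a::complex_normed_vector"
  assumes "z \<in> cspan (B \<union> u ` I)"
  obtains n a m where "n \<in> cspan B" "\<And>i. i \<notin> I \<Longrightarrow> a i = 0" "\<And>i. i \<ge> m \<Longrightarrow> a i = 0"
    "z = n + (\<Sum>i<m. a i *\<^sub>C u i)"
proof -
  have "\<exists>n a m. n \<in> cspan B \<and> (\<forall>i. i \<notin> I \<longrightarrow> a i = 0) \<and> (\<forall>i\<ge>m. a i = 0) \<and>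
      z = n + (\<Sum>i<m. a i *\<^sub>C u i)"
    using assms
  proof (induction rule: complex_vector.span_induct_alt)
    case base
    show ?case
      by (intro exI[of _ 0] exI[of _ "\<lambda>i. 0"]) (simp add: complex_vector.span_zero)
  next
    case (step c x y)
    then obtain n a m where n: "n \<in> cspan B" "\<And>i. i \<notin> I \<Longrightarrow> a i = 0" "\<And>i. i \<ge> m \<Longrightarrow> a i = 0"
      "y = n + (\<Sum>i<m. a i *\<^sub>C u i)" by blast
    show ?case
    proof (cases "x \<in> B")
      case True
      then have "c *\<^sub>C x + n \<in> cspan B"
        using n(1) by (intro complex_vector.span_add complex_vector.span_scale)
          (auto intro: complex_vector.span_base)
      then show ?thesis
        using n by (intro exI[of _ "c *\<^sub>C x + n"] exI[of _ a] exI[of _ m]) simp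
    next
      case False
      then obtain i where i: "i \<in> I" "x = u i" using step(1) by blast
      define m' where "m' = max m (Suc i)"
      define a' where "a' = (\<lambda>j. a j + (if j = i then c else 0))"
      have "(\<Sum>j<m'. a' j *\<^sub>C u j) =
          (\<Sum>j<m'. a j *\<^sub>C u j) + (\<Sum>j<m'. if j = i then c *\<^sub>C u j else 0)"
        unfolding sum.distrib[symmetric] a'_def
        by (intro sum.cong) (auto simp: scaleC_add_left)
      also have "(\<Sum>j<m'. if j = i then c *\<^sub>C u j else 0) = c *\<^sub>C x"
        using i by (simp add: m'_def less_max_iff_disj)
      also have "(\<Sum>j<m'. a j *\<^sub>C u j) = (\<Sum>j<m. a j *\<^sub>C u j)"
        using n(3) by (intro sum.mono_neutral_right) (auto simp: m'_def)
      finally have "c *\<^sub>C x + y = n + (\<Sum>j<m'. a' j *\<^sub>C u j)"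
        using n(4) by simp
      moreover have "\<forall>j. j \<notin> I \<longrightarrow> a' j = 0" "\<forall>j\<ge>m'. a' j = 0"
        using n(2,3) i(1) by (auto simp: a'_def m'_def)
      ultimately show ?thesis using n(1) by blast
    qed
  qed
  then show thesis using that by blast
qed

text \<open>The functionals need not be bounded uniformly in \<open>k\<close>: the bound \<open>C k\<close> depends only on the
  vectors chosen earlier, so \<open>u k\<close> can be chosen almost annihilated relative to it.\<close>

lemma biorthogonal_selection:
  fixes A :: "'a::complex_normed_vector set"
  assumes B: "finite B"
    and A: "\<And>\<Phi> \<epsilon>. finite \<Phi> \<Longrightarrow> (\<And>f. f \<in> \<Phi> \<Longrightarrow> bounded_clinear (f :: 'a \<Rightarrow> complex)) \<Longrightarrow> \<epsilon> > 0 \<Longrightarrow>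
      \<exists>w\<in>A. norm w \<ge> 1 \<and> (\<forall>f\<in>\<Phi>. cmod (f w) < \<epsilon>)"
  obtains u :: "nat \<Rightarrow> 'a" and \<psi> :: "nat \<Rightarrow> 'a \<Rightarrow> complex" where "\<And>k. u k \<in> A"
    "\<And>k. bounded_clinear (\<psi> k)" "\<And>j k. \<psi> k (u j) = (if j = k then 1 else 0)"
    "\<And>k z. z \<in> cspan B \<Longrightarrow> \<psi> k z = 0"
proof -
  \<comment> \<open>Each stage records a vector, a functional that vanishes on \<open>B\<close> and
    on the earlier vectors, and a norm bound for it. The last clause makes the earlier functionals
    small on the new vector, relative to the new bound.\<close>
  define Q :: "(nat \<Rightarrow> 'a \<times> ('a \<Rightarrow> complex) \<times> real) \<Rightarrow> nat \<Rightarrow> 'a \<times> ('a \<Rightarrow> complex) \<times> real \<Rightarrow> bool"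
    where "Q F k r \<longleftrightarrow> (case r of (w, \<phi>, C) \<Rightarrow>
      w \<in> A \<and> bounded_clinear \<phi> \<and> (\<forall>z\<in>cspan B. \<phi> z = 0) \<and> \<phi> w = 1 \<and> C \<ge> 1 \<and>
      (\<forall>y. cmod (\<phi> y) \<le> C * norm y) \<and> (\<forall>j<k. \<phi> (fst (F j)) = 0) \<and>
      (\<forall>j<k. cmod (fst (snd (F j)) w) \<le> (1/2) ^ (k + 2) / C))" for F k r
  have "\<exists>F. \<forall>k. Q F k (F k)"
  proof (rule dependent_wf_choice[where R = less_than])
    show "Q f x r = Q g x r" if "\<And>z. (z, x) \<in> less_than \<Longrightarrow> f z = g z" for f g x r
      using that unfolding Q_def by (auto split: prod.splits)
  next
    fix k F assume IH: "\<And>j. (j, k) \<in> less_than \<Longrightarrow> Q F j (F j)"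
    then have lin: "bounded_clinear (fst (snd (F j)))" if "j < k" for j
      using that by (fastforce simp: Q_def split: prod.splits)
    define D where "D = B \<union> (\<lambda>j. fst (F j)) ` {..<k}"
    have "finite D" using B by (simp add: D_def)
    then obtain E and g :: "'a \<Rightarrow> 'a \<Rightarrow> complex" where E: "finite E" "E \<subseteq> cspan D"
      and g: "\<And>c. bounded_clinear (g c)"
      and proj: "\<And>x. x \<in> cspan D \<Longrightarrow> (\<Sum>c\<in>E. g c x *\<^sub>C c) = x"
      using finite_cdim_projection by metis
    define P where "P x = (\<Sum>c\<in>E. g c x *\<^sub>C c)" for x
    have P: "bounded_clinear P"
      unfolding P_def
      by (intro bounded_clinear_setsum bounded_clinear_compose[OF bounded_clinear_scaleC_left] g)
    obtain C0 where C0: "C0 > 0" "\<And>x. norm (x - P x) \<le> C0 * norm x"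
      using bounded_clinear_pos[OF bounded_clinear_sub[OF bounded_clinear_ident P]] by blast
    \<comment> \<open>If \<open>w - P w\<close> has norm at least 1/2, then \<open>w\<close> has
      distance at least \<open>1 / (2 * C0)\<close> from the range of \<open>P\<close>; the maximum
      with 1 serves the triangular estimate. The constant is fixed before \<open>w\<close> is
      chosen.\<close>
    define C where "C = max 1 (2 * C0)"
    have C: "C \<ge> 1" "C \<ge> 2 * C0" by (auto simp: C_def)
    define s where "s = (\<Sum>c\<in>E. norm c)"
    have s: "s \<ge> 0" by (simp add: s_def sum_nonneg)
    \<comment> \<open>The first bound gives \<open>norm (P w) \<le> 1/2\<close>, with
      \<open>s + 1\<close> avoiding division by zero; the second is the smallness required of the
      earlier functionals.\<close>
    define \<epsilon> where "\<epsilon> = min (1 / (2 * (s + 1))) ((1/2) ^ (k + 2) / C)"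
    have \<epsilon>: "\<epsilon> > 0" using s C by (simp add: \<epsilon>_def)
    have "bounded_clinear f" if "f \<in> g ` E \<union> (\<lambda>j. fst (snd (F j))) ` {..<k}" for f
      using that g lin by auto
    then have "\<exists>w\<in>A. norm w \<ge> 1 \<and>
        (\<forall>f\<in>g ` E \<union> (\<lambda>j. fst (snd (F j))) ` {..<k}. cmod (f w) < \<epsilon>)"
      using E(1) by (intro A \<epsilon>) auto
    then obtain w where w: "w \<in> A" "norm w \<ge> 1"
      "\<And>c. c \<in> E \<Longrightarrow> cmod (g c w) < \<epsilon>" "\<And>j. j < k \<Longrightarrow> cmod (fst (snd (F j)) w) < \<epsilon>"
      by auto
    have "norm (P w) \<le> (\<Sum>c\<in>E. \<epsilon> * norm c)"
      unfolding P_def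
      by (rule sum_norm_le)
        (use w(3) in \<open>simp add: norm_scaleC mult_right_mono less_imp_le\<close>)
    also have "\<dots> = \<epsilon> * s" by (simp add: s_def sum_distrib_left)
    also have "\<dots> \<le> 1 / (2 * (s + 1)) * s"
      using s by (intro mult_right_mono) (auto simp: \<epsilon>_def)
    also have "\<dots> \<le> 1/2" using s by (simp add: field_simps)
    finally have Pw: "norm (w - P w) \<ge> 1/2"
      using w(2) norm_triangle_ineq2[of w "P w"] by linarith
    have dist: "1 / C \<le> norm (w - z)" if "z \<in> cspan D" for z
    proof -
      have "P z = z" using proj[OF that] by (simp add: P_def)
      then have "w - P w = (w - z) - P (w - z)" by (simp add: bounded_clinear_diff[OF P])
      then have "1/2 \<le> C0 * norm (w - z)" using Pw C0(2)[of "w - z"] by (metis order_trans)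
      also have "C0 * norm (w - z) \<le> C / 2 * norm (w - z)" using C by (intro mult_right_mono) auto
      finally have "1 \<le> norm (w - z) * C" by (simp add: mult.commute)
      then show ?thesis using C(1) by (simp add: pos_divide_le_eq)
    qed
    then obtain \<phi> :: "'a \<Rightarrow> complex" where \<phi>: "bounded_clinear \<phi>" "\<And>z. z \<in> cspan D \<Longrightarrow> \<phi> z = 0"
      "\<phi> w = 1" "\<And>y. cmod (\<phi> y) \<le> norm y / (1 / C)"
      using hahn_banach_separation[of "cspan D" "1 / C" w] C(1)
      by (metis complex_vector.subspace_span less_le_trans zero_less_divide_1_iff zero_less_one)
    have "cspan B \<subseteq> cspan D" by (rule complex_vector.span_mono) (simp add: D_def)
    moreover have "\<phi> (fst (F j)) = 0" if "j < k" for j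
      using that by (intro \<phi>(2) complex_vector.span_base) (auto simp: D_def)
    moreover have "cmod (fst (snd (F j)) w) \<le> (1/2) ^ (k + 2) / C" if "j < k" for j
      using w(4)[OF that] by (simp add: \<epsilon>_def)
    ultimately have "Q F k (w, \<phi>, C)"
      unfolding Q_def using w(1) \<phi> C(1) by (auto simp: mult.commute)
    then show "\<exists>r. Q F k r" by blast
  qed simp
  then obtain F where F: "\<And>k. Q F k (F k)" by blast
  define u where "u k = fst (F k)" for k
  define \<phi> where "\<phi> k = fst (snd (F k))" for k
  define C where "C k = snd (snd (F k))" for k
  have Fk: "F k = (u k, \<phi> k, C k)" for k by (simp add: u_def \<phi>_def C_def)
  have q: "u k \<in> A" "bounded_clinear (\<phi> k)" "\<And>z. z \<in> cspan B \<Longrightarrow> \<phi> k z = 0" "\<phi> k (u k) = 1"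
    "C k \<ge> 1" "\<And>y. cmod (\<phi> k y) \<le> C k * norm y" "\<And>j. j < k \<Longrightarrow> \<phi> k (u j) = 0"
    "\<And>j. j < k \<Longrightarrow> cmod (\<phi> j (u k)) \<le> (1/2) ^ (k + 2) / C k" for k
    using F[of k] unfolding Q_def Fk by auto
  \<comment> \<open>The functionals \<open>\<phi> k\<close> ignore only the earlier vectors. This
    distance from the span of all the others, earlier and later, allows them to be replaced by truly
    biorthogonal ones.\<close>
  have dist: "1 / (2 * C k) \<le> norm (u k - z)" if z: "z \<in> cspan (B \<union> u ` (UNIV - {k}))" for k z
  proof -
    obtain n a m where n: "n \<in> cspan B" "\<And>i. i \<notin> UNIV - {k} \<Longrightarrow> a i = 0"
      "\<And>i. i \<ge> m \<Longrightarrow> a i = 0" "z = n + (\<Sum>i<m. a i *\<^sub>C u i)"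
      using cspan_finite_sum_representation[OF z] by blast
    define m' where "m' = max m (Suc k)"
    \<comment> \<open>Coefficient -1 at \<open>k\<close> turns \<open>- (u k - z)\<close> into a
      combination to which the coefficient bound applies.\<close>
    define a' where "a' = a(k := - 1)"
    have "(\<Sum>j<m'. a' j *\<^sub>C u j) =
        (\<Sum>j<m'. a j *\<^sub>C u j) + (\<Sum>j<m'. if j = k then - u j else 0)"
      unfolding sum.distrib[symmetric] a'_def
      by (intro sum.cong) (use n(2)[of k] in \<open>auto\<close>)
    also have "(\<Sum>j<m'. if j = k then - u j else 0) = - u k"
      by (simp add: m'_def less_max_iff_disj)
    also have "(\<Sum>j<m'. a j *\<^sub>C u j) = (\<Sum>j<m. a j *\<^sub>C u j)"
      using n(3) by (intro sum.mono_neutral_right) (auto simp: m'_def)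
    finally have "n + (\<Sum>j<m'. a' j *\<^sub>C u j) = - (u k - z)" using n(4) by simp
    moreover have "cmod (a' k) \<le> 2 * C k * norm (n + (\<Sum>j<m'. a' j *\<^sub>C u j))"
      by (rule triangular_coefficient_bound[where \<phi> = \<phi>]) (use q n(1) in \<open>auto simp: m'_def\<close>)
    ultimately have "1 \<le> 2 * C k * norm (u k - z)"
      by (simp add: a'_def norm_minus_commute)
    then show ?thesis using q(5)[of k] by (simp add: pos_divide_le_eq mult.commute)
  qed
  have "\<exists>f. bounded_clinear f \<and> (\<forall>z\<in>cspan (B \<union> u ` (UNIV - {k})). f z = 0) \<and> f (u k) = (1::complex)"
    for k
  proof -
    have "0 < 1 / (2 * C k)" using q(5)[of k] by simp
    then show ?thesis
      using hahn_banach_separation[OF complex_vector.subspace_span _ dist[where k = k]] by metis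
  qed
  then obtain \<psi> :: "nat \<Rightarrow> 'a \<Rightarrow> complex" where \<psi>: "\<And>k. bounded_clinear (\<psi> k)"
    "\<And>k z. z \<in> cspan (B \<union> u ` (UNIV - {k})) \<Longrightarrow> \<psi> k z = 0" "\<And>k. \<psi> k (u k) = 1"
    by metis
  show thesis
  proof
    show "\<psi> k (u j) = (if j = k then 1 else 0)" for j k
      using \<psi>(3)[of k] \<psi>(2)[OF complex_vector.span_base, of "u j" k] by auto
    show "\<psi> k z = 0" if "z \<in> cspan B" for k z
      using that complex_vector.span_mono[of B "B \<union> u ` (UNIV - {k})"] by (intro \<psi>(2)) auto
  qed (use q(1) \<psi>(1) in auto)
qed

text \<open>The even functionals witness infinite dimension; the odd ones vanish on the whole
  closure and witness infinite codimension. The set \<open>B\<close> leaves room for a subspace that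
  has to be included.\<close>

lemma biorthogonal_half_space:
  fixes u :: "nat \<Rightarrow> 'a::complex_normed_vector" and \<psi> :: "nat \<Rightarrow> 'a \<Rightarrow> complex"
  assumes lin: "\<And>k. bounded_clinear (\<psi> k)"
    and bi: "\<And>j k. \<psi> k (u j) = (if j = k then 1 else 0)"
    and B: "\<And>k z. z \<in> B \<Longrightarrow> \<psi> k z = 0"
  shows "half_space (closure (cspan (B \<union> range (\<lambda>k. u (2 * k)))))" (is "half_space ?Y")
  unfolding half_space_def
proof (intro conjI)
  show "closed_csubspace ?Y"
    by (simp add: closed_csubspace_def csubspace_closure complex_vector.subspace_span)
  have "range (\<lambda>k. u (2 * k)) \<subseteq> ?Y"
    using complex_vector.span_superset[of "B \<union> range (\<lambda>k. u (2 * k))"] closure_subset by blast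
  then show "\<not> finite_cdim ?Y"
    using biorthogonal_not_finite_cdim[of "\<lambda>k. \<psi> (2 * k)" "\<lambda>k. u (2 * k)"] lin bi by simp
  have "?Y \<subseteq> {y. \<psi> (2 * k + 1) y = 0}" for k
  proof (intro closure_minimal complex_vector.span_minimal csubspace_kernel closed_kernel lin)
    show "B \<union> range (\<lambda>j. u (2 * j)) \<subseteq> {y. \<psi> (2 * k + 1) y = 0}"
      using B bi by (auto; presburger)
  qed
  then show "\<not> finite_ccodim ?Y"
    using lin bi
    by (intro biorthogonal_not_finite_ccodim[of "\<lambda>k. \<psi> (2 * k + 1)" "\<lambda>k. u (2 * k + 1)"])
      (simp_all add: subset_iff)
qed

text \<open>Finitely many functionals always have a common zero of norm one in \<open>K\<close>, so
  biorthogonal vectors can be selected there. Applied to an infinite-dimensional eigenspace, this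
  yields an invariant half-space.\<close>

lemma half_space_in_infinite_dimension:
  fixes K :: "'a::complex_normed_vector set"
  assumes K: "closed_csubspace K" and inf: "\<not> finite_cdim K"
  obtains Y where "half_space Y" "Y \<subseteq> K"
proof -
  have Ks: "csubspace K" using K by (simp add: closed_csubspace_def)
  have sel: "\<exists>w\<in>K. norm w \<ge> 1 \<and> (\<forall>f\<in>\<Phi>. cmod (f w) < \<epsilon>)"
    if \<Phi>: "finite \<Phi>" "\<And>f. f \<in> \<Phi> \<Longrightarrow> bounded_clinear f" and \<epsilon>: "\<epsilon> > 0"
    for \<Phi> :: "('a \<Rightarrow> complex) set" and \<epsilon>
  proof -
    have "\<not> finite_cdim {y\<in>K. \<forall>f\<in>\<Phi>. f y = 0}"
      using finite_cdim_kernels[OF \<Phi> Ks] inf by blast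
    then have "{y\<in>K. \<forall>f\<in>\<Phi>. f y = 0} \<noteq> {0}" using finite_cdim_0 by metis
    moreover have "0 \<in> {y\<in>K. \<forall>f\<in>\<Phi>. f y = 0}"
      using complex_vector.subspace_0[OF Ks] \<Phi>(2) bounded_clinear_zero by blast
    ultimately obtain y where y: "y \<in> K" "\<And>f. f \<in> \<Phi> \<Longrightarrow> f y = 0" "y \<noteq> 0" by blast
    define w where "w = of_real (1 / norm y) *\<^sub>C y"
    have "w \<in> K" unfolding w_def by (intro complex_vector.subspace_scale Ks y)
    moreover have "norm w = 1" using y(3) by (simp add: w_def norm_scaleC norm_divide)
    moreover have "cmod (f w) < \<epsilon>" if "f \<in> \<Phi>" for f
      using y(2)[OF that] \<epsilon> by (simp add: w_def bounded_clinear_scale'[OF \<Phi>(2)[OF that]])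
    ultimately show ?thesis by (intro bexI[of _ w]) simp_all
  qed
  obtain u :: "nat \<Rightarrow> 'a" and \<psi> :: "nat \<Rightarrow> 'a \<Rightarrow> complex" where u: "\<And>k. u k \<in> K"
    "\<And>k. bounded_clinear (\<psi> k)" "\<And>j k. \<psi> k (u j) = (if j = k then 1 else 0)"
    by (rule biorthogonal_selection[OF finite.emptyI sel]) metis+
  have "half_space (closure (cspan ({} \<union> range (\<lambda>k. u (2 * k)))))"
    by (rule biorthogonal_half_space[OF u(2,3)]) auto
  moreover have "closure (cspan ({} \<union> range (\<lambda>k. u (2 * k)))) \<subseteq> K"
    using K u(1) by (intro closure_minimal complex_vector.span_minimal)
      (auto simp: closed_csubspace_def)
  ultimately show thesis using that by blast
qed

section \<open>Weak cluster points in reflexive spaces\<close>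

text \<open>Tychonoff's theorem for the evaluations at \<open>x n\<close>, as in the Banach-Alaoglu
  theorem, gives a cluster point in the bidual; reflexivity makes it a point of the space. Later
  steps ask for finitely many functionals at a time, so a cluster point does the work of a weakly
  convergent subsequence.\<close>

lemma weak_cluster_point:
  fixes x :: "nat \<Rightarrow> 'a::complex_normed_vector"
  assumes refl: "reflexive_space TYPE('a)" and x: "\<And>n. norm (x n) \<le> M"
  obtains z where "\<And>\<Phi> \<epsilon> n0. finite \<Phi> \<Longrightarrow> (\<And>f. f \<in> \<Phi> \<Longrightarrow> bounded_clinear (f :: 'a \<Rightarrow> complex)) \<Longrightarrow>
    \<epsilon> > 0 \<Longrightarrow> \<exists>n\<ge>n0. \<forall>f\<in>\<Phi>. cmod (f (x n) - f z) < \<epsilon>"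
proof -
  have M: "M \<ge> 0" using x[of 0] norm_ge_zero order_trans by blast
  define bc where "bc = {f :: 'a \<Rightarrow> complex. bounded_clinear f}"
  \<comment> \<open>Coordinates outside the dual are pinned to 0, so that the product can run over
    the whole function type.\<close>
  define r where "r f = (if f \<in> bc then M * onorm f else 0)" for f
  define K where "K = (\<Pi>\<^sub>E f\<in>(UNIV :: ('a \<Rightarrow> complex) set). cball (0::complex) (r f))"
  have "compact K"
    unfolding K_def compactin_euclidean_iff[symmetric] euclidean_product_topology[symmetric]
      compactin_PiE by simp
  \<comment> \<open>The linearity relations involve finitely many coordinates each, hence define a
    closed set, and the evaluations satisfy them exactly.\<close>
  define L where "L = (\<Inter>f\<in>bc. \<Inter>g\<in>bc. {\<phi>. \<phi> (\<lambda>x. f x + g x) = \<phi> f + \<phi> g}) \<inter>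
    (\<Inter>c. \<Inter>f\<in>bc. {\<phi>. \<phi> (\<lambda>x. c * f x) = c * \<phi> f})"
  have cont: "continuous_on UNIV (\<lambda>\<phi>. \<phi> f)" for f :: "'a \<Rightarrow> complex"
    by (simp add: continuous_on_product_coordinates)
  have "closed L"
    unfolding L_def
    by (intro closed_Int closed_INT ballI closed_Collect_eq continuous_intros cont)
  with \<open>compact K\<close> have "compact (K \<inter> L)" by (rule compact_Int_closed)
  define E where "E n f = (if f \<in> bc then f (x n) else 0)" for n f
  have EK: "E n \<in> K" for n
  proof -
    have "cmod (E n f) \<le> r f" for f
    proof (cases "f \<in> bc")
      case True
      then have bl: "bounded_linear f" by (simp add: bc_def bounded_clinear_bounded_linear)
      have "cmod (f (x n)) \<le> onorm f * norm (x n)" by (rule onorm[OF bl])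
      also have "\<dots> \<le> onorm f * M" by (intro mult_left_mono x onorm_pos_le bl)
      finally show ?thesis using True by (simp add: E_def r_def mult.commute)
    qed (simp add: E_def r_def)
    then show ?thesis by (simp add: K_def PiE_iff)
  qed
  have EL: "E n \<in> L" for n
    by (auto simp: L_def E_def bc_def bounded_clinear_plus bounded_clinear_cmult')
  have "filtermap E sequentially \<noteq> bot" "eventually (\<lambda>\<phi>. \<phi> \<in> K \<inter> L) (filtermap E sequentially)"
    using EK EL by (auto simp: filtermap_bot_iff eventually_filtermap)
  then obtain \<phi> where \<phi>: "\<phi> \<in> K \<inter> L" "inf (nhds \<phi>) (filtermap E sequentially) \<noteq> bot"
    using \<open>compact (K \<inter> L)\<close> unfolding compact_filter by blast
  have "\<phi> \<in> cbidual"
    unfolding cbidual_def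
  proof (intro CollectI conjI)
    show "\<exists>C. \<forall>f. bounded_clinear f \<longrightarrow> cmod (\<phi> f) \<le> C * onorm f"
    proof (intro exI[of _ M] allI impI)
      fix f :: "'a \<Rightarrow> complex" assume "bounded_clinear f"
      moreover have "cmod (\<phi> f) \<le> r f" using \<phi>(1) by (auto simp: K_def PiE_iff)
      ultimately show "cmod (\<phi> f) \<le> M * onorm f" by (simp add: r_def bc_def)
    qed
  qed (use \<phi>(1) in \<open>auto simp: L_def bc_def\<close>)
  then obtain z where z: "\<And>f. bounded_clinear f \<Longrightarrow> \<phi> f = f z"
    using refl unfolding reflexive_space_def by blast
  show thesis
  proof
    fix \<Phi> :: "('a \<Rightarrow> complex) set" and \<epsilon> :: real and n0
    assume \<Phi>: "finite \<Phi>" "\<And>f. f \<in> \<Phi> \<Longrightarrow> bounded_clinear f" and \<epsilon>: "\<epsilon> > 0"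
    define U where "U = (\<Inter>f\<in>\<Phi>. {\<psi>. cmod (\<psi> f - \<phi> f) < \<epsilon>})"
    have "open U"
      unfolding U_def
      by (intro open_INT \<Phi>(1) ballI open_Collect_less continuous_intros cont)
    moreover have "\<phi> \<in> U" using \<epsilon> by (simp add: U_def)
    ultimately have nh: "eventually (\<lambda>\<psi>. \<psi> \<in> U) (nhds \<phi>)" by (rule eventually_nhds_in_open)
    have "\<exists>n\<ge>n0. E n \<in> U"
    proof (rule ccontr)
      assume "\<not> (\<exists>n\<ge>n0. E n \<in> U)"
      then have "eventually (\<lambda>\<psi>. \<psi> \<notin> U) (filtermap E sequentially)"
        unfolding eventually_filtermap eventually_sequentially by blast
      with nh have "eventually (\<lambda>\<psi>. False) (inf (nhds \<phi>) (filtermap E sequentially))"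
        unfolding eventually_inf by blast
      then show False using \<phi>(2) by (simp add: trivial_limit_def)
    qed
    then show "\<exists>n\<ge>n0. \<forall>f\<in>\<Phi>. cmod (f (x n) - f z) < \<epsilon>"
      using \<Phi>(2) z by (auto simp: U_def E_def bc_def)
  qed
qed

section \<open>Half-spaces from a resolvent that blows up\<close>

text \<open>The vectors \<open>h\<close> are normalized by their distance to \<open>N\<close>.
  Subtracting a weak cluster point then gives vectors bounded away from zero on which any finitely
  many functionals can be made small, as the biorthogonal selection requires.\<close>

theorem half_space_of_blow_up:
  fixes T :: "'a::complex_normed_vector \<Rightarrow> 'a"
  assumes refl: "reflexive_space TYPE('a)" and T: "bounded_clinear T"
    and Nfin: "finite_cdim N" and inv: "\<And>z. z \<in> N \<Longrightarrow> T z \<in> N"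
    and inj: "\<And>x. T x - lam *\<^sub>C x \<in> N \<Longrightarrow> x \<in> N"
    and blow: "\<And>K \<delta>. \<delta> > 0 \<Longrightarrow> \<exists>\<mu> h. cmod (\<mu> - lam) < \<delta> \<and> T h - \<mu> *\<^sub>C h = e \<and>
      (\<forall>z\<in>N. norm (h - z) \<ge> K)"
  obtains Y where "half_space Y" "T ` Y \<subseteq> adjoin Y e"
proof -
  have N: "closed_csubspace N" "csubspace N"
    using closed_csubspace_finite_cdim[OF Nfin] by (auto simp: closed_csubspace_def)
  note Nsub = complex_vector.subspace_0[OF N(2)] complex_vector.subspace_add[OF N(2)]
    complex_vector.subspace_diff[OF N(2)] complex_vector.subspace_scale[OF N(2)]
  have "\<exists>\<mu> x a. cmod (\<mu> - lam) < 1 / real (Suc n) \<and> norm x \<le> 2 \<and> (\<forall>z\<in>N. norm (x - z) \<ge> 1) \<and>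
      T x - \<mu> *\<^sub>C x - of_real a *\<^sub>C e \<in> N \<and> 0 < a \<and> a \<le> 1 / real (Suc n)" for n
  proof -
    obtain \<mu> h where h: "cmod (\<mu> - lam) < 1 / real (Suc n)" "T h - \<mu> *\<^sub>C h = e"
      "\<And>z. z \<in> N \<Longrightarrow> norm (h - z) \<ge> real (Suc n)"
      using blow[of "1 / real (Suc n)" "real (Suc n)"] by auto
    \<comment> \<open>Division by the distance to \<open>N\<close> keeps \<open>x\<close> at
      distance at least 1 from \<open>N\<close>; a point of \<open>N\<close> that is optimal up to
      the factor 2 bounds its norm by 2.\<close>
    define d where "d = (INF z\<in>N. norm (h - z))"
    have dle: "d \<le> norm (h - z)" if "z \<in> N" for z
      unfolding d_def by (intro cINF_lower that bdd_belowI2[of _ 0]) simp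
    have dge: "d \<ge> real (Suc n)"
      unfolding d_def using h(3) Nsub(1) by (intro cINF_greatest) auto
    then have dpos: "d > 0" by linarith
    have "\<exists>y\<in>(\<lambda>z. norm (h - z)) ` N. y < 2 * d"
      using dpos Nsub(1) unfolding d_def
      by (intro cInf_lessD) auto
    then obtain z where z: "z \<in> N" "norm (h - z) < 2 * d" by blast
    define x where "x = of_real (1 / d) *\<^sub>C (h - z)"
    have "norm x = norm (h - z) / d"
      using dpos unfolding x_def norm_scaleC by (simp add: norm_divide)
    then have "norm x \<le> 2" using z(2) dpos by (simp add: divide_le_eq)
    moreover have "norm (x - z') \<ge> 1" if "z' \<in> N" for z'
    proof -
      have "x - z' = of_real (1 / d) *\<^sub>C (h - (z + of_real d *\<^sub>C z'))"
        using dpos by (simp add: x_def complex_vector.scale_right_diff_distrib scaleC_add_right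
            scaleC_scaleC scaleC_one)
      then have "norm (x - z') = norm (h - (z + of_real d *\<^sub>C z')) / d"
        using dpos by (simp only: norm_scaleC) (simp add: norm_divide)
      also have "\<dots> \<ge> 1"
        using dle[of "z + of_real d *\<^sub>C z'"] z(1) that Nsub dpos by simp
      finally show ?thesis .
    qed
    moreover have "T x - \<mu> *\<^sub>C x - of_real (1 / d) *\<^sub>C e = - (of_real (1 / d) *\<^sub>C (T z - \<mu> *\<^sub>C z))"
      unfolding x_def h(2)[symmetric]
      by (simp add: bounded_clinear_scale[OF T] bounded_clinear_diff[OF T] scaleC_scaleC
          complex_vector.scale_right_diff_distrib mult.commute)
    then have "T x - \<mu> *\<^sub>C x - of_real (1 / d) *\<^sub>C e \<in> N"
      using z(1) by (simp only:) (intro complex_vector.subspace_neg[OF N(2)] Nsub inv)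
    moreover have "1 / d \<le> 1 / real (Suc n)" using dge by (intro divide_left_mono) auto
    ultimately show ?thesis using h(1) dpos
      by (intro exI[of _ \<mu>] exI[of _ x] exI[of _ "1/d"]) auto
  qed
  then obtain \<mu> x a where \<mu>: "\<And>n. cmod (\<mu> n - lam) < 1 / real (Suc n)"
    and x: "\<And>n. norm (x n) \<le> 2" "\<And>n z. z \<in> N \<Longrightarrow> norm (x n - z) \<ge> 1"
    and Tx: "\<And>n. T (x n) - \<mu> n *\<^sub>C x n - of_real (a n) *\<^sub>C e \<in> N"
    and a: "\<And>n. 0 < a n" "\<And>n. a n \<le> 1 / real (Suc n)" by metis
  obtain z where z: "\<And>\<Phi> \<epsilon> n0. finite \<Phi> \<Longrightarrow> (\<And>f. f \<in> \<Phi> \<Longrightarrow> bounded_clinear (f :: 'a \<Rightarrow> complex)) \<Longrightarrow>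
    \<epsilon> > 0 \<Longrightarrow> \<exists>n\<ge>n0. \<forall>f\<in>\<Phi>. cmod (f (x n) - f z) < \<epsilon>"
    by (rule weak_cluster_point[of x 2, OF refl x(1)]) (erule that)
  \<comment> \<open>A functional \<open>f\<close> vanishing on \<open>N\<close> is small at
    \<open>(T - lam) (x n)\<close>, because \<open>a n\<close> tends to 0 and \<open>\<mu> n\<close>
    to \<open>lam\<close>; these values cluster at \<open>f (T z - lam *\<^sub>C z)\<close>.\<close>
  have "T z - lam *\<^sub>C z \<in> N"
  proof (rule ccontr)
    assume "T z - lam *\<^sub>C z \<notin> N"
    then obtain f :: "'a \<Rightarrow> complex" where f: "bounded_clinear f" "\<And>y. y \<in> N \<Longrightarrow> f y = 0"
      "f (T z - lam *\<^sub>C z) = 1"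
      using closed_csubspace_separation[OF N(1)] by metis
    obtain K where K: "K > 0" "\<And>y. cmod (f y) \<le> K * norm y"
      using bounded_clinear_pos[OF f(1)] by blast
    define g where "g y = f (T y - lam *\<^sub>C y)" for y
    have g: "bounded_clinear g"
      unfolding g_def by (intro bounded_clinear_compose[OF f(1)] bounded_clinear_shift T)
    define b where "b = cmod (f e) + K * 2"
    have gx: "cmod (g (x n)) \<le> b / real (Suc n)" for n
    proof -
      have "g (x n) = f (T (x n) - \<mu> n *\<^sub>C x n - of_real (a n) *\<^sub>C e) + of_real (a n) * f e
          + (\<mu> n - lam) * f (x n)"
        by (simp add: g_def bounded_clinear_diff[OF f(1)] bounded_clinear_scale'[OF f(1)]
            bounded_clinear_add[OF f(1)]
            algebra_simps)
      then have "g (x n) = of_real (a n) * f e + (\<mu> n - lam) * f (x n)"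
        using f(2)[OF Tx] by simp
      then have "cmod (g (x n)) \<le> a n * cmod (f e) + cmod (\<mu> n - lam) * cmod (f (x n))"
        using norm_triangle_ineq[of "of_real (a n) * f e" "(\<mu> n - lam) * f (x n)"] a(1)[of n]
        by (simp add: norm_mult)
      also have "cmod (f (x n)) \<le> K * 2"
        using K(2)[of "x n"] mult_left_mono[OF x(1)[of n], of K] K(1) by linarith
      then have "a n * cmod (f e) + cmod (\<mu> n - lam) * cmod (f (x n)) \<le>
          1 / real (Suc n) * cmod (f e) + 1 / real (Suc n) * (K * 2)"
        using \<mu>[of n] a(2)[of n] by (intro add_mono mult_mono) auto
      finally show ?thesis by (simp add: b_def add_divide_distrib)
    qed
    obtain n0 where n0: "2 * b < real n0" using reals_Archimedean2 by blast
    obtain n where n: "n \<ge> n0" "cmod (g (x n) - g z) < 1/2"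
      using z[of "{g}" "1/2" n0] g by auto
    have "b / real (Suc n) < 1/2" using n0 n(1) by (simp add: field_simps)
    moreover have "cmod (g z) \<le> cmod (g (x n)) + cmod (g (x n) - g z)"
      by (metis norm_minus_commute norm_triangle_sub)
    moreover have "cmod (g z) = 1" using f(3) by (simp add: g_def)
    ultimately show False using gx[of n] n(2) by linarith
  qed
  then have zN: "z \<in> N" by (rule inj)
  \<comment> \<open>As \<open>z\<close> lies in \<open>N\<close>, the norms remain at least 1, while
    0 becomes a weak cluster point.\<close>
  define w where "w n = x n - z" for n
  obtain B where B: "finite B" "cspan B = N" using Nfin by (auto simp: finite_cdim_def)
  have sel: "\<exists>v\<in>range w. norm v \<ge> 1 \<and> (\<forall>f\<in>\<Phi>. cmod (f v) < \<epsilon>)"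
    if \<Phi>: "finite \<Phi>" "\<And>f. f \<in> \<Phi> \<Longrightarrow> bounded_clinear f" and \<epsilon>: "\<epsilon> > 0"
    for \<Phi> :: "('a \<Rightarrow> complex) set" and \<epsilon>
  proof -
    obtain n where "\<forall>f\<in>\<Phi>. cmod (f (x n) - f z) < \<epsilon>" using z[OF \<Phi> \<epsilon>] by blast
    then have "\<forall>f\<in>\<Phi>. cmod (f (w n)) < \<epsilon>"
      using \<Phi>(2) by (simp add: w_def bounded_clinear_diff)
    then show ?thesis using x(2)[OF zN, of n] by (auto simp: w_def)
  qed
  obtain u :: "nat \<Rightarrow> 'a" and \<psi> :: "nat \<Rightarrow> 'a \<Rightarrow> complex" where u: "\<And>k. u k \<in> range w"
    "\<And>k. bounded_clinear (\<psi> k)" "\<And>j k. \<psi> k (u j) = (if j = k then 1 else 0)"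
    "\<And>k z. z \<in> cspan B \<Longrightarrow> \<psi> k z = 0"
    by (rule biorthogonal_selection[OF B(1) sel]) metis+
  define S where "S = cspan (B \<union> range (\<lambda>k. u (2 * k)))"
  have hs: "half_space (closure S)"
    unfolding S_def
    by (rule biorthogonal_half_space[OF u(2,3)]) (auto intro: u(4) complex_vector.span_base)
  have Ss: "csubspace S" by (simp add: S_def complex_vector.subspace_span)
  have NS: "N \<subseteq> S" unfolding S_def B(2)[symmetric] by (rule complex_vector.span_mono) auto
  have uS: "u (2 * k) \<in> S" for k unfolding S_def by (rule complex_vector.span_base) auto
  have SS: "adjoin S e \<subseteq> adjoin (closure S) e"
    using closure_subset by (fastforce simp: adjoin_def)
  have cl: "closed_csubspace (adjoin (closure S) e)"
    using hs by (intro closed_csubspace_adjoin) (simp add: half_space_def)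
  have Tu: "T (u (2 * k)) \<in> adjoin S e" for k
  proof -
    obtain n where n: "u (2 * k) = w n" using u(1) by blast
    \<comment> \<open>Besides a multiple of \<open>e\<close> and of \<open>w n\<close> itself, only
      elements of \<open>N\<close> occur, since both \<open>z\<close> and \<open>T z\<close> lie in
      \<open>N\<close>.\<close>
    have "T (w n) - of_real (a n) *\<^sub>C e = \<mu> n *\<^sub>C w n +
        ((T (x n) - \<mu> n *\<^sub>C x n - of_real (a n) *\<^sub>C e) - (T z - \<mu> n *\<^sub>C z))"
      by (simp add: w_def bounded_clinear_diff[OF T] complex_vector.scale_right_diff_distrib)
    also have "\<dots> \<in> S"
    proof (rule complex_vector.subspace_add[OF Ss complex_vector.subspace_scale[OF Ss]])
      show "w n \<in> S" using uS[of k] n by simp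
      show "(T (x n) - \<mu> n *\<^sub>C x n - of_real (a n) *\<^sub>C e) - (T z - \<mu> n *\<^sub>C z) \<in> S"
        using complex_vector.subspace_diff[OF N(2) Tx complex_vector.subspace_diff[OF N(2)
            inv[OF zN] complex_vector.subspace_scale[OF N(2) zN]]] NS by (rule subsetD[rotated])
    qed
    finally show ?thesis unfolding adjoin_def n by blast
  qed
  have "S \<subseteq> {y. T y \<in> adjoin (closure S) e}"
    unfolding S_def
  proof (rule complex_vector.span_minimal)
    show "csubspace {y. T y \<in> adjoin (closure (cspan (B \<union> range (\<lambda>k. u (2 * k))))) e}"
      using csubspace_vimage[OF T] cl by (simp add: closed_csubspace_def S_def)
    have "b \<in> N" if "b \<in> B" for b using that B(2) complex_vector.span_base by blast
    then have "T b \<in> adjoin S e" if "b \<in> B" for b using that inv NS subset_adjoin by blast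
    then show "B \<union> range (\<lambda>k. u (2 * k)) \<subseteq>
        {y. T y \<in> adjoin (closure (cspan (B \<union> range (\<lambda>k. u (2 * k))))) e}"
      using Tu SS unfolding S_def by blast
  qed
  then have "T ` closure S \<subseteq> adjoin (closure S) e"
    using cl by (intro image_closure_subset_closed T) (auto simp: closed_csubspace_def)
  then show thesis using that hs by blast
qed

section \<open>The dual space\<close>

text \<open>As a type of its own, the dual can be the underlying space of the blow-up theorem. Its
  norm comes from the bounded real-linear maps, among which the complex-linear ones are singled
  out.\<close>

typedef (overloaded) 'a cdual =
  "{f :: 'a::complex_normed_vector \<Rightarrow>\<^sub>L complex. \<forall>c x. blinfun_apply f (c *\<^sub>C x) = c * blinfun_apply f x}"
  by (rule exI[of _ 0]) simp

setup_lifting type_definition_cdual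

lift_definition cdual_apply :: "'a::complex_normed_vector cdual \<Rightarrow> 'a \<Rightarrow> complex"
  is blinfun_apply .

instantiation cdual :: (complex_normed_vector) real_normed_vector
begin

lift_definition zero_cdual :: "'a cdual" is 0 by simp
lift_definition plus_cdual :: "'a cdual \<Rightarrow> 'a cdual \<Rightarrow> 'a cdual" is "(+)"
  by (simp add: blinfun.add_left distrib_left)
lift_definition minus_cdual :: "'a cdual \<Rightarrow> 'a cdual \<Rightarrow> 'a cdual" is "(-)"
  by (simp add: blinfun.diff_left right_diff_distrib)
lift_definition uminus_cdual :: "'a cdual \<Rightarrow> 'a cdual" is uminus
  by (simp add: blinfun.minus_left)
lift_definition scaleR_cdual :: "real \<Rightarrow> 'a cdual \<Rightarrow> 'a cdual" is scaleR
  by (simp add: blinfun.scaleR_left)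
lift_definition norm_cdual :: "'a cdual \<Rightarrow> real" is norm .

definition dist_cdual :: "'a cdual \<Rightarrow> 'a cdual \<Rightarrow> real"
  where "dist_cdual f g = norm (f - g)"

definition sgn_cdual :: "'a cdual \<Rightarrow> 'a cdual"
  where "sgn_cdual f = scaleR (inverse (norm f)) f"

definition uniformity_cdual :: "('a cdual \<times> 'a cdual) filter"
  where "uniformity_cdual = (INF e\<in>{0 <..}. principal {(f, g). dist f g < e})"

definition open_cdual :: "'a cdual set \<Rightarrow> bool"
  where "open_cdual U \<longleftrightarrow> (\<forall>f\<in>U. eventually (\<lambda>(f', g). f' = f \<longrightarrow> g \<in> U) uniformity)"

instance
proof
  fix f g h :: "'a cdual" and a b :: real
  show "f + g + h = f + (g + h)" by transfer simp
  show "f + g = g + f" by transfer simp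
  show "0 + f = f" by transfer simp
  show "- f + f = 0" by transfer simp
  show "f - g = f + - g" by transfer simp
  show "a *\<^sub>R (f + g) = a *\<^sub>R f + a *\<^sub>R g" by transfer (rule scaleR_add_right)
  show "(a + b) *\<^sub>R f = a *\<^sub>R f + b *\<^sub>R f" by transfer (rule scaleR_add_left)
  show "a *\<^sub>R b *\<^sub>R f = (a * b) *\<^sub>R f" by transfer simp
  show "1 *\<^sub>R f = f" by transfer simp
  show "norm f = 0 \<longleftrightarrow> f = 0" by transfer simp
  show "norm (f + g) \<le> norm f + norm g" by transfer (rule norm_triangle_ineq)
  show "norm (a *\<^sub>R f) = \<bar>a\<bar> * norm f" by transfer simp
qed (rule dist_cdual_def sgn_cdual_def uniformity_cdual_def open_cdual_def)+

end

section \<open>The duality pairing and its complex scalars\<close>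

lemma cdual_eqI: "(\<And>x. cdual_apply f x = cdual_apply g x) \<Longrightarrow> f = g"
  by transfer (rule blinfun_eqI)

lemma cdual_apply_add: "cdual_apply (f + g) x = cdual_apply f x + cdual_apply g x"
  by transfer (rule blinfun.add_left)

lemma cdual_apply_zero: "cdual_apply 0 x = 0"
  by transfer simp

lemma cmod_cdual_apply: "cmod (cdual_apply f x) \<le> norm f * norm x"
  by transfer (rule norm_blinfun)

lemma norm_cdual_leI:
  "0 \<le> K \<Longrightarrow> (\<And>x. cmod (cdual_apply f x) \<le> K * norm x) \<Longrightarrow> norm f \<le> K"
  by transfer (rule norm_blinfun_bound)

lemma norm_cdual_eq: "norm f = onorm (cdual_apply f)"
  by transfer (rule norm_blinfun.rep_eq)

instantiation cdual :: (complex_normed_vector) complex_normed_vector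
begin

lift_definition scaleC_cdual :: "complex \<Rightarrow> 'a cdual \<Rightarrow> 'a cdual"
  is "\<lambda>c f. blinfun_mult_right c o\<^sub>L f"
  by (simp add: blinfun_mult_right.rep_eq)

lemma cdual_apply_scaleC: "cdual_apply (c *\<^sub>C f) x = c * cdual_apply f x"
  by transfer (simp add: blinfun_mult_right.rep_eq)

instance
proof
  fix f g :: "'a cdual" and c d :: complex and r :: real
  show "c *\<^sub>C (f + g) = c *\<^sub>C f + c *\<^sub>C g"
    by (rule cdual_eqI) (simp add: cdual_apply_scaleC cdual_apply_add distrib_left)
  show "(c + d) *\<^sub>C f = c *\<^sub>C f + d *\<^sub>C f"
    by (rule cdual_eqI) (simp add: cdual_apply_scaleC cdual_apply_add distrib_right)
  show "c *\<^sub>C d *\<^sub>C f = (c * d) *\<^sub>C f"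
    by (rule cdual_eqI) (simp add: cdual_apply_scaleC)
  show "1 *\<^sub>C f = f"
    by (rule cdual_eqI) (simp add: cdual_apply_scaleC)
  have "cdual_apply (r *\<^sub>R f) x = r * cdual_apply f x" for x
    by transfer (simp add: blinfun.scaleR_left scaleR_conv_of_real)
  then show "complex_of_real r *\<^sub>C f = r *\<^sub>R f"
    by (intro cdual_eqI) (simp add: cdual_apply_scaleC)
  have le: "norm (c *\<^sub>C f) \<le> cmod c * norm f" for c and f :: "'a cdual"
    by (rule norm_cdual_leI)
      (simp_all add: cdual_apply_scaleC norm_mult mult.assoc mult_left_mono cmod_cdual_apply)
  show "norm (c *\<^sub>C f) = cmod c * norm f"
  proof (cases "c = 0")
    case True
    then show ?thesis using le[of c f] by simp
  next
    case False
    then have "f = (1 / c) *\<^sub>C c *\<^sub>C f"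
      by (intro cdual_eqI) (simp add: cdual_apply_scaleC)
    then have "norm f \<le> cmod (1 / c) * norm (c *\<^sub>C f)" using le by metis
    then show ?thesis using le[of c f] False by (simp add: norm_divide field_simps)
  qed
qed

end

text \<open>Meaningful on \<open>bounded_clinear\<close> functions only, where it inverts
  \<open>cdual_apply\<close>.\<close>

definition cdual_of :: "('a::complex_normed_vector \<Rightarrow> complex) \<Rightarrow> 'a cdual"
  where "cdual_of f = Abs_cdual (Blinfun f)"

lemma cdual_apply_cdual_of: "bounded_clinear f \<Longrightarrow> cdual_apply (cdual_of f) = f"
  unfolding cdual_of_def cdual_apply.rep_eq
  by (subst Abs_cdual_inverse)
    (auto simp: bounded_linear_Blinfun_apply bounded_clinear_bounded_linear bounded_clinear_scale')

lemma bounded_clinear_cdual_apply: "bounded_clinear (cdual_apply f)"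
proof (rule bounded_clinearI)
  show "cdual_apply f (x + y) = cdual_apply f x + cdual_apply f y" for x y
    by transfer (rule blinfun.add_right)
  show "cdual_apply f (c *\<^sub>C x) = c *\<^sub>C cdual_apply f x" for c x
    unfolding scaleC_complex_def by transfer simp
qed (rule cmod_cdual_apply)

lemma cdual_of_cdual_apply: "cdual_of (cdual_apply f) = f"
  by (rule cdual_eqI) (simp add: cdual_apply_cdual_of bounded_clinear_cdual_apply)

lemma cdual_apply_diff: "cdual_apply (f - g) x = cdual_apply f x - cdual_apply g x"
  by transfer (rule blinfun.diff_left)

lemma bounded_clinear_evaluation: "bounded_clinear (\<lambda>f. cdual_apply f x)"
  by (rule bounded_clinearI[where K = "norm x"])
    (use cmod_cdual_apply in \<open>simp_all add: cdual_apply_add cdual_apply_scaleC scaleC_complex_def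
      mult.commute\<close>)

text \<open>Bridges two encodings: reflexivity speaks of functionals as plain functions,
  \<open>F\<close> acts on the type of dual elements. Composition with \<open>cdual_of\<close>
  translates.\<close>

lemma reflexive_functional_is_evaluation:
  fixes F :: "'a::complex_normed_vector cdual \<Rightarrow> complex"
  assumes refl: "reflexive_space TYPE('a)" and F: "bounded_clinear F"
  obtains x where "\<And>h. F h = cdual_apply h x"
proof -
  obtain K where K: "\<And>h. cmod (F h) \<le> K * norm h" using bounded_clinear_pos[OF F] by blast
  define \<phi> where "\<phi> f = F (cdual_of f)" for f
  have "\<phi> \<in> cbidual"
    unfolding cbidual_def
  proof (intro CollectI conjI allI impI)
    fix f g :: "'a \<Rightarrow> complex" assume fg: "bounded_clinear f" "bounded_clinear g"
    have "cdual_of (\<lambda>x. f x + g x) = cdual_of f + cdual_of g"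
      by (rule cdual_eqI)
        (simp add: cdual_apply_cdual_of cdual_apply_add bounded_clinear_plus fg)
    then show "\<phi> (\<lambda>x. f x + g x) = \<phi> f + \<phi> g"
      by (simp add: \<phi>_def bounded_clinear_add[OF F])
  next
    fix c and f :: "'a \<Rightarrow> complex" assume f: "bounded_clinear f"
    have "cdual_of (\<lambda>x. c * f x) = c *\<^sub>C cdual_of f"
      by (rule cdual_eqI)
        (simp add: cdual_apply_cdual_of cdual_apply_scaleC bounded_clinear_cmult' f)
    then show "\<phi> (\<lambda>x. c * f x) = c * \<phi> f"
      by (simp add: \<phi>_def bounded_clinear_scale'[OF F])
  next
    show "\<exists>K. \<forall>f. bounded_clinear f \<longrightarrow> cmod (\<phi> f) \<le> K * onorm f"
    proof (intro exI allI impI)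
      fix f :: "'a \<Rightarrow> complex" assume "bounded_clinear f"
      then show "cmod (\<phi> f) \<le> K * onorm f"
        using K[of "cdual_of f"] by (simp add: \<phi>_def norm_cdual_eq cdual_apply_cdual_of)
    qed
  qed
  then obtain x where x: "\<And>f. bounded_clinear f \<Longrightarrow> \<phi> f = f x"
    using refl unfolding reflexive_space_def by blast
  have "F h = cdual_apply h x" for h
    using x[OF bounded_clinear_cdual_apply[of h]] by (simp add: \<phi>_def cdual_of_cdual_apply)
  then show thesis using that by blast
qed

text \<open>Restricting \<open>\<phi>\<close> to the evaluations at points of the space defines a
  dual element. As every functional on the dual is such an evaluation, this element represents
  \<open>\<phi>\<close>.\<close>

lemma reflexive_cdual:
  assumes refl: "reflexive_space TYPE('a::complex_normed_vector)"
  shows "reflexive_space TYPE('a cdual)"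
  unfolding reflexive_space_def
proof
  fix \<phi> :: "('a cdual \<Rightarrow> complex) \<Rightarrow> complex" assume "\<phi> \<in> cbidual"
  then have add: "\<And>f g. bounded_clinear f \<Longrightarrow> bounded_clinear g \<Longrightarrow> \<phi> (\<lambda>x. f x + g x) = \<phi> f + \<phi> g"
    and scale: "\<And>c f. bounded_clinear f \<Longrightarrow> \<phi> (\<lambda>x. c * f x) = c * \<phi> f"
    and "\<exists>K. \<forall>f. bounded_clinear f \<longrightarrow> cmod (\<phi> f) \<le> K * onorm f"
    by (simp_all add: cbidual_def)
  then obtain K where K: "\<And>f. bounded_clinear f \<Longrightarrow> cmod (\<phi> f) \<le> K * onorm f" by blast
  define ev :: "'a \<Rightarrow> 'a cdual \<Rightarrow> complex" where "ev x = (\<lambda>f. cdual_apply f x)" for x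
  have ev: "bounded_clinear (ev x)" for x
    unfolding ev_def by (rule bounded_clinear_evaluation)
  have "bounded_clinear (\<lambda>x. \<phi> (ev x))"
  proof (rule bounded_clinearI)
    fix x y :: 'a and c
    have "ev (x + y) = (\<lambda>f. ev x f + ev y f)"
      by (simp add: ev_def bounded_clinear_add[OF bounded_clinear_cdual_apply])
    then show "\<phi> (ev (x + y)) = \<phi> (ev x) + \<phi> (ev y)" by (simp add: add ev)
    have "ev (c *\<^sub>C x) = (\<lambda>f. c * ev x f)"
      by (simp add: ev_def bounded_clinear_scale'[OF bounded_clinear_cdual_apply])
    then show "\<phi> (ev (c *\<^sub>C x)) = c *\<^sub>C \<phi> (ev x)" by (simp add: scale ev scaleC_complex_def)
    have le: "onorm (ev x) \<le> norm x"
      by (rule onorm_bound) (use cmod_cdual_apply in \<open>simp_all add: ev_def mult.commute\<close>)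
    have "cmod (\<phi> (ev x)) \<le> \<bar>K\<bar> * onorm (ev x)"
      using K[OF ev, of x] mult_right_mono[OF abs_ge_self, of "onorm (ev x)" K]
        onorm_pos_le[OF bounded_clinear_bounded_linear[OF ev]] by (meson order_trans)
    also have "\<dots> \<le> \<bar>K\<bar> * norm x" using le by (intro mult_left_mono) auto
    finally show "cmod (\<phi> (ev x)) \<le> \<bar>K\<bar> * norm x" .
  qed
  then have g: "cdual_apply (cdual_of (\<lambda>x. \<phi> (ev x))) x = \<phi> (ev x)" for x
    by (simp add: cdual_apply_cdual_of)
  have "\<phi> F = F (cdual_of (\<lambda>x. \<phi> (ev x)))" if F: "bounded_clinear F" for F
  proof -
    obtain x where x: "\<And>h. F h = cdual_apply h x"
      using reflexive_functional_is_evaluation[OF refl F] by blast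
    then have "F = ev x" by (auto simp: ev_def)
    then show ?thesis using x g by simp
  qed
  then show "\<exists>g. \<forall>F. bounded_clinear F \<longrightarrow> \<phi> F = F g" by blast
qed

text \<open>The Banach space adjoint. It is complex-linear in the functional, so spectral parameters
  are not conjugated.\<close>

definition cdual_map :: "('a::complex_normed_vector \<Rightarrow> 'a) \<Rightarrow> 'a cdual \<Rightarrow> 'a cdual"
  where "cdual_map T f = cdual_of (\<lambda>x. cdual_apply f (T x))"

lemma cdual_apply_cdual_map:
  "bounded_clinear T \<Longrightarrow> cdual_apply (cdual_map T f) x = cdual_apply f (T x)"
  by (simp add: cdual_map_def cdual_apply_cdual_of
      bounded_clinear_compose[OF bounded_clinear_cdual_apply])

lemma bounded_clinear_cdual_map:
  assumes T: "bounded_clinear T"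
  shows "bounded_clinear (cdual_map T)"
proof -
  obtain K where K: "K > 0" "\<And>x. norm (T x) \<le> K * norm x" using bounded_clinear_pos[OF T] by blast
  show ?thesis
  proof (rule bounded_clinearI)
    fix f g :: "'a cdual" and c
    show "cdual_map T (f + g) = cdual_map T f + cdual_map T g"
      by (rule cdual_eqI) (simp add: cdual_apply_cdual_map[OF T] cdual_apply_add)
    show "cdual_map T (c *\<^sub>C f) = c *\<^sub>C cdual_map T f"
      by (rule cdual_eqI) (simp add: cdual_apply_cdual_map[OF T] cdual_apply_scaleC)
    show "norm (cdual_map T f) \<le> K * norm f"
    proof (rule norm_cdual_leI)
      fix x
      have "cmod (cdual_apply f (T x)) \<le> norm f * (K * norm x)"
        using cmod_cdual_apply[of f "T x"] mult_left_mono[OF K(2)[of x], of "norm f"] by simp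
      then show "cmod (cdual_apply (cdual_map T f) x) \<le> K * norm f * norm x"
        by (simp add: cdual_apply_cdual_map[OF T] mult_ac)
    qed (use K(1) in simp)
  qed
qed

text \<open>By reflexivity, functionals that separate from \<open>Z\<close> are points, so
  \<open>Z\<close> consists of all functionals vanishing on its preannihilator. Hence finite
  dimension and finite codimension are exchanged between the two.\<close>

theorem half_space_preannihilator:
  fixes T :: "'a::complex_normed_vector \<Rightarrow> 'a"
  assumes refl: "reflexive_space TYPE('a)" and T: "bounded_clinear T"
    and Z: "half_space Z" "cdual_map T ` Z \<subseteq> adjoin Z g"
  obtains Y w where "half_space Y" "T ` Y \<subseteq> adjoin Y w"
proof -
  define Y where "Y = {x. \<forall>f\<in>Z. cdual_apply f x = 0}"
  have Zs: "closed_csubspace Z" "csubspace Z" and Zinf: "\<not> finite_cdim Z" "\<not> finite_ccodim Z"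
    using Z(1) by (auto simp: half_space_def closed_csubspace_def)
  note lin = bounded_clinear_add[OF bounded_clinear_cdual_apply]
    bounded_clinear_diff[OF bounded_clinear_cdual_apply]
    bounded_clinear_scale'[OF bounded_clinear_cdual_apply]
    bounded_clinear_zero[OF bounded_clinear_cdual_apply]
  have Ys: "csubspace Y"
    by (rule complex_vector.subspaceI) (auto simp: Y_def lin)
  have "Y = (\<Inter>f\<in>Z. {x. cdual_apply f x = 0})" by (auto simp: Y_def)
  also have "closed \<dots>"
    by (intro closed_INT ballI closed_kernel bounded_clinear_cdual_apply)
  finally have "closed Y" .
  then have Yc: "closed_csubspace Y" using Ys by (simp add: closed_csubspace_def)
  have sep: "\<exists>x\<in>Y. cdual_apply f x = 1" if f: "f \<notin> Z" for f
  proof -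
    obtain F :: "'a cdual \<Rightarrow> complex" where F: "bounded_clinear F" "\<And>h. h \<in> Z \<Longrightarrow> F h = 0" "F f = 1"
      using closed_csubspace_separation[OF Zs(1) f] by metis
    obtain x where x: "\<And>h. F h = cdual_apply h x"
      using reflexive_functional_is_evaluation[OF refl F(1)] by blast
    then show ?thesis using F(2,3) by (intro bexI[of _ x]) (auto simp: Y_def)
  qed
  have "\<not> finite_cdim Y"
  proof
    assume "finite_cdim Y"
    then obtain B where B: "finite B" "cspan B = Y" by (auto simp: finite_cdim_def)
    obtain E and p :: "'a \<Rightarrow> 'a \<Rightarrow> complex" where E: "finite E" "E \<subseteq> cspan B"
      and p: "\<And>c. bounded_clinear (p c)"
      and proj: "\<And>x. x \<in> cspan B \<Longrightarrow> (\<Sum>c\<in>E. p c x *\<^sub>C c) = x"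
      using finite_cdim_projection[OF B(1)] by metis
    have "\<exists>b\<in>cspan ((\<lambda>c. cdual_of (p c)) ` E). h - b \<in> Z" for h
    proof
      \<comment> \<open>This is \<open>h\<close> composed with the projection onto \<open>Y\<close>,
        so the difference vanishes on \<open>Y\<close>.\<close>
      let ?b = "\<Sum>c\<in>E. cdual_apply h c *\<^sub>C cdual_of (p c)"
      show "?b \<in> cspan ((\<lambda>c. cdual_of (p c)) ` E)"
        by (intro complex_vector.span_sum complex_vector.span_scale complex_vector.span_base) auto
      show "h - ?b \<in> Z"
      proof (rule ccontr)
        assume "h - ?b \<notin> Z"
        then obtain x where x: "x \<in> Y" "cdual_apply (h - ?b) x = 1" using sep by blast
        have "cdual_apply ?b x = (\<Sum>c\<in>E. cdual_apply h c * p c x)"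
          by (simp add: bounded_clinear_sum[OF bounded_clinear_evaluation]
              cdual_apply_scaleC cdual_apply_cdual_of[OF p])
        also have "\<dots> = cdual_apply h (\<Sum>c\<in>E. p c x *\<^sub>C c)"
          by (simp add: bounded_clinear_sum[OF bounded_clinear_cdual_apply] lin mult.commute)
        also have "\<dots> = cdual_apply h x" using proj x(1) B(2) by simp
        finally show False using x(2) by (simp add: cdual_apply_diff)
      qed
    qed
    then have "finite_ccodim Z"
      unfolding finite_ccodim_def using E(1) by (meson finite_imageI)
    then show False using Zinf by blast
  qed
  moreover have "\<not> finite_ccodim Y"
  proof
    assume "finite_ccodim Y"
    then obtain B where B: "finite B" "\<And>x. \<exists>b\<in>cspan B. x - b \<in> Y"
      by (auto simp: finite_ccodim_def)
    have "f = 0" if f: "f \<in> Z" "\<And>b. b \<in> B \<Longrightarrow> cdual_apply f b = 0" for f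
    proof (rule cdual_eqI)
      fix x
      obtain b where b: "b \<in> cspan B" "x - b \<in> Y" using B(2) by blast
      have "cspan B \<subseteq> {x. cdual_apply f x = 0}"
        using f(2) by (intro complex_vector.span_minimal csubspace_kernel
            bounded_clinear_cdual_apply) auto
      then have "cdual_apply f b = 0" using b(1) by blast
      moreover have "cdual_apply f (x - b) = 0" using b(2) f(1) by (simp add: Y_def)
      ultimately show "cdual_apply f x = cdual_apply 0 x" by (simp add: lin cdual_apply_zero)
    qed
    then have 0: "{f\<in>Z. \<forall>F\<in>(\<lambda>b f. cdual_apply f b) ` B. F f = 0} = {0}"
      using complex_vector.subspace_0[OF Zs(2)] by (auto simp: cdual_apply_zero)
    have "finite_cdim Z"
    proof (rule finite_cdim_kernels[OF _ _ Zs(2)])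
      show "finite ((\<lambda>b f. cdual_apply f b) ` B)" using B(1) by simp
      show "bounded_clinear F" if "F \<in> (\<lambda>b f. cdual_apply f b) ` B" for F
        using that bounded_clinear_evaluation by blast
    qed (simp only: 0 finite_cdim_0)
    then show False using Zinf by blast
  qed
  ultimately have hs: "half_space Y" using Yc by (simp add: half_space_def)
  have inv: "T x \<in> Y" if x: "x \<in> Y" "cdual_apply g x = 0" for x
    unfolding Y_def
  proof (intro CollectI ballI)
    fix f assume f: "f \<in> Z"
    then obtain c where "cdual_map T f - c *\<^sub>C g \<in> Z" using Z(2) by (auto simp: adjoin_def)
    then have "cdual_apply (cdual_map T f - c *\<^sub>C g) x = 0" using x(1) by (simp add: Y_def)
    then show "cdual_apply f (T x) = 0"
      using x(2) by (simp add: cdual_apply_diff cdual_apply_cdual_map[OF T] cdual_apply_scaleC)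
  qed
  show thesis
  \<comment> \<open>\<open>T\<close> maps the part of \<open>Y\<close> annihilated by
    \<open>g\<close> into \<open>Y\<close>. What remains of \<open>Y\<close> is at most one vector
    \<open>y\<close>, and \<open>T y\<close> is the extra direction.\<close>
  proof (cases "\<exists>y\<in>Y. cdual_apply g y \<noteq> 0")
    case True
    then obtain y where y: "y \<in> Y" "cdual_apply g y \<noteq> 0" by blast
    have "T ` Y \<subseteq> adjoin Y (T y)"
    proof clarify
      fix x assume x: "x \<in> Y"
      define c where "c = cdual_apply g x / cdual_apply g y"
      have "x - c *\<^sub>C y \<in> Y"
        by (intro complex_vector.subspace_diff[OF Ys] complex_vector.subspace_scale[OF Ys] x y)
      then have "T (x - c *\<^sub>C y) \<in> Y" using y(2) by (intro inv) (simp_all add: c_def lin)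
      then show "T x \<in> adjoin Y (T y)"
        by (auto simp: adjoin_def bounded_clinear_diff[OF T] bounded_clinear_scale[OF T])
    qed
    then show thesis using that hs by blast
  next
    case False
    then have "T ` Y \<subseteq> adjoin Y 0" using inv subset_adjoin[of Y 0] by blast
    then show thesis using that hs by blast
  qed
qed

section \<open>The resolvent\<close>

text \<open>By Baire, some \<open>E m\<close> contains a ball; differences of its points bound all
  \<open>A n\<close> on a ball around 0, and scaling to half its radius explains the factor
  4.\<close>

lemma uniform_boundedness:
  fixes A :: "nat \<Rightarrow> 'a::complex_banach \<Rightarrow> 'b::complex_normed_vector"
  assumes A: "\<And>n. bounded_clinear (A n)" and bdd: "\<And>x. \<exists>C. \<forall>n. norm (A n x) \<le> C"
  obtains C where "\<And>n x. norm (A n x) \<le> C * norm x"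
proof -
  define E where "E m = {x. \<forall>n. norm (A n x) \<le> real m}" for m :: nat
  have closed: "closed (E m)" for m
    unfolding E_def
    by (intro closed_Collect_all closed_Collect_le continuous_intros bounded_clinear_continuous_on A)
  have "\<Union>(range E) = UNIV"
  proof -
    have "\<exists>m. x \<in> E m" for x
    proof -
      obtain C where C: "\<And>n. norm (A n x) \<le> C" using bdd by blast
      obtain m where "C \<le> real m" using real_arch_simple by blast
      then have "x \<in> E m" unfolding E_def using C order_trans by blast
      then show ?thesis ..
    qed
    then show ?thesis by blast
  qed
  moreover have "interior (\<Union>(range E)) = {}" if "\<And>m. interior (E m) = {}"
    using Met_TC.metric_Baire_category_alt[where 'a = 'a and \<G> = "range E"] closed that
    by (auto simp: complete_UNIV)
  ultimately have "\<exists>m. interior (E m) \<noteq> {}" by (metis UNIV_not_empty interior_UNIV)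
  then obtain m x0 where "x0 \<in> interior (E m)" by blast
  then obtain r where r: "r > 0" "ball x0 r \<subseteq> E m" using mem_interior by blast
  have small: "norm (A n y) \<le> 2 * real m" if y: "norm y < r" for n y
  proof -
    have "x0 \<in> E m" "x0 + y \<in> E m" using r y by (auto simp: dist_norm subset_iff)
    then have "norm (A n x0) \<le> real m" "norm (A n (x0 + y)) \<le> real m" by (auto simp: E_def)
    moreover have "A n y = A n (x0 + y) - A n x0" by (simp add: bounded_clinear_add[OF A])
    ultimately show ?thesis using norm_triangle_ineq4[of "A n (x0 + y)" "A n x0"] by simp
  qed
  have "norm (A n x) \<le> (4 * real m / r) * norm x" for n x
  proof (cases "x = 0")
    case True
    then show ?thesis by (simp add: bounded_clinear_zero[OF A])
  next
    case False
    define t where "t = r / (2 * norm x)"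
    have t: "t > 0" using r(1) False by (simp add: t_def)
    have "norm (of_real t *\<^sub>C x) = t * norm x"
      using t unfolding norm_scaleC by simp
    then have "norm (of_real t *\<^sub>C x) < r" using r(1) False by (simp add: t_def)
    then have "norm (A n (of_real t *\<^sub>C x)) \<le> 2 * real m" by (rule small)
    then have "t * norm (A n x) \<le> 2 * real m"
      using t unfolding bounded_clinear_scale[OF A] norm_scaleC by simp
    then have "norm (A n x) \<le> 2 * real m / t" using t by (simp add: field_simps)
    also have "\<dots> = (4 * real m / r) * norm x" using r(1) False by (simp add: t_def field_simps)
    finally show ?thesis .
  qed
  then show thesis using that by blast
qed

text \<open>The inverse of the identity minus \<open>A\<close> is read off from the fixed point of
  the contraction sending \<open>y\<close> to \<open>x + A y\<close>; uniqueness of the fixed point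
  makes it linear.\<close>

lemma neumann_inverse:
  fixes A :: "'a::complex_banach \<Rightarrow> 'a"
  assumes A: "bounded_clinear A" and q: "0 \<le> q" "q < 1" and Aq: "\<And>x. norm (A x) \<le> q * norm x"
  obtains B where "bounded_clinear B" "\<And>x. B x - A (B x) = x" "\<And>x. B (x - A x) = x"
proof -
  have ex1: "\<exists>!y. x + A y = y" for x
  proof (rule banach_fix_type[OF q])
    show "\<forall>y z. dist (x + A y) (x + A z) \<le> q * dist y z"
      using Aq by (simp add: dist_norm flip: bounded_clinear_diff[OF A])
  qed
  define B where "B x = (THE y. x + A y = y)" for x
  have B: "x + A (B x) = B x" for x unfolding B_def by (rule theI'[OF ex1])
  have Bu: "B x = y" if "x + A y = y" for x y
    unfolding B_def by (rule the1_equality[OF ex1 that])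
  have "bounded_clinear B"
  proof (rule bounded_clinearI)
    fix x y :: 'a and c
    show "B (x + y) = B x + B y"
      using B[of x] B[of y] by (intro Bu) (simp add: bounded_clinear_add[OF A] algebra_simps)
    show "B (c *\<^sub>C x) = c *\<^sub>C B x"
      by (intro Bu) (simp add: bounded_clinear_scale[OF A] B flip: scaleC_add_right)
    have "norm (B x) \<le> norm x + q * norm (B x)"
      using norm_triangle_ineq[of x "A (B x)"] Aq[of "B x"] B[of x] by simp
    then show "norm (B x) \<le> 1 / (1 - q) * norm x" using q by (simp add: field_simps)
  qed
  moreover have "B x - A (B x) = x" for x using B[of x] by (simp add: algebra_simps)
  moreover have "B (x - A x) = x" for x by (rule Bu) simp
  ultimately show thesis using that by blast
qed

text \<open>The sign convention is that \<open>R\<close> inverts T - \<mu>, from both sides.\<close>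

definition is_resolvent ::
    "('a::complex_normed_vector \<Rightarrow> 'a) \<Rightarrow> complex \<Rightarrow> ('a \<Rightarrow> 'a) \<Rightarrow> bool"
  where "is_resolvent T \<mu> R \<longleftrightarrow> bounded_clinear R \<and> (\<forall>x. R (T x - \<mu> *\<^sub>C x) = x) \<and>
    (\<forall>x. T (R x) - \<mu> *\<^sub>C R x = x)"

definition resolvent_set :: "('a::complex_normed_vector \<Rightarrow> 'a) \<Rightarrow> complex set"
  where "resolvent_set T = {\<mu>. \<exists>R. is_resolvent T \<mu> R}"

definition resolvent :: "('a::complex_normed_vector \<Rightarrow> 'a) \<Rightarrow> complex \<Rightarrow> 'a \<Rightarrow> 'a"
  where "resolvent T \<mu> = (SOME R. is_resolvent T \<mu> R)"

lemma resolvent: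
  assumes "\<mu> \<in> resolvent_set T"
  shows "bounded_clinear (resolvent T \<mu>)" "resolvent T \<mu> (T x - \<mu> *\<^sub>C x) = x"
    "T (resolvent T \<mu> x) - \<mu> *\<^sub>C resolvent T \<mu> x = x"
proof -
  have "is_resolvent T \<mu> (resolvent T \<mu>)"
    using assms someI_ex[of "is_resolvent T \<mu>"] by (simp add: resolvent_set_def resolvent_def)
  then show "bounded_clinear (resolvent T \<mu>)" "resolvent T \<mu> (T x - \<mu> *\<^sub>C x) = x"
    "T (resolvent T \<mu> x) - \<mu> *\<^sub>C resolvent T \<mu> x = x"
    by (auto simp: is_resolvent_def)
qed

text \<open>T - \<nu> factors as the identity minus (\<nu> - \<mu>) \<open>R\<close>, applied after
  T - \<mu>. The explicit radius \<open>1 / C\<close> matters: a uniform resolvent bound along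
  points approaching \<nu> excludes \<nu> from the spectrum.\<close>

lemma resolvent_set_near:
  fixes T :: "'a::complex_banach \<Rightarrow> 'a"
  assumes \<mu>: "\<mu> \<in> resolvent_set T" and C: "\<And>x. norm (resolvent T \<mu> x) \<le> C * norm x"
    and near: "cmod (\<nu> - \<mu>) * C < 1" and "0 \<le> C"
  shows "\<nu> \<in> resolvent_set T"
proof -
  define R where "R = resolvent T \<mu>"
  have R: "bounded_clinear R" "\<And>x. R (T x - \<mu> *\<^sub>C x) = x" "\<And>x. T (R x) - \<mu> *\<^sub>C R x = x"
    using resolvent[OF \<mu>] by (auto simp: R_def)
  have "norm ((\<nu> - \<mu>) *\<^sub>C R x) \<le> (cmod (\<nu> - \<mu>) * C) * norm x" for x
    using C[of x] unfolding norm_scaleC mult.assoc by (simp add: R_def mult_left_mono)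
  then obtain B where B: "bounded_clinear B" "\<And>x. B x - (\<nu> - \<mu>) *\<^sub>C R (B x) = x"
    "\<And>x. B (x - (\<nu> - \<mu>) *\<^sub>C R x) = x"
    using neumann_inverse[OF bounded_clinear_cmult[OF R(1), of "\<nu> - \<mu>"] _ near] \<open>0 \<le> C\<close>
    by (metis mult_nonneg_nonneg norm_ge_zero)
  have "is_resolvent T \<nu> (\<lambda>x. R (B x))"
    unfolding is_resolvent_def
  proof (intro conjI allI)
    show "bounded_clinear (\<lambda>x. R (B x))" by (rule bounded_clinear_compose[OF R(1) B(1)])
    fix x
    have "T x - \<nu> *\<^sub>C x = (T x - \<mu> *\<^sub>C x) - (\<nu> - \<mu>) *\<^sub>C R (T x - \<mu> *\<^sub>C x)"
      by (simp add: R(2) complex_vector.scale_left_diff_distrib)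
    then have "B (T x - \<nu> *\<^sub>C x) = T x - \<mu> *\<^sub>C x" by (simp only: B(3))
    then show "R (B (T x - \<nu> *\<^sub>C x)) = x" by (simp only: R(2))
    have "T (R (B x)) - \<nu> *\<^sub>C R (B x) = B x - (\<nu> - \<mu>) *\<^sub>C R (B x)"
      using R(3)[of "B x"] by (simp add: complex_vector.scale_left_diff_distrib algebra_simps)
    then show "T (R (B x)) - \<nu> *\<^sub>C R (B x) = x" by (simp only: B(2))
  qed
  then show ?thesis by (auto simp: resolvent_set_def)
qed

lemma open_resolvent_set: "open (resolvent_set (T :: 'a::complex_banach \<Rightarrow> 'a))"
  unfolding open_dist
proof
  fix \<mu> assume \<mu>: "\<mu> \<in> resolvent_set T"
  obtain C where C: "C > 0" "\<And>x. norm (resolvent T \<mu> x) \<le> C * norm x"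
    using bounded_clinear_pos[OF resolvent(1)[OF \<mu>]] by blast
  have "\<nu> \<in> resolvent_set T" if "dist \<nu> \<mu> < 1 / C" for \<nu>
    using that C(1) by (intro resolvent_set_near[OF \<mu> C(2)]) (simp_all add: dist_norm field_simps)
  then show "\<exists>e>0. \<forall>\<nu>. dist \<nu> \<mu> < e \<longrightarrow> \<nu> \<in> resolvent_set T"
    using C(1) by (intro exI[of _ "1 / C"]) simp
qed

text \<open>T - \<mu> is - \<mu> times a perturbation of the identity of size at most
  \<open>K / cmod \<mu>\<close>. The norm estimate supplies the decay at infinity for Liouville's
  theorem.\<close>

lemma resolvent_set_far:
  fixes T :: "'a::complex_banach \<Rightarrow> 'a"
  assumes T: "bounded_clinear T" and K: "\<And>x. norm (T x) \<le> K * norm x" "0 \<le> K" "K < cmod \<mu>"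
  shows "\<mu> \<in> resolvent_set T" "norm (resolvent T \<mu> x) \<le> norm x / (cmod \<mu> - K)"
proof -
  have \<mu>: "\<mu> \<noteq> 0" using K by auto
  have "norm ((1 / \<mu>) *\<^sub>C T x) \<le> (K / cmod \<mu>) * norm x" for x
    using K(1)[of x] \<mu> by (simp add: norm_scaleC norm_divide field_simps)
  moreover have "K / cmod \<mu> < 1" "0 \<le> K / cmod \<mu>" using K \<mu> by simp_all
  ultimately obtain B where B: "bounded_clinear B" "\<And>x. B x - (1 / \<mu>) *\<^sub>C T (B x) = x"
    "\<And>x. B (x - (1 / \<mu>) *\<^sub>C T x) = x"
    using neumann_inverse[OF bounded_clinear_cmult[OF T, of "1 / \<mu>"]] by metis
  have "is_resolvent T \<mu> (\<lambda>x. (- 1 / \<mu>) *\<^sub>C B x)"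
    unfolding is_resolvent_def
  proof (intro conjI allI)
    show "bounded_clinear (\<lambda>x. (- 1 / \<mu>) *\<^sub>C B x)" by (rule bounded_clinear_cmult[OF B(1)])
    fix x
    have "T x - \<mu> *\<^sub>C x = (- \<mu>) *\<^sub>C (x - (1 / \<mu>) *\<^sub>C T x)"
      using \<mu> by (simp add: complex_vector.scale_right_diff_distrib scaleC_scaleC scaleC_one)
    then show "(- 1 / \<mu>) *\<^sub>C B (T x - \<mu> *\<^sub>C x) = x"
      using \<mu> by (simp only: bounded_clinear_scale[OF B(1)] B(3)) (simp add: scaleC_scaleC scaleC_one)
    have "T ((- 1 / \<mu>) *\<^sub>C B x) - \<mu> *\<^sub>C ((- 1 / \<mu>) *\<^sub>C B x) = B x - (1 / \<mu>) *\<^sub>C T (B x)"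
      using \<mu> unfolding bounded_clinear_scale[OF T]
      by (simp add: scaleC_scaleC scaleC_one)
    then show "T ((- 1 / \<mu>) *\<^sub>C B x) - \<mu> *\<^sub>C ((- 1 / \<mu>) *\<^sub>C B x) = x" by (simp only: B(2))
  qed
  then show res: "\<mu> \<in> resolvent_set T" by (auto simp: resolvent_set_def)
  define y where "y = resolvent T \<mu> x"
  have "\<mu> *\<^sub>C y = T y - x" using resolvent(3)[OF res, of x] by (simp add: y_def algebra_simps)
  then have "cmod \<mu> * norm y = norm (T y - x)" by (metis norm_scaleC)
  also have "\<dots> \<le> K * norm y + norm x" using norm_triangle_ineq4[of "T y" x] K(1)[of y] by simp
  finally show "norm (resolvent T \<mu> x) \<le> norm x / (cmod \<mu> - K)"
    using K(3) by (simp add: y_def field_simps)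
qed

lemma resolvent_identity:
  assumes T: "bounded_clinear T" and "\<mu> \<in> resolvent_set T" "\<nu> \<in> resolvent_set T"
  shows "resolvent T \<nu> x = resolvent T \<mu> x + (\<nu> - \<mu>) *\<^sub>C resolvent T \<mu> (resolvent T \<nu> x)"
proof -
  define y where "y = resolvent T \<nu> x"
  have "x = (T y - \<mu> *\<^sub>C y) - (\<nu> - \<mu>) *\<^sub>C y"
    using resolvent(3)[OF assms(3), of x]
    by (simp add: y_def complex_vector.scale_left_diff_distrib)
  then have "resolvent T \<mu> x = resolvent T \<mu> ((T y - \<mu> *\<^sub>C y) - (\<nu> - \<mu>) *\<^sub>C y)"
    by (rule arg_cong)
  also have "\<dots> = y - (\<nu> - \<mu>) *\<^sub>C resolvent T \<mu> y"
    by (subst bounded_clinear_diff[OF resolvent(1)[OF assms(2)]])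
      (simp only: resolvent(2)[OF assms(2)] bounded_clinear_scale[OF resolvent(1)[OF assms(2)]])
  finally show ?thesis by (simp add: y_def)
qed

text \<open>By the resolvent identity, the difference quotient equals
  \<open>f (resolvent T \<nu> w)\<close> with \<open>w = resolvent T \<mu> e\<close>, so
  differentiability reduces to a continuity statement.\<close>

lemma holomorphic_resolvent:
  fixes T :: "'a::complex_banach \<Rightarrow> 'a" and f :: "'a \<Rightarrow> complex"
  assumes T: "bounded_clinear T" and f: "bounded_clinear f"
  shows "(\<lambda>\<mu>. f (resolvent T \<mu> e)) holomorphic_on resolvent_set T"
proof -
  have "((\<lambda>\<mu>. f (resolvent T \<mu> e)) has_field_derivative f (resolvent T \<mu> (resolvent T \<mu> e))) (at \<mu>)"
    if \<mu>: "\<mu> \<in> resolvent_set T" for \<mu>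
  proof -
    define w where "w = resolvent T \<mu> e"
    obtain C where C: "C > 0" "\<And>x. norm (resolvent T \<mu> x) \<le> C * norm x"
      using bounded_clinear_pos[OF resolvent(1)[OF \<mu>]] by blast
    obtain K where K: "K > 0" "\<And>x. cmod (f x) \<le> K * norm x"
      using bounded_clinear_pos[OF f] by blast
    \<comment> \<open>Within radius \<open>1 / (2 * C)\<close>, half of the norm of
      \<open>resolvent T \<nu> w\<close> can be absorbed, which bounds it by
      \<open>2 * C * norm w\<close>.\<close>
    have "open (resolvent_set T \<inter> ball \<mu> (1 / (2 * C)))"
      by (intro open_Int open_resolvent_set) simp
    then have ev: "\<forall>\<^sub>F \<nu> in at \<mu>. \<nu> \<in> resolvent_set T \<inter> ball \<mu> (1 / (2 * C)) - {\<mu>}"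
      using \<mu> C(1) by (intro eventually_at_in_open) auto
    have "((\<lambda>\<nu>. f (resolvent T \<nu> w) - f (resolvent T \<mu> w)) \<longlongrightarrow> 0) (at \<mu>)"
    proof (rule Lim_null_comparison)
      show "\<forall>\<^sub>F \<nu> in at \<mu>. norm (f (resolvent T \<nu> w) - f (resolvent T \<mu> w)) \<le>
          K * (cmod (\<nu> - \<mu>) * (C * (2 * C * norm w)))"
        using ev
      proof eventually_elim
        case (elim \<nu>)
        then have \<nu>: "\<nu> \<in> resolvent_set T" "cmod (\<nu> - \<mu>) * C \<le> 1/2"
          using C(1) by (auto simp: dist_norm norm_minus_commute field_simps)
        define v where "v = resolvent T \<nu> w"
        have id: "v = resolvent T \<mu> w + (\<nu> - \<mu>) *\<^sub>C resolvent T \<mu> v"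
          unfolding v_def by (rule resolvent_identity[OF T \<mu> \<nu>(1)])
        have diff: "norm ((\<nu> - \<mu>) *\<^sub>C resolvent T \<mu> v) \<le> cmod (\<nu> - \<mu>) * (C * norm v)"
          unfolding norm_scaleC by (intro mult_left_mono C) auto
        have "norm v \<le> C * norm w + cmod (\<nu> - \<mu>) * (C * norm v)"
          using norm_triangle_ineq[of "resolvent T \<mu> w" "(\<nu> - \<mu>) *\<^sub>C resolvent T \<mu> v"]
            C(2)[of w] diff id by simp
        moreover have "cmod (\<nu> - \<mu>) * (C * norm v) \<le> 1/2 * norm v"
          using mult_right_mono[OF \<nu>(2), of "norm v"] by (simp add: mult.assoc)
        ultimately have v: "norm v \<le> 2 * C * norm w" by simp
        have "f v - f (resolvent T \<mu> w) = f ((\<nu> - \<mu>) *\<^sub>C resolvent T \<mu> v)"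
          using id by (metis add_diff_cancel_left' bounded_clinear_diff[OF f])
        also have "cmod \<dots> \<le> K * (cmod (\<nu> - \<mu>) * (C * norm v))"
          using K(2)[of "(\<nu> - \<mu>) *\<^sub>C resolvent T \<mu> v"] mult_left_mono[OF diff, of K] K(1) by linarith
        also have "\<dots> \<le> K * (cmod (\<nu> - \<mu>) * (C * (2 * C * norm w)))"
          using K(1) C(1) v by (intro mult_left_mono) auto
        finally show ?case unfolding v_def .
      qed
      have "((\<lambda>\<nu>. K * (cmod (\<nu> - \<mu>) * (C * (2 * C * norm w)))) \<longlongrightarrow>
          K * (cmod (\<mu> - \<mu>) * (C * (2 * C * norm w)))) (at \<mu>)"
        by (intro tendsto_intros)
      then show "((\<lambda>\<nu>. K * (cmod (\<nu> - \<mu>) * (C * (2 * C * norm w)))) \<longlongrightarrow> 0) (at \<mu>)"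
        by simp
    qed
    then have lim: "((\<lambda>\<nu>. f (resolvent T \<nu> w)) \<longlongrightarrow> f (resolvent T \<mu> w)) (at \<mu>)"
      by (rule LIM_zero_cancel)
    have "\<forall>\<^sub>F \<nu> in at \<mu>. (f (resolvent T \<nu> e) - f (resolvent T \<mu> e)) / (\<nu> - \<mu>) =
        f (resolvent T \<nu> w)"
      using ev
    proof eventually_elim
      case (elim \<nu>)
      then have \<nu>: "\<nu> \<in> resolvent_set T" "\<nu> \<noteq> \<mu>" by auto
      have "resolvent T \<mu> e = resolvent T \<nu> e + (\<mu> - \<nu>) *\<^sub>C resolvent T \<nu> w"
        unfolding w_def by (rule resolvent_identity[OF T \<nu>(1) \<mu>])
      then have "f (resolvent T \<mu> e) = f (resolvent T \<nu> e) + (\<mu> - \<nu>) * f (resolvent T \<nu> w)"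
        by (metis bounded_clinear_add[OF f] bounded_clinear_scale'[OF f])
      then show ?case using \<nu>(2) by (simp add: field_simps)
    qed
    then show ?thesis
      unfolding has_field_derivative_iff using lim by (simp add: tendsto_cong w_def)
  qed
  then show ?thesis
    unfolding holomorphic_on_def field_differentiable_def
    by (blast intro: has_field_derivative_at_within)
qed

theorem functional_eq_0_if_resolvent_bounded_near_spectrum:
  fixes T :: "'a::complex_banach \<Rightarrow> 'a" and f :: "'a \<Rightarrow> complex"
  assumes T: "bounded_clinear T" and f: "bounded_clinear f" and fin: "finite (- resolvent_set T)"
    and bdd: "\<And>lam x. lam \<notin> resolvent_set T \<Longrightarrow>
      \<exists>B. \<forall>\<^sub>F \<mu> in at lam. \<mu> \<in> resolvent_set T \<longrightarrow> cmod (f (resolvent T \<mu> x)) \<le> B"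
  shows "f x = 0"
proof -
  have zero: "f (resolvent T \<mu> x) = 0" if \<mu>: "\<mu> \<in> resolvent_set T" for \<mu> x
  proof -
    define F where "F = (\<lambda>\<mu>. f (resolvent T \<mu> x))"
    have "\<exists>g. g holomorphic_on UNIV \<and> (\<forall>z\<in>UNIV - (- resolvent_set T). g z = F z)"
    proof (rule removable_singularities[OF fin])
      show "F holomorphic_on UNIV - (- resolvent_set T)"
        using holomorphic_resolvent[OF T f] by (simp add: F_def Diff_eq)
      fix z assume "z \<in> - resolvent_set T"
      then obtain B where B: "\<forall>\<^sub>F \<mu> in at z. \<mu> \<in> resolvent_set T \<longrightarrow> cmod (F \<mu>) \<le> B"
        using bdd[of z x] unfolding F_def by blast
      \<comment> \<open>Finiteness of the spectrum puts a punctured neighbourhood of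
        \<open>z\<close> into the resolvent set, so the conditional bound holds on all of
        it.\<close>
      have "\<forall>\<^sub>F \<mu> in nhds z. \<mu> \<in> - (- resolvent_set T - {z})"
        using fin by (intro eventually_nhds_in_open open_Compl finite_imp_closed) auto
      then have "\<forall>\<^sub>F \<mu> in at z. \<mu> \<in> resolvent_set T"
        unfolding eventually_at_filter by eventually_elim auto
      with B have "\<forall>\<^sub>F \<mu> in at z. cmod (F \<mu>) \<le> B * cmod 1"
        by eventually_elim simp
      then show "F \<in> O[at z](\<lambda>_. 1)" by (rule bigoI)
    qed simp
    then obtain g where g: "g holomorphic_on UNIV" "\<And>z. z \<in> resolvent_set T \<Longrightarrow> g z = F z"
      by auto
    obtain K where K: "K > 0" "\<And>x. norm (T x) \<le> K * norm x"
      using bounded_clinear_pos[OF T] by blast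
    obtain L where L: "L > 0" "\<And>x. cmod (f x) \<le> L * norm x"
      using bounded_clinear_pos[OF f] by blast
    have "(g \<longlongrightarrow> 0) at_infinity"
    proof (rule Lim_null_comparison)
      have "\<forall>\<^sub>F z :: complex in at_infinity. K < cmod z"
        using filterlim_norm_at_top filterlim_at_top_dense by blast
      then show "\<forall>\<^sub>F z in at_infinity. cmod (g z) \<le> L * (norm x / (cmod z - K))"
      proof eventually_elim
        case (elim z)
        have z: "z \<in> resolvent_set T" "norm (resolvent T z x) \<le> norm x / (cmod z - K)"
          using resolvent_set_far[OF T K(2)] K(1) elim by auto
        have "cmod (f (resolvent T z x)) \<le> L * (norm x / (cmod z - K))"
          using order_trans[OF L(2) mult_left_mono[OF z(2)]] L(1) by simp
        then show ?case using g(2)[OF z(1)] by (simp add: F_def)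
      qed
      show "((\<lambda>z. L * (norm x / (cmod z - K))) \<longlongrightarrow> 0) (at_infinity :: complex filter)"
      proof -
        have "filterlim (\<lambda>z :: complex. - K + cmod z) at_top at_infinity"
          by (intro filterlim_tendsto_add_at_top[OF tendsto_const] filterlim_norm_at_top)
        then have "((\<lambda>z :: complex. norm x / (- K + cmod z)) \<longlongrightarrow> 0) at_infinity"
          by (intro tendsto_divide_0[OF tendsto_const] filterlim_at_top_imp_at_infinity)
        from tendsto_mult[OF tendsto_const this, of L] show ?thesis by simp
      qed
    qed
    then have "g \<mu> = 0" using Liouville_weak_0[OF g(1)] by blast
    then show ?thesis using g(2)[OF \<mu>] by (simp add: F_def)
  qed
  have "resolvent_set T \<noteq> {}"
    using fin infinite_UNIV_char_0[where 'a = complex] by (metis Compl_empty_eq)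
  then obtain \<mu> where \<mu>: "\<mu> \<in> resolvent_set T" by blast
  \<comment> \<open>Every vector is a value of the resolvent, namely at
    \<open>T x - \<mu> *\<^sub>C x\<close>.\<close>
  show ?thesis using zero[OF \<mu>, of "T x - \<mu> *\<^sub>C x"] resolvent(2)[OF \<mu>] by simp
qed

text \<open>The plane without a finite set is connected, yet it is covered by the disjoint open sets
  \<open>interior S\<close> and \<open>- S\<close>; the second is nonempty, so the first is
  empty.\<close>

lemma finite_of_finite_frontier:
  fixes S :: "complex set"
  assumes "closed S" "S \<noteq> UNIV" "finite (frontier S)"
  shows "finite S" "frontier S = S"
proof -
  have "connected (- frontier S)"
    using connected_open_diff_countable[OF _ open_UNIV connected_UNIV countable_finite[OF assms(3)]]
    by (simp add: Compl_eq_Diff_UNIV)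
  moreover have "- frontier S \<subseteq> interior S \<union> - S"
    using assms(1) by (auto simp: frontier_def)
  moreover have "interior S \<inter> - S \<inter> - frontier S = {}"
    using interior_subset by auto
  ultimately have "interior S \<inter> - frontier S = {} \<or> - S \<inter> - frontier S = {}"
    using assms(1) by (intro connectedD) auto
  moreover have "- S \<inter> - frontier S = - S"
    using assms(1) by (auto simp: frontier_def)
  moreover have "interior S \<inter> - frontier S = interior S" by (auto simp: frontier_def)
  ultimately have "interior S = {}" using assms(2) by auto
  then show "frontier S = S" using assms(1) by (simp add: frontier_def)
  then show "finite S" using assms(3) by simp
qed

section \<open>Chains of subspaces\<close>

lemma independent_sequence:
  fixes y :: "nat \<Rightarrow> 'a::complex_normed_vector"
  assumes "\<And>i. i < m \<Longrightarrow> y i \<notin> cspan (y ` {..<i})"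
  shows "complex_vector.independent (y ` {..<m}) \<and> card (y ` {..<m}) = m"
  using assms
proof (induction m)
  case 0
  then show ?case by (simp add: complex_vector.independent_empty)
next
  case (Suc m)
  then have IH: "complex_vector.independent (y ` {..<m})" "card (y ` {..<m}) = m"
    and new: "y m \<notin> cspan (y ` {..<m})" by auto
  then have "y m \<notin> y ` {..<m}" by (metis complex_vector.span_base)
  then show ?case
    using IH complex_vector.independent_insertI[OF new IH(1)] by (simp add: lessThan_Suc)
qed

lemma not_finite_cdim_increasing:
  fixes E :: "nat \<Rightarrow> 'a::complex_normed_vector set"
  assumes E: "\<And>n. csubspace (E n)" and mono: "\<And>n. E n \<subseteq> E (Suc n)"
    and x: "\<And>n. \<exists>x\<in>D. x \<in> E (Suc n) \<and> x \<notin> E n"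
  shows "\<not> finite_cdim D"
proof
  assume "finite_cdim D"
  then obtain B where B: "finite B" "cspan B = D" by (auto simp: finite_cdim_def)
  obtain y where y: "\<And>n. y n \<in> D" "\<And>n. y n \<in> E (Suc n)" "\<And>n. y n \<notin> E n"
    using x by metis
  have inE: "y j \<in> E i" if "j < i" for i j
    using y(2)[of j] lift_Suc_mono_le[of E "Suc j" i] mono that by auto
  have "y i \<notin> cspan (y ` {..<i})" for i
    using complex_vector.span_minimal[OF _ E[of i], of "y ` {..<i}"] inE y(3)[of i] by auto
  then have "complex_vector.independent (y ` {..<Suc (card B)})"
    "card (y ` {..<Suc (card B)}) = Suc (card B)"
    using independent_sequence[of "Suc (card B)" y] by auto
  then show False
    using complex_vector.independent_span_bound[OF B(1), of "y ` {..<Suc (card B)}"] y(1) B(2)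
    by auto
qed

lemma not_finite_cdim_decreasing:
  fixes E :: "nat \<Rightarrow> 'a::complex_normed_vector set"
  assumes E: "\<And>n. csubspace (E n)" and mono: "\<And>n. E (Suc n) \<subseteq> E n"
    and x: "\<And>n. \<exists>x\<in>D. x \<in> E n \<and> x \<notin> E (Suc n)"
  shows "\<not> finite_cdim D"
proof
  assume "finite_cdim D"
  then obtain B where B: "finite B" "cspan B = D" by (auto simp: finite_cdim_def)
  obtain y where y: "\<And>n. y n \<in> D" "\<And>n. y n \<in> E n" "\<And>n. y n \<notin> E (Suc n)"
    using x by metis
  define m where "m = Suc (card B)"
  \<comment> \<open>Reversed enumeration: vectors from deeper in the chain come first, so each new
    one lies outside the member that contains its predecessors.\<close>
  define z where "z i = y (m - i)" for i
  have inE: "z j \<in> E (Suc (m - i))" if "j < i" "i \<le> m" for i j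
  proof -
    have "Suc (m - i) \<le> m - j" using that by linarith
    then have "E (m - j) \<subseteq> E (Suc (m - i))" using mono by (rule lift_Suc_antimono_le[rotated])
    then show ?thesis using y(2)[of "m - j"] by (auto simp: z_def)
  qed
  have "z i \<notin> cspan (z ` {..<i})" if "i < m" for i
  proof -
    have "z ` {..<i} \<subseteq> E (Suc (m - i))" using inE that by auto
    then have "cspan (z ` {..<i}) \<subseteq> E (Suc (m - i))"
      by (rule complex_vector.span_minimal[OF _ E])
    then show ?thesis using y(3)[of "m - i"] by (auto simp: z_def)
  qed
  then have "complex_vector.independent (z ` {..<m})" "card (z ` {..<m}) = m"
    using independent_sequence[of m z] by auto
  then show False
    using complex_vector.independent_span_bound[OF B(1), of "z ` {..<m}"] y(1) B(2)
    by (auto simp: z_def m_def)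
qed

lemma finite_cdim_chain_stabilizes:
  fixes E :: "nat \<Rightarrow> 'a::complex_normed_vector set"
  assumes E: "\<And>n. csubspace (E n)" and mono: "\<And>n. E (Suc n) \<subseteq> E n" and fin: "finite_cdim (E 0)"
  obtains k0 where "\<And>k. k \<ge> k0 \<Longrightarrow> E k = E k0"
proof -
  have anti: "E k \<subseteq> E j" if "j \<le> k" for j k
    using lift_Suc_antimono_le[of E] mono that by blast
  have "\<exists>k0. \<forall>k\<ge>k0. E k = E k0"
  proof (rule ccontr)
    assume "\<not> (\<exists>k0. \<forall>k\<ge>k0. E k = E k0)"
    then have "\<forall>j. \<exists>k\<ge>j. E k \<noteq> E j" by blast
    then obtain r where r: "\<And>j. r j \<ge> j" "\<And>j. E (r j) \<noteq> E j" by metis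
    define s where "s n = (r ^^ n) 0" for n
    have "E (s (Suc n)) \<subset> E (s n)" for n
      using r(2)[of "s n"] anti[OF r(1)[of "s n"]] by (auto simp: s_def)
    then have "\<exists>x\<in>E 0. x \<in> E (s n) \<and> x \<notin> E (s (Suc n))" for n
      using anti[of 0 "s n"] by blast
    moreover have "E (s (Suc n)) \<subseteq> E (s n)" for n
      using \<open>\<And>n. E (s (Suc n)) \<subset> E (s n)\<close> by blast
    ultimately show False
      using not_finite_cdim_decreasing[of "\<lambda>n. E (s n)" "E 0"] E fin by blast
  qed
  then show thesis using that by blast
qed

section \<open>Generalized eigenspaces on the boundary of the spectrum\<close>

definition shift :: "('a::complex_normed_vector \<Rightarrow> 'a) \<Rightarrow> complex \<Rightarrow> 'a \<Rightarrow> 'a"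
  where "shift T c x = T x - c *\<^sub>C x"

lemma bounded_clinear_shift_power:
  "bounded_clinear T \<Longrightarrow> bounded_clinear (shift T c ^^ n)"
  using bounded_clinear_funpow[OF bounded_clinear_shift[of T c]] by (simp add: shift_def[abs_def])

lemma shift_power_commute:
  assumes T: "bounded_clinear T"
  shows "(shift T c ^^ n) (T x) = T ((shift T c ^^ n) x)"
  by (induction n)
    (simp_all add: shift_def bounded_clinear_diff[OF T] bounded_clinear_scale[OF T])

lemma shift_power_eigenvector:
  assumes T: "bounded_clinear T" and "T v = d *\<^sub>C v"
  shows "(shift T c ^^ n) v = (d - c) ^ n *\<^sub>C v"
proof (induction n)
  case 0
  then show ?case by (simp add: scaleC_one)
next
  case (Suc n)
  then show ?case
    using assms(2)
    by (simp add: shift_def bounded_clinear_scale[OF T] scaleC_scaleC mult.commute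
        left_diff_distrib complex_vector.scale_left_diff_distrib)
qed

text \<open>The shift maps the kernel of its power \<open>Suc n\<close> into that of its power
  \<open>n\<close>, with a kernel inside its own.\<close>

lemma finite_cdim_shift_power_kernel:
  assumes T: "bounded_clinear T" and ker: "finite_cdim {x. shift T c x = 0}"
  shows "finite_cdim {x. (shift T c ^^ n) x = 0}"
proof (induction n)
  case 0
  then show ?case using finite_cdim_0 by simp
next
  case (Suc n)
  let ?S = "shift T c" and ?Y = "{x. (shift T c ^^ Suc n) x = 0}"
  have S: "bounded_clinear ?S" using bounded_clinear_shift_power[OF T, where n = 1] by simp
  have Y: "csubspace ?Y" by (rule csubspace_kernel[OF bounded_clinear_shift_power[OF T]])
  show ?case
  proof (rule finite_cdim_kernel_image[OF S Y])
    show "finite_cdim {y \<in> ?Y. ?S y = 0}"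
    proof (rule finite_cdim_subspace[OF _ _ ker])
      show "csubspace {y \<in> ?Y. ?S y = 0}"
        using complex_vector.subspace_inter[OF Y csubspace_kernel[OF S]]
        by (simp only: Collect_conj_eq[symmetric] mem_Collect_eq Int_def)
    qed auto
    show "finite_cdim (?S ` ?Y)"
      by (rule finite_cdim_subspace[OF csubspace_image[OF S Y] _ Suc])
        (auto simp: funpow_Suc_right simp del: funpow.simps)
  qed
qed

text \<open>Long Jordan chains make every Y_k infinite-dimensional, so one of infinite codimension
  is already an invariant half-space. The alternative between a strictly decreasing and a
  stabilizing sequence is thus considered for finite codimensions only.\<close>

lemma half_space_of_infinite_ascent:
  fixes T :: "'a::complex_normed_vector \<Rightarrow> 'a"
  assumes refl: "reflexive_space TYPE('a)" and T: "bounded_clinear T"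
    and lam: "lam \<in> closure (resolvent_set T)"
    and ker: "finite_cdim {x. shift T lam x = 0}"
    and asc: "\<And>n. \<exists>x. (shift T lam ^^ Suc n) x = 0 \<and> (shift T lam ^^ n) x \<noteq> 0"
  obtains Y e where "half_space Y" "T ` Y \<subseteq> adjoin Y e"
proof -
  define S where "S = shift T lam"
  define Y where "Y k = closure (range (S ^^ k))" for k
  have S: "bounded_clinear (S ^^ k)" for k
    unfolding S_def by (rule bounded_clinear_shift_power[OF T])
  have S_add: "(S ^^ (m + k)) x = (S ^^ m) ((S ^^ k) x)" for m k x
    by (simp add: funpow_add)
  have TS: "(S ^^ k) (T x) = T ((S ^^ k) x)" for k x
    unfolding S_def by (rule shift_power_commute[OF T])
  have Yc: "closed_csubspace (Y k)" for k
    using csubspace_image[OF S complex_vector.subspace_UNIV]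
    by (simp add: Y_def closed_csubspace_def csubspace_closure)
  then have Ys: "csubspace (Y k)" "closed (Y k)" for k by (auto simp: closed_csubspace_def)
  have rangeY: "(S ^^ k) x \<in> Y k" for k x
    unfolding Y_def by (rule subsetD[OF closure_subset rangeI])
  have TY: "T ` Y k \<subseteq> Y k" for k
    unfolding Y_def
  proof (rule image_closure_subset_closed[OF T closed_closure])
    have "T ` range (S ^^ k) \<subseteq> range (S ^^ k)" by (auto simp flip: TS)
    then show "T ` range (S ^^ k) \<subseteq> closure (range (S ^^ k))"
      using closure_subset by (rule order_trans)
  qed
  have Ymono: "Y (Suc k) \<subseteq> Y k" for k
  proof -
    have "range (S ^^ Suc k) \<subseteq> range (S ^^ k)" by (auto simp: funpow_Suc_right simp del: funpow.simps)
    then show ?thesis unfolding Y_def by (rule closure_mono)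
  qed
  define Ker where "Ker n = {x. (S ^^ n) x = 0}" for n
  have Kers: "csubspace (Ker n)" for n unfolding Ker_def by (rule csubspace_kernel[OF S])
  have kermono: "Ker n \<subseteq> Ker (Suc n)" for n
    using bounded_clinear_zero[OF S[of 1]] by (auto simp: Ker_def)
  \<comment> \<open>The powers of \<open>S\<close> push a long Jordan chain into the range of any given power.\<close>
  have chain: "\<exists>w. w \<in> range (S ^^ k) \<and> w \<in> Ker (Suc n) \<and> w \<notin> Ker n" for k n
  proof -
    obtain x where "(S ^^ Suc (n + k)) x = 0" "(S ^^ (n + k)) x \<noteq> 0"
      using asc[of "n + k"] unfolding S_def by blast
    then have "(S ^^ Suc n) ((S ^^ k) x) = 0" "(S ^^ n) ((S ^^ k) x) \<noteq> 0"
      using S_add[of "Suc n" k x] S_add[of n k x] by simp_all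
    then show ?thesis unfolding Ker_def by blast
  qed
  show thesis
  proof (cases "\<exists>k. \<not> finite_ccodim (Y k)")
    case True
    then obtain k where k: "\<not> finite_ccodim (Y k)" by blast
    have "\<exists>w\<in>Y k. w \<in> Ker (Suc n) \<and> w \<notin> Ker n" for n
      using chain[of k n] rangeY by blast
    then have "\<not> finite_cdim (Y k)"
      by (rule not_finite_cdim_increasing[where E = Ker, OF Kers kermono])
    then have "half_space (Y k)" using k Yc by (simp add: half_space_def)
    then show thesis using that[of "Y k" 0] TY subset_adjoin by blast
  next
    case codim: False
    show thesis
    proof (cases "\<exists>k. Y (Suc k) = Y k")
      case False
      \<comment> \<open>Each kernel of a power is finite-dimensional, so its intersections with the
        \<open>Y k\<close> stabilize; a Jordan vector of prescribed height therefore lies in all of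
        them, which makes \<open>D\<close> infinite-dimensional.\<close>
      define D where "D = (\<Inter>k. Y k)"
      have Ds: "closed_csubspace D"
        using Ys by (auto simp: D_def closed_csubspace_def intro!: complex_vector.subspace_Inter)
      have TD: "T ` D \<subseteq> D" using TY unfolding D_def by blast
      have "\<exists>w\<in>D. w \<in> Ker (Suc n) \<and> w \<notin> Ker n" for n
      proof -
        define E where "E k = Ker (Suc n) \<inter> Y k" for k
        have "csubspace (E k)" for k
          unfolding E_def by (rule complex_vector.subspace_inter[OF Kers Ys(1)])
        moreover have Emono: "E (Suc k) \<subseteq> E k" for k using Ymono[of k] unfolding E_def by blast
        moreover have "finite_cdim (E 0)"
          by (rule finite_cdim_subspace[OF calculation(1) _
                finite_cdim_shift_power_kernel[OF T ker, of "Suc n"]]) (auto simp: E_def S_def Ker_def)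
        ultimately obtain k0 where k0: "\<And>k. k \<ge> k0 \<Longrightarrow> E k = E k0"
          using finite_cdim_chain_stabilizes by metis
        obtain w where w: "w \<in> range (S ^^ k0)" "w \<in> Ker (Suc n)" "w \<notin> Ker n"
          using chain by blast
        have "w \<in> E k0" using w rangeY by (auto simp: E_def)
        moreover have "E k0 \<subseteq> E k" for k
        proof (cases "k \<ge> k0")
          case True
          then show ?thesis by (intro equalityD2 k0)
        next
          case False
          then have "k \<le> k0" by simp
          then show ?thesis by (rule lift_Suc_antimono_le[of E, OF Emono])
        qed
        ultimately have "w \<in> D" unfolding D_def E_def by blast
        then show ?thesis using w by blast
      qed
      then have inf: "\<not> finite_cdim D"
        by (rule not_finite_cdim_increasing[where E = Ker, OF Kers kermono])
      have "\<not> finite_ccodim D"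
      proof
        assume "finite_ccodim D"
        then obtain B where B: "finite B" "\<And>x. \<exists>b\<in>cspan B. x - b \<in> D"
          by (auto simp: finite_ccodim_def)
        have "\<exists>b\<in>cspan B. b \<in> Y k \<and> b \<notin> Y (Suc k)" for k
        proof -
          obtain x where x: "x \<in> Y k" "x \<notin> Y (Suc k)" using False Ymono[of k] by blast
          obtain b where b: "b \<in> cspan B" "x - b \<in> D" using B(2) by blast
          then have d: "x - b \<in> Y j" for j by (simp add: D_def)
          have "b = x - (x - b)" "x = b + (x - b)" by simp_all
          then have "b \<in> Y k" "b \<notin> Y (Suc k)"
            using x d complex_vector.subspace_diff[OF Ys(1)] complex_vector.subspace_add[OF Ys(1)]
            by metis+
          then show ?thesis using b(1) by blast
        qed
        then have "\<not> finite_cdim (cspan B)"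
          by (rule not_finite_cdim_decreasing[where E = Y, OF Ys(1) Ymono])
        then show False using finite_cdim_span[OF B(1)] by blast
      qed
      then have "half_space D" using Ds inf by (simp add: half_space_def)
      then show thesis using that[of D 0] TD subset_adjoin by blast
    next
      case True
      then obtain k where k: "Y (Suc k) = Y k" by blast
      \<comment> \<open>The annihilator of \<open>Y k\<close>, finite-dimensional because
        \<open>Y k\<close> has finite codimension.\<close>
      define N where "N = {f :: 'a cdual. \<forall>x. cdual_apply f ((S ^^ k) x) = 0}"
      have Nclosure: "cdual_apply f y = 0" if "f \<in> N" "y \<in> Y k" for f y
        using image_closure_subset_closed[OF bounded_clinear_cdual_apply[of f], of "{0}"
            "range (S ^^ k)"] that by (auto simp: N_def Y_def)
      have Ns: "csubspace N"
        by (rule complex_vector.subspaceI)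
          (auto simp: N_def cdual_apply_add cdual_apply_scaleC cdual_apply_zero)
      obtain B where B: "finite B" "\<And>x. \<exists>b\<in>cspan B. x - b \<in> Y k"
        using codim unfolding finite_ccodim_def by metis
      have "f = 0" if f: "f \<in> N" "\<And>b. b \<in> B \<Longrightarrow> cdual_apply f b = 0" for f
      proof (rule cdual_eqI)
        fix x
        obtain b where b: "b \<in> cspan B" "x - b \<in> Y k" using B(2) by blast
        have "cspan B \<subseteq> {x. cdual_apply f x = 0}"
          using f(2) by (intro complex_vector.span_minimal csubspace_kernel
              bounded_clinear_cdual_apply) auto
        then have "cdual_apply f b = 0" using b(1) by blast
        then show "cdual_apply f x = cdual_apply 0 x"
          using Nclosure[OF f(1) b(2)]
          by (simp add: bounded_clinear_diff[OF bounded_clinear_cdual_apply] cdual_apply_zero)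
      qed
      then have 0: "{f\<in>N. \<forall>F\<in>(\<lambda>b f. cdual_apply f b) ` B. F f = 0} = {0}"
        using complex_vector.subspace_0[OF Ns] by (auto simp: cdual_apply_zero)
      have Nfin: "finite_cdim N"
      proof (rule finite_cdim_kernels[OF _ _ Ns])
        show "finite ((\<lambda>b f. cdual_apply f b) ` B)" using B(1) by simp
        show "bounded_clinear F" if "F \<in> (\<lambda>b f. cdual_apply f b) ` B" for F
          using that bounded_clinear_evaluation by blast
      qed (simp only: 0 finite_cdim_0)
      have Ninv: "cdual_map T f \<in> N" if "f \<in> N" for f
        using that unfolding N_def by (simp add: cdual_apply_cdual_map[OF T] flip: TS)
      have Ninj: "f \<in> N" if "cdual_map T f - lam *\<^sub>C f \<in> N" for f
      proof -
        have "cdual_apply f (S ((S ^^ k) x)) = 0" for x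
        proof -
          have "cdual_apply (cdual_map T f - lam *\<^sub>C f) ((S ^^ k) x) = 0"
            using that by (simp add: N_def)
          then show ?thesis
            by (simp add: S_def shift_def cdual_apply_diff cdual_apply_scaleC
                cdual_apply_cdual_map[OF T] bounded_clinear_diff[OF bounded_clinear_cdual_apply]
                bounded_clinear_scale'[OF bounded_clinear_cdual_apply])
        qed
        \<comment> \<open>Stabilization enters here: vanishing on the range of the power
          \<open>Suc k\<close> passes to its closure, which is \<open>Y k\<close>.\<close>
        then have "cdual_apply f ` Y (Suc k) \<subseteq> {0}"
          unfolding Y_def
          by (intro image_closure_subset_closed bounded_clinear_cdual_apply) auto
        then show ?thesis unfolding k using rangeY by (auto simp: N_def)
      qed
      \<comment> \<open>An eigenvector inside the range, annihilated by all of \<open>N\<close>; the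
        chain is used at height 0, where the kernel is trivial.\<close>
      obtain v where v: "v \<in> range (S ^^ k)" "S v = 0" "v \<noteq> 0"
        using chain[of k 0] by (auto simp: Ker_def)
      have vN: "cdual_apply f v = 0" if "f \<in> N" for f
        using that v(1) by (auto simp: N_def)
      have Tv: "T v = lam *\<^sub>C v" using v(2) by (simp add: S_def shift_def)
      obtain g0 :: "'a \<Rightarrow> complex" where g0: "bounded_clinear g0" "g0 v = 1"
        using closed_csubspace_separation[OF closed_csubspace_finite_cdim[OF finite_cdim_0]] v(3)
        by (metis singletonD)
      define g where "g = cdual_of g0"
      have gv: "cdual_apply g v = 1" by (simp add: g_def cdual_apply_cdual_of g0)
      have blow: "\<exists>\<mu> h. cmod (\<mu> - lam) < \<delta> \<and> cdual_map T h - \<mu> *\<^sub>C h = g \<and>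
          (\<forall>z\<in>N. norm (h - z) \<ge> K)" if "\<delta> > 0" for K \<delta>
      proof -
        \<comment> \<open>Every \<open>h - z\<close> with \<open>z\<close> in \<open>N\<close> takes
          the value \<open>1 / (lam - \<mu>)\<close> at \<open>v\<close>, so this radius forces its
          norm to be at least \<bar>\<open>K\<close>\<bar> + 1; the added 1 keeps the denominator
          positive.\<close>
        define \<epsilon> where "\<epsilon> = min \<delta> (1 / ((\<bar>K\<bar> + 1) * norm v))"
        have "\<epsilon> > 0" using that v(3) by (simp add: \<epsilon>_def)
        then obtain \<mu> where \<mu>: "\<mu> \<in> resolvent_set T" "cmod (\<mu> - lam) < \<epsilon>"
          using lam by (auto simp: closure_approachable dist_norm)
        define R where "R = resolvent T \<mu>"
        have R: "bounded_clinear R" "\<And>x. R (T x - \<mu> *\<^sub>C x) = x" "\<And>x. T (R x) - \<mu> *\<^sub>C R x = x"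
          using resolvent[OF \<mu>(1)] by (auto simp: R_def)
        define h where "h = cdual_map R g"
        have h: "cdual_map T h - \<mu> *\<^sub>C h = g"
        proof (rule cdual_eqI)
          fix x
          have "cdual_apply (cdual_map T h - \<mu> *\<^sub>C h) x = cdual_apply g (R (T x - \<mu> *\<^sub>C x))"
            by (simp add: cdual_apply_diff cdual_apply_scaleC cdual_apply_cdual_map[OF T] h_def
                cdual_apply_cdual_map[OF R(1)] bounded_clinear_diff[OF bounded_clinear_cdual_apply]
                bounded_clinear_scale'[OF bounded_clinear_cdual_apply]
                bounded_clinear_diff[OF R(1)] bounded_clinear_scale[OF R(1)])
          then show "cdual_apply (cdual_map T h - \<mu> *\<^sub>C h) x = cdual_apply g x" by (simp only: R(2))
        qed
        have "R ((lam - \<mu>) *\<^sub>C v) = v"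
          using R(2)[of v] by (simp add: Tv complex_vector.scale_left_diff_distrib)
        then have "(lam - \<mu>) *\<^sub>C R v = v" by (simp add: bounded_clinear_scale[OF R(1)])
        then have "(lam - \<mu>) * cdual_apply g (R v) = 1"
          using gv by (metis bounded_clinear_scale'[OF bounded_clinear_cdual_apply])
        then have hv: "(lam - \<mu>) * cdual_apply h v = 1"
          by (simp add: h_def cdual_apply_cdual_map[OF R(1)])
        have "norm (h - z) \<ge> K" if z: "z \<in> N" for z
        proof -
          have "(lam - \<mu>) * cdual_apply (h - z) v = 1" using hv vN[OF z] by (simp add: cdual_apply_diff)
          then have "cmod (\<mu> - lam) * cmod (cdual_apply (h - z) v) = 1"
            by (metis norm_minus_commute norm_mult norm_one)
          moreover have "cmod (\<mu> - lam) * cmod (cdual_apply (h - z) v) \<le>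
              (1 / ((\<bar>K\<bar> + 1) * norm v)) * (norm (h - z) * norm v)"
            using \<mu>(2) by (intro mult_mono cmod_cdual_apply) (auto simp: \<epsilon>_def)
          ultimately have "1 \<le> norm (h - z) / (\<bar>K\<bar> + 1)" using v(3) by simp
          then have "\<bar>K\<bar> + 1 \<le> norm (h - z)" by (simp add: pos_le_divide_eq)
          then show ?thesis by linarith
        qed
        then show ?thesis using \<mu>(2) h by (intro exI[of _ \<mu>] exI[of _ h]) (auto simp: \<epsilon>_def)
      qed
      obtain Z where "half_space Z" "cdual_map T ` Z \<subseteq> adjoin Z g"
        using half_space_of_blow_up[OF reflexive_cdual[OF refl] bounded_clinear_cdual_map[OF T]
            Nfin Ninv Ninj blow] by metis
      then show thesis using half_space_preannihilator[OF refl T] that by metis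
    qed
  qed
qed

section \<open>Existence of the half-space\<close>

text \<open>Without half-spaces there is no blow-up for any single \<open>e\<close>, which bounds
  the resolvents pointwise modulo \<open>N\<close>. Uniform boundedness removes the dependence on
  the vector.\<close>

lemma local_resolvent_bound:
  fixes T :: "'a::complex_banach \<Rightarrow> 'a"
  assumes refl: "reflexive_space TYPE('a)" and T: "bounded_clinear T"
    and Nfin: "finite_cdim N" and inv: "\<And>z. z \<in> N \<Longrightarrow> T z \<in> N"
    and inj: "\<And>x. T x - lam *\<^sub>C x \<in> N \<Longrightarrow> x \<in> N"
    and nh: "\<And>Y e. half_space Y \<Longrightarrow> \<not> T ` Y \<subseteq> adjoin Y e"
  obtains C \<delta> where "C > 0" "\<delta> > 0"
    "\<And>\<mu> x. \<mu> \<in> resolvent_set T \<Longrightarrow> cmod (\<mu> - lam) < \<delta> \<Longrightarrow>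
      \<exists>z\<in>N. norm (resolvent T \<mu> x - z) \<le> C * norm x"
proof -
  obtain B where B: "finite B" "cspan B = N" using Nfin by (auto simp: finite_cdim_def)
  obtain E and g :: "'a \<Rightarrow> 'a \<Rightarrow> complex" where E: "finite E" "E \<subseteq> cspan B"
    and g: "\<And>c. bounded_clinear (g c)"
    and proj: "\<And>x. x \<in> cspan B \<Longrightarrow> (\<Sum>c\<in>E. g c x *\<^sub>C c) = x"
    using finite_cdim_projection[OF B(1)] by metis
  define P where "P = (\<lambda>x. \<Sum>c\<in>E. g c x *\<^sub>C c)"
  have P: "bounded_clinear P"
    unfolding P_def
    by (intro bounded_clinear_setsum bounded_clinear_compose[OF bounded_clinear_scaleC_left] g)
  have PN: "P x \<in> N" for x
    unfolding P_def B(2)[symmetric] using E(2)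
    by (intro complex_vector.span_sum complex_vector.span_scale) auto
  \<comment> \<open>\<open>Q\<close> stands in for the quotient map by \<open>N\<close>: it vanishes
    on \<open>N\<close>, so \<open>norm (Q h)\<close> is controlled by the distance of
    \<open>h\<close> to \<open>N\<close>, and \<open>h - Q h\<close> lies in
    \<open>N\<close>.\<close>
  define Q where "Q = (\<lambda>x. x - P x)"
  have Q: "bounded_clinear Q"
    unfolding Q_def by (rule bounded_clinear_sub[OF bounded_clinear_ident P])
  have QN: "Q z = 0" if "z \<in> N" for z using proj that B(2) by (simp add: Q_def P_def)
  obtain D where D: "D > 0" "\<And>x. norm (Q x) \<le> D * norm x"
    using bounded_clinear_pos[OF Q] by blast
  have pointwise: "\<exists>K \<delta>. \<delta> > 0 \<and> (\<forall>\<mu>\<in>resolvent_set T. cmod (\<mu> - lam) < \<delta> \<longrightarrow>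
      norm (Q (resolvent T \<mu> e)) \<le> K)" for e
  proof -
    have "\<not> (\<forall>K \<delta>. \<delta> > 0 \<longrightarrow> (\<exists>\<mu> h. cmod (\<mu> - lam) < \<delta> \<and> T h - \<mu> *\<^sub>C h = e \<and>
        (\<forall>z\<in>N. norm (h - z) \<ge> K)))"
    proof
      assume "\<forall>K \<delta>. \<delta> > 0 \<longrightarrow> (\<exists>\<mu> h. cmod (\<mu> - lam) < \<delta> \<and> T h - \<mu> *\<^sub>C h = e \<and>
        (\<forall>z\<in>N. norm (h - z) \<ge> K))"
      then obtain Y where "half_space Y" "T ` Y \<subseteq> adjoin Y e"
        using half_space_of_blow_up[OF refl T Nfin inv inj, where e = e] by metis
      then show False using nh by blast
    qed
    then obtain K \<delta> where \<delta>: "\<delta> > 0"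
      "\<And>\<mu> h. cmod (\<mu> - lam) < \<delta> \<Longrightarrow> T h - \<mu> *\<^sub>C h = e \<Longrightarrow> \<exists>z\<in>N. norm (h - z) < K"
      by (meson not_le)
    have "norm (Q (resolvent T \<mu> e)) \<le> D * K"
      if \<mu>: "\<mu> \<in> resolvent_set T" "cmod (\<mu> - lam) < \<delta>" for \<mu>
    proof -
      obtain z where z: "z \<in> N" "norm (resolvent T \<mu> e - z) < K"
        using \<delta>(2)[OF \<mu>(2) resolvent(3)[OF \<mu>(1)]] by blast
      have "Q (resolvent T \<mu> e) = Q (resolvent T \<mu> e - z)"
        using QN[OF z(1)] by (simp add: bounded_clinear_diff[OF Q])
      then have "norm (Q (resolvent T \<mu> e)) \<le> D * norm (resolvent T \<mu> e - z)"
        using D(2) by simp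
      also have "\<dots> \<le> D * K" using z(2) D(1) by simp
      finally show ?thesis .
    qed
    then show ?thesis using \<delta>(1) by blast
  qed
  have "\<exists>C \<delta>. C > 0 \<and> \<delta> > 0 \<and> (\<forall>\<mu>\<in>resolvent_set T. cmod (\<mu> - lam) < \<delta> \<longrightarrow>
      (\<forall>x. norm (Q (resolvent T \<mu> x)) \<le> C * norm x))"
  proof (rule ccontr)
    assume not: "\<not> ?thesis"
    \<comment> \<open>Using \<open>Suc n\<close> both as bound and as inverse radius yields one
      sequence of operators, to which uniform boundedness applies.\<close>
    have "\<exists>\<mu> x. \<mu> \<in> resolvent_set T \<and> cmod (\<mu> - lam) < 1 / real (Suc n) \<and>
        real (Suc n) * norm x < norm (Q (resolvent T \<mu> x))" for n
    proof -
      have "\<not> (\<forall>\<mu>\<in>resolvent_set T. cmod (\<mu> - lam) < 1 / real (Suc n) \<longrightarrow>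
          (\<forall>x. norm (Q (resolvent T \<mu> x)) \<le> real (Suc n) * norm x))"
      proof
        assume *: "\<forall>\<mu>\<in>resolvent_set T. cmod (\<mu> - lam) < 1 / real (Suc n) \<longrightarrow>
          (\<forall>x. norm (Q (resolvent T \<mu> x)) \<le> real (Suc n) * norm x)"
        have "real (Suc n) > 0" "1 / real (Suc n) > 0" by simp_all
        with * show False using not by blast
      qed
      then show ?thesis by (meson not_le)
    qed
    then obtain \<mu> x where \<mu>: "\<And>n. \<mu> n \<in> resolvent_set T"
      "\<And>n. cmod (\<mu> n - lam) < 1 / real (Suc n)"
      and x: "\<And>n. real (Suc n) * norm (x n) < norm (Q (resolvent T (\<mu> n) (x n)))" by metis
    define A where "A n = (\<lambda>y. Q (resolvent T (\<mu> n) y))" for n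
    have A: "bounded_clinear (A n)" for n
      unfolding A_def by (rule bounded_clinear_compose[OF Q resolvent(1)[OF \<mu>(1)]])
    have "\<exists>C. \<forall>n. norm (A n y) \<le> C" for y
    proof -
      obtain K \<delta> where \<delta>: "\<delta> > 0" "\<And>\<mu>. \<mu> \<in> resolvent_set T \<Longrightarrow> cmod (\<mu> - lam) < \<delta> \<Longrightarrow>
          norm (Q (resolvent T \<mu> y)) \<le> K"
        using pointwise[of y] by blast
      obtain n0 where n0: "1 / real (Suc n0) < \<delta>"
        using \<delta>(1) by (metis nat_approx_posE)
      have "norm (A n y) \<le> K" if "n \<ge> n0" for n
      proof -
        have "1 / real (Suc n) \<le> 1 / real (Suc n0)" using that by (intro divide_left_mono) auto
        then show ?thesis
          unfolding A_def using \<mu>(2)[of n] n0 by (intro \<delta>(2) \<mu>(1)) linarith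
      qed
      then have "\<forall>\<^sub>F n in sequentially. norm (A n y) \<le> K"
        unfolding eventually_sequentially by blast
      then have "Bseq (\<lambda>n. A n y)" by (rule BfunI)
      then show ?thesis unfolding Bseq_def by blast
    qed
    then obtain C where C: "\<And>n y. norm (A n y) \<le> C * norm y"
      using uniform_boundedness[where A = A, OF A] by metis
    obtain n where n: "C \<le> real n" using real_arch_simple by blast
    have "real (Suc n) * norm (x n) < C * norm (x n)"
      using x[of n] C[of n "x n"] unfolding A_def by linarith
    also have "\<dots> \<le> real (Suc n) * norm (x n)" using n by (intro mult_right_mono) auto
    finally show False by simp
  qed
  then obtain C \<delta> where C: "C > 0" "\<delta> > 0" "\<And>\<mu> x. \<mu> \<in> resolvent_set T \<Longrightarrow> cmod (\<mu> - lam) < \<delta> \<Longrightarrow>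
      norm (Q (resolvent T \<mu> x)) \<le> C * norm x" by blast
  have "\<exists>z\<in>N. norm (resolvent T \<mu> x - z) \<le> C * norm x"
    if "\<mu> \<in> resolvent_set T" "cmod (\<mu> - lam) < \<delta>" for \<mu> x
    using C(3)[OF that, of x] PN unfolding Q_def by blast
  then show thesis using that C(1,2) by blast
qed

theorem exists_half_space_defect_le_1:
  fixes T :: "'a::complex_banach \<Rightarrow> 'a"
  assumes inf: "\<not> finite_cdim (UNIV :: 'a set)" and refl: "reflexive_space TYPE('a)"
    and T: "bounded_clinear T"
  shows "\<exists>Y e. half_space Y \<and> T ` Y \<subseteq> adjoin Y e"
proof (rule ccontr)
  assume "\<not> ?thesis"
  then have nh: "\<not> T ` Y \<subseteq> adjoin Y e" if "half_space Y" for Y e using that by blast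
  define \<sigma> where "\<sigma> = - resolvent_set T"
  have \<sigma>: "closed \<sigma>" unfolding \<sigma>_def using open_resolvent_set[of T] by (simp add: closed_Compl)
  have fr: "lam \<in> closure (resolvent_set T)" "lam \<in> \<sigma>" if "lam \<in> frontier \<sigma>" for lam
    using that \<sigma> by (auto simp: frontier_closures \<sigma>_def)
  have ker: "finite_cdim {x. shift T c x = 0}" for c
  proof (rule ccontr)
    assume "\<not> finite_cdim {x. shift T c x = 0}"
    moreover have S: "bounded_clinear (shift T c)"
      using bounded_clinear_shift_power[OF T, where n = 1] by simp
    have "closed_csubspace {x. shift T c x = 0}"
      using csubspace_kernel[OF S] closed_kernel[OF S] by (simp add: closed_csubspace_def)
    ultimately obtain Y where Y: "half_space Y" "Y \<subseteq> {x. shift T c x = 0}"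
      using half_space_in_infinite_dimension by metis
    have "T y \<in> adjoin Y 0" if "y \<in> Y" for y
    proof -
      have "T y = c *\<^sub>C y" using Y(2) that by (auto simp: shift_def)
      then show ?thesis
        using that Y(1) subset_adjoin complex_vector.subspace_scale
        by (metis closed_csubspace_def half_space_def subsetD)
    qed
    then show False using nh[OF Y(1)] by blast
  qed
  \<comment> \<open>The data of a boundary point are bundled so that one choice provides
    \<open>N\<close>, \<open>C\<close> and \<delta> together.\<close>
  define G where "G lam N C \<delta> \<longleftrightarrow> finite_cdim N \<and> (\<exists>n. N = {x. (shift T lam ^^ n) x = 0}) \<and>
      C > 0 \<and> \<delta> > 0 \<and> (\<forall>\<mu>\<in>resolvent_set T. cmod (\<mu> - lam) < \<delta> \<longrightarrow>
        (\<forall>x. \<exists>z\<in>N. norm (resolvent T \<mu> x - z) \<le> C * norm x))" for lam N C \<delta>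
  have "\<exists>N C \<delta>. G lam N C \<delta>"
    if lam: "lam \<in> frontier \<sigma>" for lam
  proof -
    have "\<not> (\<forall>n. \<exists>x. (shift T lam ^^ Suc n) x = 0 \<and> (shift T lam ^^ n) x \<noteq> 0)"
      using half_space_of_infinite_ascent[OF refl T fr(1)[OF lam] ker] nh by metis
    then obtain n where n: "\<And>x. (shift T lam ^^ Suc n) x = 0 \<Longrightarrow> (shift T lam ^^ n) x = 0"
      by blast
    define N where "N = {x. (shift T lam ^^ n) x = 0}"
    have Nfin: "finite_cdim N" unfolding N_def by (rule finite_cdim_shift_power_kernel[OF T ker])
    have inv: "T z \<in> N" if "z \<in> N" for z
      using that by (simp add: N_def shift_power_commute[OF T] bounded_clinear_zero[OF T])
    have inj: "x \<in> N" if "T x - lam *\<^sub>C x \<in> N" for x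
    proof -
      have "(shift T lam ^^ Suc n) x = (shift T lam ^^ n) (T x - lam *\<^sub>C x)"
        by (simp add: funpow_Suc_right shift_def del: funpow.simps)
      then show ?thesis using that n[of x] by (simp add: N_def)
    qed
    obtain C \<delta> where "C > 0" "\<delta> > 0" "\<And>\<mu> x. \<mu> \<in> resolvent_set T \<Longrightarrow> cmod (\<mu> - lam) < \<delta> \<Longrightarrow>
      \<exists>z\<in>N. norm (resolvent T \<mu> x - z) \<le> C * norm x"
      using local_resolvent_bound[OF refl T Nfin inv inj nh] by metis
    then show ?thesis using Nfin N_def unfolding G_def by blast
  qed
  then obtain N C \<delta> where G: "\<And>lam. lam \<in> frontier \<sigma> \<Longrightarrow> G lam (N lam) (C lam) (\<delta> lam)"
    by metis
  then have N: "\<And>lam. lam \<in> frontier \<sigma> \<Longrightarrow> finite_cdim (N lam)"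
    "\<And>lam. lam \<in> frontier \<sigma> \<Longrightarrow> \<exists>n. N lam = {x. (shift T lam ^^ n) x = 0}"
    and C: "\<And>lam. lam \<in> frontier \<sigma> \<Longrightarrow> C lam > 0" and \<delta>: "\<And>lam. lam \<in> frontier \<sigma> \<Longrightarrow> \<delta> lam > 0"
    and bound: "\<And>lam \<mu> x. lam \<in> frontier \<sigma> \<Longrightarrow> \<mu> \<in> resolvent_set T \<Longrightarrow> cmod (\<mu> - lam) < \<delta> lam \<Longrightarrow>
      \<exists>z\<in>N lam. norm (resolvent T \<mu> x - z) \<le> C lam * norm x"
    unfolding G_def by simp_all
  \<comment> \<open>If \<open>lam\<close> is no eigenvalue, then \<open>N lam\<close> is zero and
    the resolvent itself is bounded by \<open>C lam\<close> at points arbitrarily close to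
    \<open>lam\<close>, so the invertibility radius reaches \<open>lam\<close>.\<close>
  have eigen: "\<exists>v. v \<noteq> 0 \<and> T v = lam *\<^sub>C v" if lam: "lam \<in> frontier \<sigma>" for lam
  proof (rule ccontr)
    assume "\<not> ?thesis"
    then have inj: "shift T lam x = 0 \<Longrightarrow> x = 0" for x by (auto simp: shift_def)
    have "(shift T lam ^^ n) x = 0 \<Longrightarrow> x = 0" for n x
      by (induction n) (auto dest: inj)
    then have N0: "z = 0" if "z \<in> N lam" for z using N(2)[OF lam] that by auto
    define r where "r = min (\<delta> lam) (1 / C lam)"
    have "r > 0" using C[OF lam] \<delta>[OF lam] by (simp add: r_def)
    then obtain \<mu> where \<mu>: "\<mu> \<in> resolvent_set T" "cmod (\<mu> - lam) < r"
      using fr(1)[OF lam] by (auto simp: closure_approachable dist_norm)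
    have "norm (resolvent T \<mu> x) \<le> C lam * norm x" for x
      using bound[OF lam \<mu>(1), of x] \<mu>(2) N0 by (fastforce simp: r_def)
    moreover have "cmod (lam - \<mu>) * C lam < 1"
    proof -
      have "cmod (lam - \<mu>) < 1 / C lam" using \<mu>(2) by (simp add: r_def norm_minus_commute)
      then show ?thesis using C[OF lam] by (simp add: pos_less_divide_eq)
    qed
    ultimately have "lam \<in> resolvent_set T"
      using C[OF lam] by (intro resolvent_set_near[OF \<mu>(1)]) auto
    then show False using fr(2)[OF lam] by (simp add: \<sigma>_def)
  qed
  \<comment> \<open>An eigenvector for a nearby \<open>lam'\<close> lies outside
    \<open>N lam\<close>, and the resolvent along it blows up at \<open>lam'\<close>, against the
    bound modulo \<open>N lam\<close>.\<close>
  have isolated: "lam' = lam" if lam: "lam \<in> frontier \<sigma>" "lam' \<in> frontier \<sigma>" "cmod (lam' - lam) < \<delta> lam"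
    for lam lam'
  proof (rule ccontr)
    assume ne: "lam' \<noteq> lam"
    obtain v where v: "v \<noteq> 0" "T v = lam' *\<^sub>C v" using eigen[OF lam(2)] by blast
    obtain n where n: "N lam = {x. (shift T lam ^^ n) x = 0}" using N(2)[OF lam(1)] by blast
    have "(shift T lam ^^ n) v = (lam' - lam) ^ n *\<^sub>C v"
      by (rule shift_power_eigenvector[OF T v(2)])
    then have "v \<notin> N lam" using ne v(1) by (simp add: n)
    then obtain f :: "'a \<Rightarrow> complex" where f: "bounded_clinear f" "\<And>z. z \<in> N lam \<Longrightarrow> f z = 0" "f v = 1"
      using closed_csubspace_separation[OF closed_csubspace_finite_cdim[OF N(1)[OF lam(1)]]] by metis
    obtain L where L: "L > 0" "\<And>x. cmod (f x) \<le> L * norm x"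
      using bounded_clinear_pos[OF f(1)] by blast
    \<comment> \<open>The first entry keeps \<mu> within the region of the bound around
      \<open>lam\<close>; the second makes the product of the estimates less than 1.\<close>
    define r where "r = min (\<delta> lam - cmod (lam' - lam)) (1 / (L * (C lam * norm v)))"
    have "r > 0" using lam(3) L(1) C[OF lam(1)] v(1) by (simp add: r_def)
    then obtain \<mu> where \<mu>: "\<mu> \<in> resolvent_set T" "cmod (\<mu> - lam') < r"
      using fr(1)[OF lam(2)] by (auto simp: closure_approachable dist_norm)
    have "cmod (\<mu> - lam) \<le> cmod (\<mu> - lam') + cmod (lam' - lam)"
      using norm_triangle_ineq[of "\<mu> - lam'" "lam' - lam"] by simp
    then have "cmod (\<mu> - lam) < \<delta> lam" using \<mu>(2) by (simp add: r_def)
    then obtain z where z: "z \<in> N lam" "norm (resolvent T \<mu> v - z) \<le> C lam * norm v"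
      using bound[OF lam(1) \<mu>(1)] by blast
    have "T v - \<mu> *\<^sub>C v = (lam' - \<mu>) *\<^sub>C v"
      by (simp add: v(2) complex_vector.scale_left_diff_distrib)
    then have "(lam' - \<mu>) *\<^sub>C resolvent T \<mu> v = v"
      using resolvent(2)[OF \<mu>(1), of v] by (simp add: bounded_clinear_scale[OF resolvent(1)[OF \<mu>(1)]])
    then have "(lam' - \<mu>) * f (resolvent T \<mu> v) = 1"
      using f(3) by (metis bounded_clinear_scale'[OF f(1)])
    then have "(lam' - \<mu>) * f (resolvent T \<mu> v - z) = 1"
      using f(2)[OF z(1)] by (simp add: bounded_clinear_diff[OF f(1)])
    then have "1 = cmod (\<mu> - lam') * cmod (f (resolvent T \<mu> v - z))"
      by (metis norm_minus_commute norm_mult norm_one)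
    also have "\<dots> \<le> cmod (\<mu> - lam') * (L * (C lam * norm v))"
      using order_trans[OF L(2) mult_left_mono[OF z(2)]] L(1) by (intro mult_left_mono) auto
    also have "\<dots> < (1 / (L * (C lam * norm v))) * (L * (C lam * norm v))"
      using \<mu>(2) L(1) C[OF lam(1)] v(1) by (intro mult_strict_right_mono) (auto simp: r_def)
    also have "\<dots> = 1" using L(1) C[OF lam(1)] v(1) by simp
    finally show False by simp
  qed
  obtain K where K: "K > 0" "\<And>x. norm (T x) \<le> K * norm x"
    using bounded_clinear_pos[OF T] by blast
  have far: "z \<in> resolvent_set T" if "K < cmod z" for z
    using resolvent_set_far(1)[OF T K(2)] K(1) that by simp
  then have "\<sigma> \<subseteq> cball 0 K" by (force simp: \<sigma>_def)
  then have "compact \<sigma>" using \<sigma> by (meson bounded_cball bounded_subset compact_eq_bounded_closed)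
  have "finite (frontier \<sigma>)"
  proof (rule ccontr)
    assume "infinite (frontier \<sigma>)"
    then obtain lam where lam: "lam \<in> frontier \<sigma>" "lam islimpt frontier \<sigma>"
      using compact_frontier[OF \<open>compact \<sigma>\<close>] unfolding compact_eq_Bolzano_Weierstrass by blast
    then obtain lam' where "lam' \<in> frontier \<sigma>" "lam' \<noteq> lam" "dist lam' lam < \<delta> lam"
      using \<delta>[OF lam(1)] unfolding islimpt_approachable by blast
    then show False using isolated[OF lam(1)] by (simp add: dist_norm)
  qed
  moreover have "\<sigma> \<noteq> UNIV"
  proof
    assume "\<sigma> = UNIV"
    moreover have "of_real (K + 1) \<in> resolvent_set T"
      using K(1) by (intro far) (simp only: norm_of_real abs_of_pos)
    ultimately show False by (auto simp: \<sigma>_def)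
  qed
  ultimately have fin: "finite \<sigma>" "frontier \<sigma> = \<sigma>"
    using finite_of_finite_frontier[OF \<sigma>] by auto
  have "\<exists>B. finite B \<and> cspan B = N lam" if "lam \<in> \<sigma>" for lam
    using N(1) that fin(2) unfolding finite_cdim_def by blast
  then obtain B where B: "\<And>lam. lam \<in> \<sigma> \<Longrightarrow> finite (B lam)" "\<And>lam. lam \<in> \<sigma> \<Longrightarrow> cspan (B lam) = N lam"
    by metis
  \<comment> \<open>The sum of the subspaces \<open>N lam\<close>. If \<sigma> is empty,
    \<open>M\<close> is zero and the contradiction below arises in the same way.\<close>
  define M where "M = cspan (\<Union>lam\<in>\<sigma>. B lam)"
  have Mfin: "finite_cdim M" unfolding M_def using fin(1) B(1) by (intro finite_cdim_span) auto
  have NM: "N lam \<subseteq> M" if "lam \<in> \<sigma>" for lam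
    unfolding M_def B(2)[OF that, symmetric] using that by (intro complex_vector.span_mono) auto
  obtain e where e: "e \<notin> M" using Mfin inf by (metis UNIV_eq_I)
  obtain f :: "'a \<Rightarrow> complex" where f: "bounded_clinear f" "\<And>z. z \<in> M \<Longrightarrow> f z = 0" "f e = 1"
    using closed_csubspace_separation[OF closed_csubspace_finite_cdim[OF Mfin] e] by metis
  obtain L where L: "L > 0" "\<And>x. cmod (f x) \<le> L * norm x"
    using bounded_clinear_pos[OF f(1)] by blast
  have "f e = 0"
  proof (rule functional_eq_0_if_resolvent_bounded_near_spectrum[OF T f(1)])
    show "finite (- resolvent_set T)" using fin(1) by (simp add: \<sigma>_def)
    fix lam x assume "lam \<notin> resolvent_set T"
    then have lam: "lam \<in> \<sigma>" "lam \<in> frontier \<sigma>" using fin(2) by (auto simp: \<sigma>_def)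
    have "cmod (f (resolvent T \<mu> x)) \<le> L * (C lam * norm x)"
      if \<mu>: "\<mu> \<in> resolvent_set T" "cmod (\<mu> - lam) < \<delta> lam" for \<mu>
    proof -
      obtain z where z: "z \<in> N lam" "norm (resolvent T \<mu> x - z) \<le> C lam * norm x"
        using bound[OF lam(2) \<mu>] by blast
      have "f (resolvent T \<mu> x) = f (resolvent T \<mu> x - z)"
        using f(2) NM[OF lam(1)] z(1) by (auto simp: bounded_clinear_diff[OF f(1)])
      also have "cmod \<dots> \<le> L * (C lam * norm x)"
        using order_trans[OF L(2) mult_left_mono[OF z(2)]] L(1) by simp
      finally show ?thesis .
    qed
    then show "\<exists>B. \<forall>\<^sub>F \<mu> in at lam. \<mu> \<in> resolvent_set T \<longrightarrow> cmod (f (resolvent T \<mu> x)) \<le> B"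
      using \<delta>[OF lam(2)] unfolding eventually_at dist_norm by blast
  qed
  then show False using f(3) by simp
qed

theorem theorem2p6:
  fixes T :: "'a::complex_banach \<Rightarrow> 'a"
  assumes "\<not> finite_cdim (UNIV :: 'a set)"
    and "reflexive_space TYPE('a)"
    and "bounded_clinear T"
  shows "\<exists>Y. almost_invariant_half_space T Y \<and> defect T Y \<le> 1 \<and>
    ((\<nexists>c. T = scaleC c) \<longrightarrow> defect T Y = 1)"
proof -
  obtain Y e where "half_space Y" "T ` Y \<subseteq> adjoin Y e"
    using exists_half_space_defect_le_1[OF assms] by blast
  then show ?thesis by (rule defect_one_from_half_space[OF assms(3)])
qed

end
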